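(* Let $k\ge 2$ and let $\Omega\subset\mathbb{R}^2$ be a $k$-connected bounded smooth domain. Let $\mu>0$, $\beta>0$, $\gamma>1$ be constants, let $K\ge 0$ be a smooth function on $\partial\Omega$, and let $\rho_0\ge 0$ be a given function on $\Omega$ with $\int_\Omega\rho_0\,dx>0$ and mean value $\hat\rho_0=\frac1{|\Omega|}\int_\Omega\rho_0\,dx$. Consider the stationary system for $(\rho,u)$, $\rho\ge 0$, $u=(u_1,u_2)$, $$\mathrm{div}(\rho u)=0,\qquad \mathrm{div}(\rho u\otimes u)+\nabla\rho^\gamma=\mu\Delta u+\nabla\big((\mu+\rho^\beta)\,\mathrm{div}\,u\big)\quad\text{in }\Omega,$$ $$\int_\Omega\rho\,dx=\int_\Omega\rho_0\,dx,\qquad u\cdot n=0\ \text{ and }\ \mathrm{curl}\,u=-K\,u\cdot n^\bot\ \text{ on }\partial\Omega.$$ Then: (a) If $K$ is not identically $0$ on $\partial\Omega$, the unique smooth solution is the trivial one $\rho\equiv\hat\rho_0$, $u\equiv 0$. (b) If $K\equiv 0$ and $\Omega$ is a 2-connected domain whose boundary consists of two concentric circles (centred at the origin), then the non-vacuum smooth solutions are exactly those given by $$\rho^{\gamma-1}(z)=\frac{\gamma-1}{\gamma}\Big(C_2-\frac{C_1^2}{2|z|^2}\Big),\qquad u_1(z)-iu_2(z)=\frac{iC_1}{z},\qquad z=x_1+ix_2,$$ where $C_1,C_2$ are real numbers (such that the resulting $\rho$ is positive on $\overline\Omega$ and $\int_\Omega\rho\,dx=\int_\Omega\rho_0\,dx$).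 (c) If $K\equiv 0$ and $\Omega$ is any $k$-connected domain different from those in (b) (that is, $\partial\Omega$ does not consist of two concentric circles), then the only non-vacuum smooth solution is the trivial one $\rho\equiv\hat\rho_0$, $u\equiv 0$.
   Context: A $k$-connected bounded smooth domain $\Omega\subset\mathbb{R}^2$ is a bounded domain whose boundary is the union $\partial\Omega=\bigcup_{i=0}^{k-1}\Gamma_i$ of $k$ pairwise disjoint smooth simple closed curves, $\Gamma_0$ being the outermost one. $n=(n_1,n_2)$ is the unit outer normal on $\partial\Omega$ and $n^\bot=(n_2,-n_1)$. The convention for the curl is $\mathrm{curl}\,u=\partial_2u_1-\partial_1u_2$. "Smooth" means smooth up to the boundary; "non-vacuum" means $\rho>0$ on $\overline\Omega$. *)

theory Defs
  imports "HOL-Analysis.Analysis"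
begin

text \<open>
  The plane $R^2$ is identified with the type \<^typ>\<open>complex\<close>, $z = x_1 + i x_2$; a vector field
  $u = (u_1,u_2)$ is a function \<^typ>\<open>complex \<Rightarrow> complex\<close> with $u_1$ = \<^const>\<open>Re\<close> $u$ and
  $u_2$ = \<^const>\<open>Im\<close> $u$. All derivatives are real (Frechet) derivatives.
\<close>

subsection \<open>Smoothness\<close>

primrec Ck_on :: "nat \<Rightarrow> 'a::real_normed_vector set \<Rightarrow> ('a \<Rightarrow> 'b::real_normed_vector) \<Rightarrow> bool" where
  "Ck_on 0 U f \<longleftrightarrow> continuous_on U f"
| "Ck_on (Suc m) U f \<longleftrightarrow> (\<forall>x\<in>U. f differentiable (at x)) \<and>
     (\<forall>v. Ck_on m U (\<lambda>x. frechet_derivative f (at x) v))"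

text \<open>Meant for open sets only.\<close>

definition smooth_open :: "'a::real_normed_vector set \<Rightarrow> ('a \<Rightarrow> 'b::real_normed_vector) \<Rightarrow> bool" where
  "smooth_open U f \<longleftrightarrow> (\<forall>m. Ck_on m U f)"

text \<open>
  Smoothness on a set that need not be open (the closure of a domain: smoothness up to the boundary;
  a boundary curve: smoothness along the curve): existence of a smooth extension to a
  neighbourhood. It depends on the values of \<open>f\<close> on \<open>S\<close> only.
\<close>

definition smooth_set :: "'a::real_normed_vector set \<Rightarrow> ('a \<Rightarrow> 'b::real_normed_vector) \<Rightarrow> bool" where
  "smooth_set S f \<longleftrightarrow> (\<exists>U g. open U \<and> S \<subseteq> U \<and> smooth_open U g \<and> (\<forall>x\<in>S. g x = f x))"

subsection \<open>Multiply connected smooth domains\<close>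

text \<open>
  Regular parametrisations of smooth simple closed curves; periodicity on the whole line makes the
  curve smooth also at the point where it closes up.
\<close>

definition smooth_loop :: "(real \<Rightarrow> complex) \<Rightarrow> bool" where
  "smooth_loop p \<longleftrightarrow> smooth_open UNIV p \<and> (\<forall>t. p (t + 1) = p t) \<and> inj_on p {0..<1} \<and>
     (\<forall>t. vector_derivative p (at t) \<noteq> 0)"

definition smooth_simple_closed_curve :: "complex set \<Rightarrow> bool" where
  "smooth_simple_closed_curve C \<longleftrightarrow> (\<exists>p. smooth_loop p \<and> C = path_image p)"

definition connected_smooth_domain :: "nat \<Rightarrow> complex set \<Rightarrow> bool" where
  "connected_smooth_domain k \<Omega> \<longleftrightarrow>
     open \<Omega> \<and> connected \<Omega> \<and> \<Omega> \<noteq> {} \<and> bounded \<Omega> \<and>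
     (\<exists>\<Gamma>. (\<forall>i<k. smooth_simple_closed_curve (\<Gamma> i)) \<and> disjoint_family_on \<Gamma> {..<k} \<and>
          frontier \<Omega> = (\<Union>i<k. \<Gamma> i) \<and> (\<forall>i\<in>{1..<k}. \<Gamma> i \<subseteq> inside (\<Gamma> 0)))"

text \<open>
  \<open>outer_unit_normal \<Omega> x \<nu>\<close>: \<open>\<nu>\<close> is the unit normal to the boundary at \<open>x\<close> pointing out of \<open>\<Omega>\<close>. On a
  smooth domain there is exactly one such \<open>\<nu>\<close> at each boundary point.
\<close>

definition outer_unit_normal :: "complex set \<Rightarrow> complex \<Rightarrow> complex \<Rightarrow> bool" where
  "outer_unit_normal \<Omega> x \<nu> \<longleftrightarrow>
     norm \<nu> = 1 \<and>
     (\<exists>p s. smooth_loop p \<and> path_image p \<subseteq> frontier \<Omega> \<and> p s = x \<and>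
            inner \<nu> (vector_derivative p (at s)) = 0) \<and>
     (\<exists>e>0. \<forall>t. 0 < t \<and> t < e \<longrightarrow> x - t *\<^sub>R \<nu> \<in> \<Omega> \<and> x + t *\<^sub>R \<nu> \<notin> closure \<Omega>)"

definition perp :: "complex \<Rightarrow> complex" where
  "perp \<nu> = Complex (Im \<nu>) (- Re \<nu>)"

subsection \<open>Differential operators\<close>

definition pd1 :: "(complex \<Rightarrow> 'b::real_normed_vector) \<Rightarrow> complex \<Rightarrow> 'b" where
  "pd1 f x = frechet_derivative f (at x) 1"

definition pd2 :: "(complex \<Rightarrow> 'b::real_normed_vector) \<Rightarrow> complex \<Rightarrow> 'b" where
  "pd2 f x = frechet_derivative f (at x) \<i>"

definition grad :: "(complex \<Rightarrow> real) \<Rightarrow> complex \<Rightarrow> complex" where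
  "grad f x = Complex (pd1 f x) (pd2 f x)"

definition divg :: "(complex \<Rightarrow> complex) \<Rightarrow> complex \<Rightarrow> real" where
  "divg v x = pd1 (\<lambda>y. Re (v y)) x + pd2 (\<lambda>y. Im (v y)) x"

text \<open>The opposite sign of the more common convention.\<close>

definition curl :: "(complex \<Rightarrow> complex) \<Rightarrow> complex \<Rightarrow> real" where
  "curl v x = pd2 (\<lambda>y. Re (v y)) x - pd1 (\<lambda>y. Im (v y)) x"

definition laplacian :: "(complex \<Rightarrow> complex) \<Rightarrow> complex \<Rightarrow> complex" where
  "laplacian v x = pd1 (pd1 v) x + pd2 (pd2 v) x"

text \<open>The divergence of the tensor $v \otimes w$: its $j$-th component is $\sum_i \partial_i (v_i w_j)$.\<close>

definition div_tensor :: "(complex \<Rightarrow> complex) \<Rightarrow> (complex \<Rightarrow> complex) \<Rightarrow> complex \<Rightarrow> complex" where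
  "div_tensor v w x = pd1 (\<lambda>y. Re (v y) *\<^sub>R w y) x + pd2 (\<lambda>y. Im (v y) *\<^sub>R w y) x"

subsection \<open>The stationary system\<close>

text \<open>
  Differentiability of \<open>(\<mu> + \<rho>\<^sup>\<beta>) div u\<close> is part of the momentum equation: at a vacuum point, where
  \<open>\<rho>\<close> vanishes, it does not follow from smoothness of \<open>\<rho>\<close> and \<open>u\<close> when \<open>\<beta>\<close> is small. All other
  differentiated terms are differentiable because \<open>\<rho>\<close> and \<open>u\<close> are smooth and \<open>\<gamma> > 1\<close>.

  The boundary value of \<open>curl u\<close> is its limit from inside \<open>\<Omega>\<close>, since the values of \<open>u\<close> outside the
  closure of \<open>\<Omega>\<close> carry no meaning.
\<close>

definition smooth_solution ::
  "complex set \<Rightarrow> real \<Rightarrow> real \<Rightarrow> real \<Rightarrow> (complex \<Rightarrow> real) \<Rightarrow> (complex \<Rightarrow> real) \<Rightarrow>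
   (complex \<Rightarrow> real) \<Rightarrow> (complex \<Rightarrow> complex) \<Rightarrow> bool" where
  "smooth_solution \<Omega> \<mu> \<beta> \<gamma> K \<rho>0 \<rho> u \<longleftrightarrow>
     smooth_set (closure \<Omega>) \<rho> \<and> smooth_set (closure \<Omega>) u \<and>
     (\<forall>x\<in>closure \<Omega>. \<rho> x \<ge> 0) \<and>
     (\<forall>x\<in>\<Omega>. divg (\<lambda>y. \<rho> y *\<^sub>R u y) x = 0) \<and>
     (\<forall>x\<in>\<Omega>. (\<lambda>y. (\<mu> + \<rho> y powr \<beta>) * divg u y) differentiable (at x) \<and>
        div_tensor (\<lambda>y. \<rho> y *\<^sub>R u y) u x + grad (\<lambda>y. \<rho> y powr \<gamma>) x =
        \<mu> *\<^sub>R laplacian u x + grad (\<lambda>y. (\<mu> + \<rho> y powr \<beta>) * divg u y) x) \<and>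
     (LINT x:\<Omega>|lebesgue. \<rho> x) = (LINT x:\<Omega>|lebesgue. \<rho>0 x) \<and>
     (\<forall>x\<in>frontier \<Omega>. \<forall>\<nu>. outer_unit_normal \<Omega> x \<nu> \<longrightarrow>
        inner (u x) \<nu> = 0 \<and>
        (curl u \<longlongrightarrow> - K x * inner (u x) (perp \<nu>)) (at x within \<Omega>))"

definition nonvacuum :: "complex set \<Rightarrow> (complex \<Rightarrow> real) \<Rightarrow> bool" where
  "nonvacuum \<Omega> \<rho> \<longleftrightarrow> (\<forall>x\<in>closure \<Omega>. \<rho> x > 0)"

definition mean_value :: "complex set \<Rightarrow> (complex \<Rightarrow> real) \<Rightarrow> real" where
  "mean_value \<Omega> f = (LINT x:\<Omega>|lebesgue. f x) / measure lebesgue \<Omega>"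

text \<open>
  Fields are total functions, so equality with the trivial solution is asserted on the closure of
  \<open>\<Omega>\<close> only.
\<close>

definition trivial_solution ::
  "complex set \<Rightarrow> (complex \<Rightarrow> real) \<Rightarrow> (complex \<Rightarrow> real) \<Rightarrow> (complex \<Rightarrow> complex) \<Rightarrow> bool" where
  "trivial_solution \<Omega> \<rho>0 \<rho> u \<longleftrightarrow> (\<forall>x\<in>closure \<Omega>. \<rho> x = mean_value \<Omega> \<rho>0 \<and> u x = 0)"

definition bounded_by_concentric_circles :: "complex \<Rightarrow> complex set \<Rightarrow> bool" where
  "bounded_by_concentric_circles c \<Omega> \<longleftrightarrow>
     (\<exists>r R. 0 < r \<and> r < R \<and> frontier \<Omega> = sphere c r \<union> sphere c R)"

end

theory Submission imports Defs "HOL-Complex_Analysis.Complex_Analysis" begin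

text \<open>
  The proof rests on an energy identity. Testing the momentum equation with \<open>u\<close> shows that the energy
  flux \<open>V\<close>, which collects kinetic energy, pressure and viscous stress, satisfies
  \<open>div V = - (2 \<mu> + \<rho>\<^sup>\<beta>) (div u)\<^sup>2 - \<mu> (curl u)\<^sup>2\<close> in the domain, while the boundary conditions make
  its outer normal component equal to \<open>\<mu> K |u|\<^sup>2 \<ge> 0\<close>. The divergence theorem then leaves only
  \<open>div u = 0\<close> and \<open>curl u = 0\<close> (\<open>solution_potential\<close>). The divergence
  theorem enters as the inequality that the divergence of a field pointing outward at the boundary
  has a nonnegative integral (\<open>divergence_inequality\<close>). It is obtained from the translation
  invariance of Lebesgue measure by cutting the field off in a thin layer along the boundary; the
  layer is described by a local defining function of the domain, which exists by the Jordan curve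
  theorem (\<open>collar_exists\<close>).

  Now \<open>f = u\<^sub>1 - \<i> u\<^sub>2\<close> is holomorphic. If \<open>K\<close> is positive somewhere, the boundary conditions
  give \<open>u = 0\<close> on an arc of the boundary, and unique continuation gives \<open>u = 0\<close> everywhere
  (\<open>friction_stops_flow\<close>); then the pressure, hence the density, is constant.

  If \<open>K\<close> vanishes and there is no vacuum, the momentum equation becomes Bernoulli's law: the sum of
  \<open>|u|\<^sup>2 / 2\<close> and \<open>\<gamma> / (\<gamma> - 1) \<rho>\<^bsup>\<gamma> - 1\<^esup>\<close> is constant. By the continuity equation \<open>\<rho>\<close> is constant along
  stream lines, and so is \<open>|u|\<close> (\<open>bernoulli\<close>). For a nonzero holomorphic \<open>f\<close> this means that
  \<open>f' / f\<^sup>2\<close> is imaginary and therefore constant, so \<open>1 / f\<close> is an affine function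
  \<open>\<i> c z + d\<close> with real \<open>c\<close> (\<open>reciprocal_affine\<close>). As \<open>u\<close> is tangent to the boundary, the
  boundary curves would lie on straight lines if \<open>c = 0\<close>, which is impossible for closed curves; if
  \<open>c \<noteq> 0\<close>, they are circles around the pole of \<open>f\<close>, and a connected domain is bounded by at most
  two of these (\<open>rotation_boundary\<close>). Conversely, around the common centre of two circles the
  rotation is a solution by a direct computation (\<open>rotation_is_solution\<close>).
\<close>

section \<open>Calculus of smooth functions\<close>

text \<open>The stability of smoothness under algebraic operations is wanted for two things: all
  derivatives of smooth data are continuous, hence bounded, on the closure of the domain; and the
  rotating flows, given by a formula, have to be recognised as smooth.\<close>

lemma Ck_on_continuous: "Ck_on m U f \<Longrightarrow> continuous_on U f"
proof (cases m)
  case (Suc n)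
  assume "Ck_on m U f"
  then have "\<forall>x\<in>U. isCont f x"
    using Suc differentiable_imp_continuous_within by auto
  then show ?thesis
    by (simp add: continuous_at_imp_continuous_on)
qed auto

lemma Ck_on_SucD: "Ck_on (Suc m) U f \<Longrightarrow> Ck_on m U f"
proof (induction m arbitrary: f)
  case 0
  then show ?case using Ck_on_continuous by fastforce
next
  case (Suc m)
  then show ?case
    by (metis Ck_on.simps(2))
qed

lemma frechet_derivative_cong_open:
  assumes "open U" "x \<in> U" "\<And>y. y \<in> U \<Longrightarrow> f y = g y"
  shows "frechet_derivative f (at x) = frechet_derivative g (at x)"
proof -
  have "(f has_derivative D) (at x) \<longleftrightarrow> (g has_derivative D) (at x)" for D
    using assms by (metis has_derivative_transform_within_open)
  then show ?thesis
    by (simp add: frechet_derivative_def)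
qed

lemma differentiable_cong_open:
  assumes "open U" "x \<in> U" "\<And>y. y \<in> U \<Longrightarrow> f y = g y"
  shows "f differentiable (at x) \<longleftrightarrow> g differentiable (at x)"
  unfolding differentiable_def
  using assms by (metis has_derivative_transform_within_open)

lemma Ck_on_cong:
  assumes "open U" "\<And>y. y \<in> U \<Longrightarrow> f y = g y" "Ck_on m U f"
  shows "Ck_on m U g"
  using assms(2,3)
proof (induction m arbitrary: f g)
  case 0
  then show ?case using continuous_on_cong by fastforce
next
  case (Suc m)
  have "frechet_derivative f (at x) = frechet_derivative g (at x)" if "x \<in> U" for x
    by (rule frechet_derivative_cong_open[OF assms(1) that Suc.prems(1)])
  then have "Ck_on m U (\<lambda>x. frechet_derivative g (at x) v)" for v
    using Suc.prems Suc.IH[of "\<lambda>x. frechet_derivative f (at x) v"] by simp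
  moreover have "g differentiable (at x)" if "x \<in> U" for x
    using differentiable_cong_open[OF assms(1) that, of f g] Suc.prems that by auto
  ultimately show ?case by simp
qed

lemma Ck_on_subset: "Ck_on m U f \<Longrightarrow> V \<subseteq> U \<Longrightarrow> Ck_on m V f"
proof (induction m arbitrary: f)
  case 0
  then show ?case using continuous_on_subset by auto
next
  case (Suc m)
  then show ?case by (metis Ck_on.simps(2) subsetD)
qed

lemma smooth_open_subset: "smooth_open U f \<Longrightarrow> V \<subseteq> U \<Longrightarrow> smooth_open V f"
  unfolding smooth_open_def using Ck_on_subset by blast

lemma smooth_open_differentiable: "smooth_open U f \<Longrightarrow> x \<in> U \<Longrightarrow> f differentiable (at x)"
  unfolding smooth_open_def by (metis Ck_on.simps(2))

lemma smooth_open_continuous: "smooth_open U f \<Longrightarrow> continuous_on U f"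
  unfolding smooth_open_def using Ck_on_continuous by blast

lemma smooth_open_derivative:
  "smooth_open U f \<Longrightarrow> smooth_open U (\<lambda>x. frechet_derivative f (at x) v)"
  unfolding smooth_open_def by (metis Ck_on.simps(2))

lemma smooth_open_pd1: "smooth_open U f \<Longrightarrow> smooth_open U (pd1 f)"
  unfolding pd1_def by (rule smooth_open_derivative)

lemma smooth_open_pd2: "smooth_open U f \<Longrightarrow> smooth_open U (pd2 f)"
  unfolding pd2_def by (rule smooth_open_derivative)

lemma Ck_on_const: "Ck_on m U (\<lambda>x. c)"
  by (induction m arbitrary: c) auto

lemma smooth_open_const: "smooth_open U (\<lambda>x. c)"
  by (simp add: smooth_open_def Ck_on_const)

lemma Ck_on_bounded_linear:
  assumes "bounded_linear L" "open U" "Ck_on m U f"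
  shows "Ck_on m U (\<lambda>x. L (f x))"
  using assms(3)
proof (induction m arbitrary: f)
  case 0
  then show ?case
    using bounded_linear.continuous_on[OF assms(1)] by auto
next
  case (Suc m)
  have D: "((\<lambda>x. L (f x)) has_derivative (\<lambda>h. L (frechet_derivative f (at x) h))) (at x)"
    if "x \<in> U" for x
    using Suc.prems that
    by (intro bounded_linear.has_derivative[OF assms(1)] frechet_derivative_works[THEN iffD1]) auto
  have "Ck_on m U (\<lambda>x. L (frechet_derivative f (at x) v))" for v
    using Suc.prems by (intro Suc.IH) auto
  then have "Ck_on m U (\<lambda>x. frechet_derivative (\<lambda>x. L (f x)) (at x) v)" for v
    by (rule Ck_on_cong[OF assms(2), rotated]) (simp add: frechet_derivative_at[OF D, symmetric])
  then show ?case
    using differentiableI[OF D] by auto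
qed

lemma smooth_open_bounded_linear:
  "bounded_linear L \<Longrightarrow> open U \<Longrightarrow> smooth_open U f \<Longrightarrow> smooth_open U (\<lambda>x. L (f x))"
  unfolding smooth_open_def using Ck_on_bounded_linear by blast

lemma Ck_on_ident:
  assumes "open U" shows "Ck_on m U (\<lambda>x. x)"
proof (cases m)
  case (Suc n)
  have "frechet_derivative (\<lambda>x. x) (at x) v = v" for x v :: 'a
    by (metis frechet_derivative_at has_derivative_ident)
  then show ?thesis using Suc Ck_on_const by auto
qed auto

lemma smooth_open_ident: "open U \<Longrightarrow> smooth_open U (\<lambda>x. x)"
  by (simp add: smooth_open_def Ck_on_ident)

lemma Ck_on_add:
  assumes "open U" "Ck_on m U f" "Ck_on m U g"
  shows "Ck_on m U (\<lambda>x. f x + g x)"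
  using assms(2,3)
proof (induction m arbitrary: f g)
  case 0
  then show ?case by (auto intro: continuous_on_add)
next
  case (Suc m)
  have D: "((\<lambda>x. f x + g x) has_derivative
      (\<lambda>h. frechet_derivative f (at x) h + frechet_derivative g (at x) h)) (at x)"
    if "x \<in> U" for x
    using Suc.prems that by (intro has_derivative_add frechet_derivative_works[THEN iffD1]) auto
  have "Ck_on m U (\<lambda>x. frechet_derivative f (at x) v + frechet_derivative g (at x) v)" for v
    using Suc.prems by (intro Suc.IH) auto
  then have "Ck_on m U (\<lambda>x. frechet_derivative (\<lambda>x. f x + g x) (at x) v)" for v
    by (rule Ck_on_cong[OF assms(1), rotated]) (simp add: frechet_derivative_at[OF D, symmetric])
  then show ?case
    using differentiableI[OF D] by auto
qed

lemma Ck_on_scaleR: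
  fixes f :: "'a::real_normed_vector \<Rightarrow> real" and g :: "'a \<Rightarrow> 'b::real_normed_vector"
  assumes "open U" "Ck_on m U f" "Ck_on m U g"
  shows "Ck_on m U (\<lambda>x. f x *\<^sub>R g x)"
  using assms(2,3)
proof (induction m arbitrary: f g)
  case 0
  then show ?case by (auto intro: continuous_on_scaleR)
next
  case (Suc m)
  have D: "((\<lambda>x. f x *\<^sub>R g x) has_derivative
      (\<lambda>h. f x *\<^sub>R frechet_derivative g (at x) h + frechet_derivative f (at x) h *\<^sub>R g x)) (at x)"
    if "x \<in> U" for x
    using Suc.prems that by (intro has_derivative_scaleR frechet_derivative_works[THEN iffD1]) auto
  have "Ck_on m U (\<lambda>x. f x *\<^sub>R frechet_derivative g (at x) v + frechet_derivative f (at x) v *\<^sub>R g x)" for v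
    using Suc.prems Ck_on_SucD[OF Suc.prems(1)] Ck_on_SucD[OF Suc.prems(2)]
    by (intro Ck_on_add[OF assms(1)] Suc.IH) auto
  then have "Ck_on m U (\<lambda>x. frechet_derivative (\<lambda>x. f x *\<^sub>R g x) (at x) v)" for v
    by (rule Ck_on_cong[OF assms(1), rotated]) (simp add: frechet_derivative_at[OF D, symmetric])
  then show ?case
    using differentiableI[OF D] by auto
qed

lemma Ck_on_mult:
  fixes f g :: "'a::real_normed_vector \<Rightarrow> real"
  shows "open U \<Longrightarrow> Ck_on m U f \<Longrightarrow> Ck_on m U g \<Longrightarrow> Ck_on m U (\<lambda>x. f x * g x)"
  using Ck_on_scaleR[of U m f g] by simp

lemma Ck_on_powr:
  fixes f :: "'a::real_normed_vector \<Rightarrow> real"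
  assumes "open U" "Ck_on m U f" "\<And>x. x \<in> U \<Longrightarrow> f x > 0"
  shows "Ck_on m U (\<lambda>x. f x powr a)"
  using assms(2)
proof (induction m arbitrary: a)
  case 0
  then show ?case using assms(3) by (force intro: continuous_on_powr)
next
  case (Suc m)
  have D: "((\<lambda>x. f x powr a) has_derivative
      (\<lambda>h. (a * f x powr (a - 1)) * frechet_derivative f (at x) h)) (at x)"
    if "x \<in> U" for x
  proof -
    have "(f has_derivative frechet_derivative f (at x)) (at x)"
      using Suc.prems that by (intro frechet_derivative_works[THEN iffD1]) auto
    moreover have "((\<lambda>t. t powr a) has_real_derivative a * f x powr (a - 1)) (at (f x))"
      using assms(3)[OF that] by (rule has_real_derivative_powr)
    ultimately show ?thesis
      unfolding has_field_derivative_def using has_derivative_compose by fastforce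
  qed
  have N: "Ck_on m U (\<lambda>x. (a * f x powr (a - 1)) * frechet_derivative f (at x) v)" for v
    using Suc.prems Ck_on_SucD[OF Suc.prems]
    by (intro Ck_on_mult[OF assms(1)] Ck_on_const Suc.IH) auto
  have "Ck_on m U (\<lambda>x. frechet_derivative (\<lambda>x. f x powr a) (at x) v)" for v
    by (rule Ck_on_cong[OF assms(1) _ N[of v]]) (simp add: frechet_derivative_at[OF D, symmetric])
  then show ?case
    using differentiableI[OF D] by auto
qed

lemma smooth_open_add:
  "open U \<Longrightarrow> smooth_open U f \<Longrightarrow> smooth_open U g \<Longrightarrow> smooth_open U (\<lambda>x. f x + g x)"
  unfolding smooth_open_def using Ck_on_add by blast

lemma smooth_open_scaleR:
  "open U \<Longrightarrow> smooth_open U f \<Longrightarrow> smooth_open U g \<Longrightarrow> smooth_open U (\<lambda>x. f x *\<^sub>R g x)"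
  unfolding smooth_open_def using Ck_on_scaleR by blast

lemma smooth_open_mult:
  fixes f g :: "'a::real_normed_vector \<Rightarrow> real"
  shows "open U \<Longrightarrow> smooth_open U f \<Longrightarrow> smooth_open U g \<Longrightarrow> smooth_open U (\<lambda>x. f x * g x)"
  unfolding smooth_open_def using Ck_on_mult by blast

lemma smooth_open_powr:
  fixes f :: "'a::real_normed_vector \<Rightarrow> real"
  shows "open U \<Longrightarrow> smooth_open U f \<Longrightarrow> (\<And>x. x \<in> U \<Longrightarrow> f x > 0) \<Longrightarrow> smooth_open U (\<lambda>x. f x powr a)"
  unfolding smooth_open_def using Ck_on_powr by blast

section \<open>Partial derivatives\<close>

text \<open>Differentiability and the values of both partial derivatives in one statement: in this form the
  product and chain rules compute partial derivatives of compound fluxes.\<close>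

definition has_partials ::
  "(complex \<Rightarrow> 'b::real_normed_vector) \<Rightarrow> 'b \<Rightarrow> 'b \<Rightarrow> complex \<Rightarrow> bool" where
  "has_partials f a b x \<longleftrightarrow> (f has_derivative (\<lambda>h. Re h *\<^sub>R a + Im h *\<^sub>R b)) (at x)"

lemma has_partials_pd: "has_partials f a b x \<Longrightarrow> pd1 f x = a" "has_partials f a b x \<Longrightarrow> pd2 f x = b"
  unfolding has_partials_def pd1_def pd2_def
  by (metis (no_types, lifting) frechet_derivative_at one_complex.simps add.right_neutral scaleR_one scaleR_zero_left)
    (metis (no_types, lifting) frechet_derivative_at imaginary_unit.simps add.left_neutral scaleR_one scaleR_zero_left)

lemma has_partials_differentiable: "has_partials f a b x \<Longrightarrow> f differentiable (at x)"
  unfolding has_partials_def differentiable_def by blast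

lemma frechet_derivative_pd:
  assumes "f differentiable (at x)"
  shows "frechet_derivative f (at x) h = Re h *\<^sub>R pd1 f x + Im h *\<^sub>R pd2 f x"
proof -
  interpret bounded_linear "frechet_derivative f (at x)"
    using assms frechet_derivative_works has_derivative_bounded_linear by blast
  have "h = Re h *\<^sub>R 1 + Im h *\<^sub>R \<i>" by (simp add: complex_eq_iff)
  then have "frechet_derivative f (at x) h = frechet_derivative f (at x) (Re h *\<^sub>R 1 + Im h *\<^sub>R \<i>)" by simp
  then show ?thesis by (simp add: add scaleR pd1_def pd2_def)
qed

lemma has_partials_iff:
  "has_partials f a b x \<longleftrightarrow> f differentiable (at x) \<and> pd1 f x = a \<and> pd2 f x = b"
proof
  assume "f differentiable (at x) \<and> pd1 f x = a \<and> pd2 f x = b"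
  moreover from this have "frechet_derivative f (at x) = (\<lambda>h. Re h *\<^sub>R a + Im h *\<^sub>R b)"
    using frechet_derivative_pd by blast
  ultimately show "has_partials f a b x"
    unfolding has_partials_def using frechet_derivative_works by metis
qed (use has_partials_pd has_partials_differentiable in blast)

lemma has_partials_const: "has_partials (\<lambda>x. c) 0 0 x"
  by (simp add: has_partials_def)

lemma has_partials_add:
  "has_partials f a b x \<Longrightarrow> has_partials g c d x \<Longrightarrow> has_partials (\<lambda>x. f x + g x) (a + c) (b + d) x"
  unfolding has_partials_def
  by (drule (1) has_derivative_add) (simp add: algebra_simps)

lemma has_partials_diff:
  "has_partials f a b x \<Longrightarrow> has_partials g c d x \<Longrightarrow> has_partials (\<lambda>x. f x - g x) (a - c) (b - d) x"
  unfolding has_partials_def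
  by (drule (1) has_derivative_diff) (simp add: algebra_simps)

lemma has_partials_scaleR:
  "has_partials f a b x \<Longrightarrow> has_partials g c d x \<Longrightarrow>
   has_partials (\<lambda>x. f x *\<^sub>R g x) (a *\<^sub>R g x + f x *\<^sub>R c) (b *\<^sub>R g x + f x *\<^sub>R d) x"
  unfolding has_partials_def
  by (drule (1) has_derivative_scaleR) (simp add: algebra_simps)

lemma has_partials_mult:
  fixes f g :: "complex \<Rightarrow> real"
  shows "has_partials f a b x \<Longrightarrow> has_partials g c d x \<Longrightarrow>
   has_partials (\<lambda>x. f x * g x) (a * g x + f x * c) (b * g x + f x * d) x"
  using has_partials_scaleR[of f a b x g c d] by simp

lemma has_partials_bounded_linear:
  assumes "bounded_linear L" "has_partials f a b x"
  shows "has_partials (\<lambda>x. L (f x)) (L a) (L b) x"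
proof -
  have "L (Re h *\<^sub>R a + Im h *\<^sub>R b) = Re h *\<^sub>R L a + Im h *\<^sub>R L b" for h
    using assms(1) by (simp add: linear_simps)
  then show ?thesis
    using bounded_linear.has_derivative[OF assms(1), of f _ "at x"] assms(2)
    unfolding has_partials_def by fastforce
qed

lemma has_partials_cong_open:
  assumes "open U" "x \<in> U" "\<And>y. y \<in> U \<Longrightarrow> f y = g y" "has_partials f a b x"
  shows "has_partials g a b x"
  using has_derivative_transform_within_open[OF _ assms(1,2), of f _ UNIV g] assms(3,4)
  unfolding has_partials_def by blast

lemma pd_cong_open:
  assumes "open U" "x \<in> U" "\<And>y. y \<in> U \<Longrightarrow> f y = g y"
  shows "pd1 f x = pd1 g x" "pd2 f x = pd2 g x"
  unfolding pd1_def pd2_def using frechet_derivative_cong_open[OF assms] by auto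

lemma has_partials_smooth_open:
  "smooth_open U f \<Longrightarrow> x \<in> U \<Longrightarrow> has_partials f (pd1 f x) (pd2 f x) x"
  using has_partials_iff smooth_open_differentiable by blast

text \<open>The chain rule is wanted for a power of the density, which may vanish and has a
  differentiable power at zero only from the right; hence the one-sided derivative.\<close>

lemma has_partials_chain_nonneg:
  fixes f :: "complex \<Rightarrow> real"
  assumes "open U" "x \<in> U" "\<And>y. y \<in> U \<Longrightarrow> f y \<ge> 0" "has_partials f a b x"
    and "(g has_real_derivative c) (at (f x) within {0..})"
  shows "has_partials (\<lambda>y. g (f y)) (c * a) (c * b) x"
proof -
  have f: "(f has_derivative (\<lambda>h. Re h *\<^sub>R a + Im h *\<^sub>R b)) (at x within U)"
    using assms(4) unfolding has_partials_def by (rule has_derivative_at_withinI)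
  have "(g has_derivative (*) c) (at (f x) within f ` U)"
    using assms(3,5) unfolding has_field_derivative_def
    by (rule_tac has_derivative_subset) auto
  from has_derivative_in_compose[OF f this]
  show ?thesis
    unfolding has_partials_def at_within_open[OF assms(2,1)] by (simp add: algebra_simps)
qed

text \<open>At zero the difference quotient is \<open>t\<^bsup>\<gamma> - 1\<^esup>\<close>, which tends to zero because \<open>\<gamma> > 1\<close>; this keeps the
  pressure differentiable at vacuum points.\<close>

lemma powr_has_real_derivative_nonneg:
  fixes t :: real
  assumes "t \<ge> 0" "\<gamma> > 1"
  shows "((\<lambda>t. t powr \<gamma>) has_real_derivative \<gamma> * t powr (\<gamma> - 1)) (at t within {0..})"
proof (cases "t = 0")
  case False
  then show ?thesis
    using assms has_real_derivative_powr[of t \<gamma>] by (auto intro: has_field_derivative_at_within)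
next
  case True
  have "((\<lambda>y::real. y powr (\<gamma> - 1)) \<longlongrightarrow> 0 powr (\<gamma> - 1)) (at 0 within {0..})"
    using assms by (intro tendsto_powr' tendsto_intros) (auto simp: eventually_at_filter)
  then have "((\<lambda>y::real. y powr (\<gamma> - 1)) \<longlongrightarrow> 0) (at 0 within {0..})"
    by simp
  then have "((\<lambda>y::real. y powr \<gamma> / y) \<longlongrightarrow> 0) (at 0 within {0..})"
    by (rule Lim_transform_within[where d = 1]) (auto simp: powr_diff)
  then show ?thesis
    using True by (simp add: has_field_derivative_iff)
qed

lemma has_partials_powr:
  fixes f :: "complex \<Rightarrow> real"
  assumes "open U" "x \<in> U" "\<And>y. y \<in> U \<Longrightarrow> f y \<ge> 0" "has_partials f a b x" "\<gamma> > 1"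
  shows "has_partials (\<lambda>y. f y powr \<gamma>) (\<gamma> * f x powr (\<gamma> - 1) * a) (\<gamma> * f x powr (\<gamma> - 1) * b) x"
  using has_partials_chain_nonneg[OF assms(1-4) powr_has_real_derivative_nonneg] assms by auto

text \<open>Both mixed partial derivatives are limits of the second difference quotient over a small
  parallelogram, which is symmetric in the two directions.\<close>

lemma second_difference_mean_value:
  fixes f :: "'a::real_normed_vector \<Rightarrow> real"
  assumes "\<And>y. y \<in> ball x r \<Longrightarrow> f differentiable (at y)"
    and "\<And>y. y \<in> ball x r \<Longrightarrow> (\<lambda>z. frechet_derivative f (at z) v) differentiable (at y)"
    and "h > 0" "h * (norm v + norm w) < r"
  shows "\<exists>\<xi>. dist x \<xi> \<le> h * (norm v + norm w) \<and>
     f (x + h *\<^sub>R v + h *\<^sub>R w) - f (x + h *\<^sub>R v) - f (x + h *\<^sub>R w) + f x =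
     h\<^sup>2 * frechet_derivative (\<lambda>z. frechet_derivative f (at z) v) (at \<xi>) w"
proof -
  have near: "x + s *\<^sub>R v + t *\<^sub>R w \<in> ball x r \<and> dist x (x + s *\<^sub>R v + t *\<^sub>R w) \<le> h * (norm v + norm w)"
    if "0 \<le> s" "s \<le> h" "0 \<le> t" "t \<le> h" for s t
  proof -
    have "norm (s *\<^sub>R v + t *\<^sub>R w) \<le> s * norm v + t * norm w"
      using that norm_triangle_ineq[of "s *\<^sub>R v" "t *\<^sub>R w"] by simp
    also have "\<dots> \<le> h * norm v + h * norm w"
      using that by (intro add_mono mult_right_mono) auto
    finally have "norm (s *\<^sub>R v + t *\<^sub>R w) \<le> h * (norm v + norm w)" by (simp add: algebra_simps)
    moreover have "dist x (x + s *\<^sub>R v + t *\<^sub>R w) = norm (s *\<^sub>R v + t *\<^sub>R w)"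
      by (metis add.assoc add_diff_cancel_left' dist_norm norm_minus_commute)
    ultimately show ?thesis using assms(4) by simp
  qed
  define g where "g s = f (x + s *\<^sub>R v + h *\<^sub>R w) - f (x + s *\<^sub>R v + 0 *\<^sub>R w)" for s
  have Df: "((\<lambda>s. f (x + s *\<^sub>R v + t *\<^sub>R w)) has_real_derivative
       frechet_derivative f (at (x + s *\<^sub>R v + t *\<^sub>R w)) v) (at s)" if "0 \<le> s" "s \<le> h" "0 \<le> t" "t \<le> h" for s t
  proof -
    have 1: "(f has_derivative frechet_derivative f (at (x + s *\<^sub>R v + t *\<^sub>R w))) (at (x + s *\<^sub>R v + t *\<^sub>R w))"
      using assms(1) near[OF that] frechet_derivative_works by blast
    have "((\<lambda>s. x + s *\<^sub>R v + t *\<^sub>R w) has_derivative (\<lambda>h. h *\<^sub>R v)) (at s)"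
      by (auto intro!: derivative_eq_intros)
    from has_derivative_compose[OF this 1]
    have "((\<lambda>s. f (x + s *\<^sub>R v + t *\<^sub>R w)) has_derivative
       (\<lambda>h. frechet_derivative f (at (x + s *\<^sub>R v + t *\<^sub>R w)) (h *\<^sub>R v))) (at s)" .
    moreover have "frechet_derivative f (at (x + s *\<^sub>R v + t *\<^sub>R w)) (h *\<^sub>R v) =
        frechet_derivative f (at (x + s *\<^sub>R v + t *\<^sub>R w)) v * h" for h
      using has_derivative_linear[OF 1] by (simp add: linear_cmul)
    ultimately show ?thesis
      unfolding has_field_derivative_def by simp
  qed
  have "\<exists>z>0. z < h \<and> g h - g 0 = (h - 0) *
      (frechet_derivative f (at (x + z *\<^sub>R v + h *\<^sub>R w)) v - frechet_derivative f (at (x + z *\<^sub>R v + 0 *\<^sub>R w)) v)"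
    using assms(3) unfolding g_def by (intro MVT2 DERIV_diff Df) auto
  then obtain s where s: "0 < s" "s < h" "g h - g 0 = h *
      (frechet_derivative f (at (x + s *\<^sub>R v + h *\<^sub>R w)) v - frechet_derivative f (at (x + s *\<^sub>R v + 0 *\<^sub>R w)) v)"
    by auto
  let ?F = "\<lambda>z. frechet_derivative f (at z) v"
  have DF: "((\<lambda>t. ?F (x + s *\<^sub>R v + t *\<^sub>R w)) has_real_derivative
       frechet_derivative ?F (at (x + s *\<^sub>R v + t *\<^sub>R w)) w) (at t)" if "0 \<le> t" "t \<le> h" for t
  proof -
    have 1: "(?F has_derivative frechet_derivative ?F (at (x + s *\<^sub>R v + t *\<^sub>R w))) (at (x + s *\<^sub>R v + t *\<^sub>R w))"
      using assms(2) near[of s t] that s frechet_derivative_works by fastforce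
    have "((\<lambda>t. x + s *\<^sub>R v + t *\<^sub>R w) has_derivative (\<lambda>h. h *\<^sub>R w)) (at t)"
      by (auto intro!: derivative_eq_intros)
    from has_derivative_compose[OF this 1]
    have "((\<lambda>t. ?F (x + s *\<^sub>R v + t *\<^sub>R w)) has_derivative
       (\<lambda>h. frechet_derivative ?F (at (x + s *\<^sub>R v + t *\<^sub>R w)) (h *\<^sub>R w))) (at t)" .
    moreover have "frechet_derivative ?F (at (x + s *\<^sub>R v + t *\<^sub>R w)) (h *\<^sub>R w) =
        frechet_derivative ?F (at (x + s *\<^sub>R v + t *\<^sub>R w)) w * h" for h
      using has_derivative_linear[OF 1] by (simp add: linear_cmul)
    ultimately show ?thesis
      unfolding has_field_derivative_def by simp
  qed
  have "\<exists>z>0. z < h \<and> ?F (x + s *\<^sub>R v + h *\<^sub>R w) - ?F (x + s *\<^sub>R v + 0 *\<^sub>R w) = (h - 0) *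
      frechet_derivative ?F (at (x + s *\<^sub>R v + z *\<^sub>R w)) w"
    using assms(3) by (intro MVT2 DF) auto
  then obtain t where t: "0 < t" "t < h" "?F (x + s *\<^sub>R v + h *\<^sub>R w) - ?F (x + s *\<^sub>R v + 0 *\<^sub>R w) = h *
      frechet_derivative ?F (at (x + s *\<^sub>R v + t *\<^sub>R w)) w"
    by auto
  have "f (x + h *\<^sub>R v + h *\<^sub>R w) - f (x + h *\<^sub>R v) - f (x + h *\<^sub>R w) + f x = g h - g 0"
    by (simp add: g_def)
  also have "\<dots> = h\<^sup>2 * frechet_derivative ?F (at (x + s *\<^sub>R v + t *\<^sub>R w)) w"
    using s(3) t(3) by (simp add: power2_eq_square)
  finally show ?thesis
    using near[of s t] s t by (intro exI[of _ "x + s *\<^sub>R v + t *\<^sub>R w"]) auto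
qed

lemma mixed_derivatives_symmetric:
  fixes f :: "'a::real_normed_vector \<Rightarrow> real"
  assumes "open U" "x \<in> U" "smooth_open U f"
  shows "frechet_derivative (\<lambda>z. frechet_derivative f (at z) v) (at x) w =
         frechet_derivative (\<lambda>z. frechet_derivative f (at z) w) (at x) v"
proof (rule ccontr)
  let ?A = "\<lambda>y. frechet_derivative (\<lambda>z. frechet_derivative f (at z) v) (at y) w"
  let ?B = "\<lambda>y. frechet_derivative (\<lambda>z. frechet_derivative f (at z) w) (at y) v"
  assume "?A x \<noteq> ?B x"
  define e where "e = \<bar>?A x - ?B x\<bar> / 2"
  have "e > 0" using \<open>?A x \<noteq> ?B x\<close> by (simp add: e_def)
  have "continuous_on U ?A" "continuous_on U ?B"
    using assms(3) by (auto intro!: smooth_open_continuous smooth_open_derivative)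
  then have "isCont ?A x" "isCont ?B x"
    using assms(1,2) continuous_on_eq_continuous_at by blast+
  then obtain d1 d2 where d: "d1 > 0" "d2 > 0"
      "\<And>y. dist y x < d1 \<Longrightarrow> dist (?A y) (?A x) < e" "\<And>y. dist y x < d2 \<Longrightarrow> dist (?B y) (?B x) < e"
    using \<open>e > 0\<close> unfolding continuous_at_eps_delta by metis
  obtain d3 where d3: "d3 > 0" "ball x d3 \<subseteq> U"
    using assms(1,2) open_contains_ball by blast
  define r where "r = min d1 (min d2 d3)"
  define h where "h = r / (2 * (norm v + norm w + 1))"
  have "r > 0" using d d3 by (simp add: r_def)
  then have h: "h > 0" by (auto simp: h_def intro!: divide_pos_pos add_nonneg_pos)
  have "norm v + norm w < 2 * (norm v + norm w + 1)"
    using norm_ge_zero[of v] norm_ge_zero[of w] unfolding distrib_left by linarith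
  moreover have "norm v + norm w + 1 > 0"
    using norm_ge_zero[of v] norm_ge_zero[of w] by linarith
  ultimately have hr: "h * (norm v + norm w) < r"
    using \<open>r > 0\<close> by (simp add: h_def pos_divide_less_eq)
  have sub: "y \<in> U" if "y \<in> ball x r" for y
    using that d3 by (auto simp: r_def)
  have diff: "f differentiable (at y)" "(\<lambda>z. frechet_derivative f (at z) v) differentiable (at y)"
     "(\<lambda>z. frechet_derivative f (at z) w) differentiable (at y)" if "y \<in> ball x r" for y
    using sub[OF that] assms(3) smooth_open_derivative smooth_open_differentiable by blast+
  obtain a where a: "dist x a \<le> h * (norm v + norm w)"
     "f (x + h *\<^sub>R v + h *\<^sub>R w) - f (x + h *\<^sub>R v) - f (x + h *\<^sub>R w) + f x = h\<^sup>2 * ?A a"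
    using second_difference_mean_value[of x r f v h w] diff h hr by blast
  obtain b where b: "dist x b \<le> h * (norm w + norm v)"
     "f (x + h *\<^sub>R w + h *\<^sub>R v) - f (x + h *\<^sub>R w) - f (x + h *\<^sub>R v) + f x = h\<^sup>2 * ?B b"
    using second_difference_mean_value[of x r f w h v] diff h hr by (metis add.commute)
  have "f (x + h *\<^sub>R v + h *\<^sub>R w) - f (x + h *\<^sub>R v) - f (x + h *\<^sub>R w) + f x =
     f (x + h *\<^sub>R w + h *\<^sub>R v) - f (x + h *\<^sub>R w) - f (x + h *\<^sub>R v) + f x"
    by (simp add: algebra_simps)
  then have "?A a = ?B b"
    using a(2) b(2) h by simp
  moreover have "dist (?A a) (?A x) < e"
    using a(1) hr d(3)[of a] by (simp add: r_def dist_commute)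
  moreover have "dist (?B b) (?B x) < e"
    using b(1) hr d(4)[of b] by (simp add: r_def dist_commute add.commute)
  ultimately show False
    by (simp add: e_def dist_real_def abs_if split: if_splits)
qed

lemma pd_mixed:
  fixes f :: "complex \<Rightarrow> real"
  assumes "open U" "x \<in> U" "smooth_open U f"
  shows "pd1 (pd2 f) x = pd2 (pd1 f) x"
  using mixed_derivatives_symmetric[OF assms, of \<i> 1]
  unfolding pd1_def[abs_def] pd2_def[abs_def] by simp

section \<open>Integrals of derivatives, and thin neighbourhoods of curves\<close>

lemma lborel_integral_translation:
  fixes g :: "'a::euclidean_space \<Rightarrow> real"
  assumes "integrable lborel g"
  shows "integrable lborel (\<lambda>x. g (x + a))" "integral\<^sup>L lborel (\<lambda>x. g (x + a)) = integral\<^sup>L lborel g"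
proof -
  have m: "(+) a \<in> lborel \<rightarrow>\<^sub>M borel" by simp
  have "integrable (distr lborel borel ((+) a)) g"
    using assms by (simp only: lborel_distr_plus)
  then have "integrable lborel (\<lambda>x. g (a + x))"
    using integrable_distr[OF m] by blast
  then show "integrable lborel (\<lambda>x. g (x + a))" by (simp add: add.commute)
  have "integral\<^sup>L (distr lborel borel ((+) a)) g = integral\<^sup>L lborel (\<lambda>x. g (a + x))"
    using assms by (intro integral_distr) auto
  then show "integral\<^sup>L lborel (\<lambda>x. g (x + a)) = integral\<^sup>L lborel g"
    by (simp add: add.commute lborel_distr_plus)
qed

text \<open>Difference quotients have integral zero because Lebesgue measure is translation invariant, and
  they converge to the derivative boundedly.\<close>

lemma integral_derivative_compact_support:
  fixes g :: "'a::euclidean_space \<Rightarrow> real"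
  assumes diff: "\<And>x. g differentiable (at x)"
    and bnd: "\<And>x h. \<bar>frechet_derivative g (at x) h\<bar> \<le> B * norm h"
    and supp: "\<And>x. norm x > R \<Longrightarrow> g x = 0"
  shows "integrable lborel (\<lambda>x. frechet_derivative g (at x) v)"
    and "integral\<^sup>L lborel (\<lambda>x. frechet_derivative g (at x) v) = 0"
proof -
  have cont: "continuous_on UNIV g"
    using diff differentiable_imp_continuous_within by (auto simp: continuous_on_eq_continuous_within)
  have int_g: "integrable lborel g"
  proof -
    have "integrable lborel (\<lambda>x. indicator (cball 0 R) x *\<^sub>R g x)"
      using cont continuous_on_subset by (intro borel_integrable_compact) auto
    moreover have "(\<lambda>x. indicator (cball 0 R) x *\<^sub>R g x) = g"
      using supp by (auto simp: indicator_def fun_eq_iff not_le)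
    ultimately show ?thesis by simp
  qed
  have lip: "\<bar>g x - g y\<bar> \<le> B * norm (x - y)" for x y
  proof -
    have "norm (g x - g y) \<le> B * norm (x - y)"
      using diff bnd
      by (intro differentiable_bound[where S = UNIV and f' = "\<lambda>x. frechet_derivative g (at x)"]
          onorm_le frechet_derivative_works[THEN iffD1]) auto
    then show ?thesis by simp
  qed
  define q where "q n x = real (Suc n) * (g (x + (1 / real (Suc n)) *\<^sub>R v) - g x)" for n x
  have q_int: "integrable lborel (q n)" "integral\<^sup>L lborel (q n) = 0" for n
    unfolding q_def using lborel_integral_translation[OF int_g] int_g by auto
  have lim: "(\<lambda>n. q n x) \<longlonglongrightarrow> frechet_derivative g (at x) v" for x
  proof -
    have 1: "(g has_derivative frechet_derivative g (at x)) (at (x + 0 *\<^sub>R v))"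
      using frechet_derivative_works[THEN iffD1, OF diff[of x]] by simp
    have "((\<lambda>t. x + t *\<^sub>R v) has_derivative (\<lambda>h. h *\<^sub>R v)) (at 0)"
      by (auto intro!: derivative_eq_intros)
    from has_derivative_compose[OF this 1]
    have "((\<lambda>t. g (x + t *\<^sub>R v)) has_derivative (\<lambda>h. frechet_derivative g (at x) (h *\<^sub>R v))) (at 0)" .
    moreover have "frechet_derivative g (at x) (h *\<^sub>R v) = frechet_derivative g (at x) v * h" for h
      using has_derivative_linear[OF 1] by (simp add: linear_cmul)
    ultimately have "((\<lambda>t. g (x + t *\<^sub>R v)) has_real_derivative frechet_derivative g (at x) v) (at 0)"
      unfolding has_field_derivative_def by simp
    then have "(\<lambda>t. (g (x + t *\<^sub>R v) - g x) / t) \<midarrow>0\<rightarrow> frechet_derivative g (at x) v"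
      by (simp add: has_field_derivative_iff)
    moreover have "filterlim (\<lambda>n. 1 / real (Suc n)) (at 0) sequentially"
      using LIMSEQ_inverse_real_of_nat by (auto simp: filterlim_at inverse_eq_divide)
    ultimately have "(\<lambda>n. (g (x + (1 / real (Suc n)) *\<^sub>R v) - g x) / (1 / real (Suc n))) \<longlonglongrightarrow> frechet_derivative g (at x) v"
      by (rule filterlim_compose)
    then show ?thesis by (simp add: q_def mult.commute)
  qed
  have bound: "norm (q n x) \<le> B * norm v * indicator (cball 0 (R + norm v)) x" for n x
  proof (cases "x \<in> cball 0 (R + norm v)")
    case True
    have "\<bar>g (x + (1 / real (Suc n)) *\<^sub>R v) - g x\<bar> \<le> B * norm ((1 / real (Suc n)) *\<^sub>R v)"
      using lip[of "x + (1 / real (Suc n)) *\<^sub>R v" x] by simp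
    also have "\<dots> = B * norm v / real (Suc n)" by simp
    finally have "real (Suc n) * \<bar>g (x + (1 / real (Suc n)) *\<^sub>R v) - g x\<bar> \<le> B * norm v"
      by (simp add: pos_le_divide_eq mult.commute del: of_nat_Suc)
    moreover have "norm (q n x) = real (Suc n) * \<bar>g (x + (1 / real (Suc n)) *\<^sub>R v) - g x\<bar>"
      by (simp add: q_def abs_mult del: of_nat_Suc)
    ultimately show ?thesis using True by simp
  next
    case False
    have "norm ((1 / real (Suc n)) *\<^sub>R v) \<le> norm v"
      using divide_left_mono[of 1 "real (Suc n)" "norm v"] by simp
    then have "norm (x + (1 / real (Suc n)) *\<^sub>R v) > R"
      using False norm_diff_ineq[of x "(1 / real (Suc n)) *\<^sub>R v"] by simp
    moreover have "norm x > R"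
      using False norm_ge_zero[of v] by (simp del: norm_ge_zero)
    ultimately show ?thesis using supp False by (simp add: q_def)
  qed
  have dom: "integrable lborel (\<lambda>x. B * norm v * indicator (cball (0::'a) (R + norm v)) x)"
    using emeasure_lborel_cball_finite[of 0 "R + norm v"] unfolding infinity_ennreal_def
    by (intro integrable_mult_right integrable_real_indicator) auto
  have qm: "q n \<in> borel_measurable lborel" for n
    by (rule borel_measurable_integrable[OF q_int(1)])
  have meas: "(\<lambda>x. frechet_derivative g (at x) v) \<in> borel_measurable lborel"
    by (rule borel_measurable_LIMSEQ_real[OF lim qm])
  have lim': "AE x in lborel. (\<lambda>n. q n x) \<longlonglongrightarrow> frechet_derivative g (at x) v"
    using lim by simp
  have bound': "AE x in lborel. norm (q n x) \<le> B * norm v * indicator (cball 0 (R + norm v)) x" for n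
    using bound by simp
  show "integrable lborel (\<lambda>x. frechet_derivative g (at x) v)"
    by (rule integrable_dominated_convergence[OF meas qm dom lim' bound'])
  have "(\<lambda>n. integral\<^sup>L lborel (q n)) \<longlonglongrightarrow> integral\<^sup>L lborel (\<lambda>x. frechet_derivative g (at x) v)"
    by (rule integral_dominated_convergence[OF meas qm dom lim' bound'])
  then show "integral\<^sup>L lborel (\<lambda>x. frechet_derivative g (at x) v) = 0"
    unfolding q_int(2) by (simp add: LIMSEQ_const_iff)
qed

text \<open>Of order \<open>1 / e\<close> discs of radius of order \<open>e\<close> cover the \<open>e\<close>-neighbourhood of a curve.\<close>

lemma measure_neighbourhood_of_curve:
  fixes p :: "real \<Rightarrow> complex"
  assumes lip: "\<And>s t. s \<in> {0..1} \<Longrightarrow> t \<in> {0..1} \<Longrightarrow> dist (p s) (p t) \<le> L * \<bar>s - t\<bar>" and "L \<ge> 0"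
  shows "\<exists>C\<ge>0. \<forall>e. 0 < e \<and> e \<le> 1 \<longrightarrow> measure lborel {x. infdist x (path_image p) < e} \<le> C * e"
proof -
  define V where "V = unit_ball_vol (DIM(complex))"
  have "V \<ge> 0" by (simp add: V_def)
  have "measure lborel {x. infdist x (path_image p) < e} \<le> (3 * V * (L + 1)\<^sup>2) * e"
    if e: "0 < e" "e \<le> 1" for e
  proof -
    define N where "N = nat \<lceil>1 / e\<rceil>"
    have N: "real N \<ge> 1 / e" "real N < 1 / e + 1"
      using e by (auto simp: N_def of_nat_nat ceiling_correct) linarith+
    then have "real N > 0" using e by (smt (verit) divide_pos_pos)
    have N1: "1 / real N \<le> e"
      using N(1) e \<open>real N > 0\<close> by (simp add: field_simps)
    let ?F = "\<lambda>k. cball (p (real k / real N)) ((L + 1) * e)"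
    have sub: "{x. infdist x (path_image p) < e} \<subseteq> (\<Union>k\<in>{..N}. ?F k)"
    proof
      fix x assume "x \<in> {x. infdist x (path_image p) < e}"
      then have "infdist x (path_image p) < e" by simp
      moreover have "path_image p \<noteq> {}" by simp
      ultimately have "(INF a\<in>path_image p. dist x a) < e" by (simp add: infdist_def)
      then obtain a where "a \<in> path_image p" "dist x a < e"
        using cInf_lessD[of "dist x ` path_image p" e] by auto
      then obtain t where t: "t \<in> {0..1}" "dist x (p t) < e"
        by (auto simp: path_image_def)
      define k where "k = nat \<lfloor>t * real N\<rfloor>"
      have k: "real k \<le> t * real N" "t * real N < real k + 1"
        using t \<open>real N > 0\<close> by (auto simp: k_def of_nat_nat)
      then have "real k \<le> real N"
        using t mult_right_mono[of t 1 "real N"] by (auto simp del: of_nat_le_iff)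
      have 1: "real k / real N \<le> t" "t < real k / real N + 1 / real N"
        using k \<open>real N > 0\<close> by (simp_all add: field_simps)
      then have "\<bar>t - real k / real N\<bar> \<le> e" using N1 by linarith
      moreover have "real k / real N \<in> {0..1}"
        using \<open>real k \<le> real N\<close> \<open>real N > 0\<close> by simp
      ultimately have "dist (p t) (p (real k / real N)) \<le> L * e"
        using lip[OF t(1)] \<open>L \<ge> 0\<close> by (meson mult_left_mono order_trans)
      then have "dist x (p (real k / real N)) \<le> (L + 1) * e"
        using t(2) dist_triangle[of x "p (real k / real N)" "p t"] by (simp add: algebra_simps)
      then have "x \<in> ?F k" by (simp add: dist_commute)
      then show "x \<in> (\<Union>k\<in>{..N}. ?F k)"
        using \<open>real k \<le> real N\<close> by auto
    qed
    have "measure lborel {x. infdist x (path_image p) < e} \<le> measure lborel (\<Union>k\<in>{..N}. ?F k)"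
    proof (rule measure_mono_fmeasurable[OF sub])
      have "open {x. infdist x (path_image p) < e}"
        by (intro open_Collect_less continuous_intros)
      then show "{x. infdist x (path_image p) < e} \<in> sets lborel" by simp
      show "(\<Union>k\<in>{..N}. ?F k) \<in> fmeasurable lborel"
        by (intro fmeasurable.finite_UN) (auto intro!: fmeasurableI emeasure_lborel_cball_finite[unfolded infinity_ennreal_def])
    qed
    also have "\<dots> \<le> (\<Sum>k\<in>{..N}. measure lborel (?F k))"
      by (rule measure_UNION_le) auto
    also have "\<dots> = (\<Sum>k\<in>{..N}. V * ((L + 1) * e)\<^sup>2)"
      using \<open>L \<ge> 0\<close> e by (simp add: content_cball V_def)
    also have "\<dots> = (real N + 1) * (V * ((L + 1) * e)\<^sup>2)" by simp
    also have "\<dots> \<le> (3 / e) * (V * ((L + 1) * e)\<^sup>2)"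
    proof (rule mult_right_mono)
      have "1 \<le> 1 / e" using e by simp
      then show "real N + 1 \<le> 3 / e" using N by simp
    qed (use \<open>V \<ge> 0\<close> in simp)
    also have "\<dots> = (3 * V * (L + 1)\<^sup>2) * e"
      using e by (simp add: power2_eq_square field_simps)
    finally show ?thesis .
  qed
  moreover have "3 * V * (L + 1)\<^sup>2 \<ge> 0" using \<open>V \<ge> 0\<close> by simp
  ultimately show ?thesis by blast
qed

section \<open>Collars of smooth boundary curves\<close>

lemma smooth_loop_has_vector_derivative:
  assumes "smooth_loop p"
  shows "(p has_vector_derivative vector_derivative p (at t)) (at t)"
  using assms smooth_open_differentiable
  unfolding smooth_loop_def by (blast intro: vector_derivative_works[THEN iffD1])

lemma smooth_loop_continuous_derivative:
  assumes "smooth_loop p"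
  shows "continuous_on UNIV (\<lambda>t. vector_derivative p (at t))"
proof -
  have "vector_derivative p (at t) = frechet_derivative p (at t) 1" for t
    using fun_cong[OF frechet_derivative_at[OF smooth_loop_has_vector_derivative[OF assms, unfolded has_vector_derivative_def]], of 1]
    by simp
  moreover have "smooth_open UNIV p" using assms by (simp add: smooth_loop_def)
  ultimately show ?thesis
    using smooth_open_continuous[OF smooth_open_derivative, of UNIV p 1] by simp
qed

lemma smooth_loop_continuous: "smooth_loop p \<Longrightarrow> continuous_on S p"
  using smooth_open_continuous continuous_on_subset unfolding smooth_loop_def by blast

lemma smooth_loop_shift_int:
  assumes "smooth_loop p"
  shows "p (t + of_int n) = p t"
proof -
  have per: "p (t + 1) = p t" for t using assms by (simp add: smooth_loop_def)
  have nat: "p (t + real k) = p t" for t k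
  proof (induction k)
    case (Suc k)
    then show ?case using per[of "t + real k"] by (simp add: add.assoc add.commute[of 1])
  qed auto
  show ?thesis
  proof (cases "n \<ge> 0")
    case True
    then show ?thesis using nat[of t "nat n"] by simp
  next
    case False
    then show ?thesis using nat[of "t + of_int n" "nat (- n)"] by simp
  qed
qed

lemma smooth_loop_eqD:
  assumes "smooth_loop p" "p s = p t"
  shows "\<exists>n::int. t = s + of_int n"
proof -
  have "p (frac s) = p s" "p (frac t) = p t"
    using smooth_loop_shift_int[OF assms(1), of s "- \<lfloor>s\<rfloor>"] smooth_loop_shift_int[OF assms(1), of t "- \<lfloor>t\<rfloor>"]
    by (simp_all add: frac_def)
  moreover have "frac s \<in> {0..<1}" "frac t \<in> {0..<1}"
    by (simp_all add: frac_lt_1)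
  ultimately have "frac s = frac t"
    using assms unfolding smooth_loop_def by (metis inj_onD)
  then have "t = s + of_int (\<lfloor>t\<rfloor> - \<lfloor>s\<rfloor>)" by (simp add: frac_def)
  then show ?thesis by blast
qed

lemma smooth_loop_range: "smooth_loop p \<Longrightarrow> path_image p = range p"
proof
  assume p: "smooth_loop p"
  show "range p \<subseteq> path_image p"
  proof
    fix x assume "x \<in> range p"
    then obtain t where "x = p t" by auto
    then have "x = p (frac t)" using smooth_loop_shift_int[OF p, of t "- \<lfloor>t\<rfloor>"] by (simp add: frac_def)
    then show "x \<in> path_image p" by (auto simp: path_image_def frac_lt_1 less_imp_le)
  qed
qed (auto simp: path_image_def)

lemma smooth_loop_simple_path:
  assumes "smooth_loop p"
  shows "simple_path p" "pathfinish p = pathstart p"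
proof -
  have "x = y \<or> x = 0 \<and> y = 1 \<or> x = 1 \<and> y = 0"
    if xy: "x \<in> {0..1}" "y \<in> {0..1}" "p x = p y" for x y :: real
  proof -
    obtain n :: int where n: "y = x + of_int n" using smooth_loop_eqD[OF assms xy(3)] by blast
    then have "-1 \<le> n" "n \<le> 1" using xy by auto
    then have "n = -1 \<or> n = 0 \<or> n = 1" by linarith
    then show ?thesis using n xy by auto
  qed
  then show "simple_path p"
    using smooth_loop_continuous[OF assms] by (auto simp: simple_path_def path_def loop_free_def)
  show "pathfinish p = pathstart p"
    using assms unfolding smooth_loop_def pathfinish_def pathstart_def by (metis add.left_neutral)
qed

lemma smooth_loop_lipschitz:
  assumes "smooth_loop p"
  shows "\<exists>L\<ge>0. \<forall>s\<in>{0..1}. \<forall>t\<in>{0..1}. dist (p s) (p t) \<le> L * \<bar>s - t\<bar>"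
proof -
  have "continuous_on {0..1} (\<lambda>t. vector_derivative p (at t))"
    using smooth_loop_continuous_derivative[OF assms] by (rule continuous_on_subset) simp
  then have "compact ((\<lambda>t. vector_derivative p (at t)) ` {0..1})"
    by (intro compact_continuous_image) auto
  then have "\<exists>L. \<forall>x\<in>(\<lambda>t. vector_derivative p (at t)) ` {0..1}. norm x \<le> L"
    by (auto dest!: compact_imp_bounded simp: bounded_iff)
  then obtain L where L: "\<And>t. t \<in> {0..1} \<Longrightarrow> norm (vector_derivative p (at t)) \<le> L"
    by blast
  have "dist (p s) (p t) \<le> L * \<bar>s - t\<bar>" if "s \<in> {0..1}" "t \<in> {0..1}" for s t
  proof -
    have "norm (p s - p t) \<le> L * norm (s - t)"
    proof (rule differentiable_bound[where S = "{0..1}" and f' = "\<lambda>t h. h *\<^sub>R vector_derivative p (at t)"])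
      show "(p has_derivative (\<lambda>h. h *\<^sub>R vector_derivative p (at x))) (at x within {0..1})" for x
        using smooth_loop_has_vector_derivative[OF assms, of x]
        unfolding has_vector_derivative_def by (rule has_derivative_at_withinI)
      show "onorm (\<lambda>h. h *\<^sub>R vector_derivative p (at x)) \<le> L" if "x \<in> {0..1}" for x
        using L[OF that] by (intro onorm_le) (auto simp: mult.commute[of L] mult_left_mono)
    qed (use that in auto)
    then show ?thesis by (simp add: dist_norm)
  qed
  moreover have "L \<ge> 0"
    by (rule order_trans[OF norm_ge_zero L[of 0]]) simp
  ultimately show ?thesis by blast
qed

text \<open>A point of a simple closed curve close to \<open>p s0\<close> has a parameter close to \<open>s0\<close> modulo the
  period: on the compact remainder of a period the curve keeps a positive distance from \<open>p s0\<close>.\<close>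

lemma smooth_loop_near:
  assumes "smooth_loop p" "\<delta> > 0"
  obtains \<epsilon> where "\<epsilon> > 0" "\<And>t. dist (p t) (p s0) < \<epsilon> \<Longrightarrow> \<exists>n::int. \<bar>t - of_int n - s0\<bar> < \<delta>"
proof -
  let ?K = "{s0 - 1/2..s0 + 1/2} - {s0 - \<delta><..<s0 + \<delta>}"
  have cpt: "compact ?K" by (intro compact_diff) auto
  have ne: "p s0 \<notin> p ` ?K"
  proof
    assume "p s0 \<in> p ` ?K"
    then obtain t where t: "t \<in> ?K" "p s0 = p t" by (rule imageE) blast
    then obtain n :: int where n: "t = s0 + of_int n" using smooth_loop_eqD[OF assms(1)] by blast
    with t have "\<bar>real_of_int n\<bar> \<le> 1/2" by auto
    then have "n = 0" by linarith
    then show False using n t assms(2) by auto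
  qed
  have "closed (p ` ?K)"
    using cpt smooth_loop_continuous[OF assms(1)] compact_continuous_image compact_imp_closed by blast
  then obtain \<epsilon> where \<epsilon>: "\<epsilon> > 0" "ball (p s0) \<epsilon> \<inter> p ` ?K = {}"
    using ne by (metis separate_point_closed disjoint_iff mem_ball not_le)
  show thesis
  proof
    show "\<epsilon> > 0" by fact
    fix t assume t: "dist (p t) (p s0) < \<epsilon>"
    define n where "n = \<lfloor>t - s0 + 1/2\<rfloor>"
    have "t - of_int n \<in> {s0 - 1/2..s0 + 1/2}"
      unfolding n_def using floor_correct[of "t - s0 + 1/2"] by (simp, linarith)
    moreover have "p (t - of_int n) = p t"
      using smooth_loop_shift_int[OF assms(1), of t "- n"] by simp
    moreover have "p t \<in> ball (p s0) \<epsilon>" using t by (simp add: dist_commute)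
    ultimately have "t - of_int n \<in> {s0 - \<delta><..<s0 + \<delta>}"
      using \<epsilon>(2) by (metis DiffI disjoint_iff imageI)
    then show "\<exists>n::int. \<bar>t - of_int n - s0\<bar> < \<delta>" by (intro exI[of _ n]) auto
  qed
qed

text \<open>Near one of its points a regular curve is a graph over its tangent there. The function \<open>d\<close> below
  is the height above this graph, up to a constant factor.\<close>

lemma smooth_loop_collar:
  assumes p: "smooth_loop p" and e: "e > 0"
  obtains B d gd C where "open B" "p s0 \<in> B" "B \<subseteq> ball (p s0) e"
    "\<And>x. x \<in> B \<Longrightarrow> (d has_derivative inner (gd x)) (at x)"
    "continuous_on B gd" "\<And>x. x \<in> B \<Longrightarrow> gd x \<noteq> 0"
    "\<And>x. x \<in> B \<Longrightarrow> d x = 0 \<longleftrightarrow> x \<in> path_image p"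
    "connected {x \<in> B. d x > 0}" "connected {x \<in> B. d x < 0}"
    "C \<ge> 0" "\<And>x. x \<in> B \<Longrightarrow> infdist x (path_image p) \<le> C * \<bar>d x\<bar>"
proof -
  let ?p' = "\<lambda>t. vector_derivative p (at t)"
  \<comment> \<open>\<open>T\<close> and \<open>N\<close> are the tangent and a normal at \<open>p s0\<close>, both of length \<open>sqrt m\<close>; the curve is the
    graph \<open>x \<bullet> N = h (x \<bullet> T)\<close>.\<close>
  define T where "T = ?p' s0"
  define N where "N = \<i> * T"
  define m where "m = inner T T"
  have "T \<noteq> 0" using p by (simp add: T_def smooth_loop_def)
  then have m: "m > 0" by (simp add: m_def)
  have NN: "inner N N = m" "inner T N = 0" "inner N T = 0"
    by (simp_all add: N_def m_def inner_complex_def)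
  have decomp: "m *\<^sub>R x = inner x T *\<^sub>R T + inner x N *\<^sub>R N" for x
    by (simp add: m_def N_def inner_complex_def complex_eq_iff algebra_simps)
  have eqI: "x = y" if "inner x T = inner y T" "inner x N = inner y N" for x y
    using decomp[of x] decomp[of y] that m by (metis less_irrefl scaleR_left_imp_eq)
  have contp': "continuous_on S ?p'" for S
    using smooth_loop_continuous_derivative[OF p] continuous_on_subset by blast
  have DT: "((\<lambda>s. inner (p s) v) has_real_derivative inner (?p' s) v) (at s)" for s v
    using smooth_loop_has_vector_derivative[OF p, of s] unfolding has_vector_derivative_def has_field_derivative_def
    by (auto intro!: derivative_eq_intros simp: mult.commute)
  define \<tau> where "\<tau> s = inner (p s) T" for s
  have contin: "isCont (\<lambda>s. inner (?p' s) T) s0"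
    using contp'[of UNIV] by (intro continuous_intros) (auto simp: continuous_on_eq_continuous_at)
  have "\<forall>\<^sub>F s in at s0. inner (?p' s) T > 0"
    using contin m by (intro order_tendstoD(1)[where y = "inner (?p' s0) T"]) (auto simp: isCont_def T_def m_def)
  then obtain \<delta>' where \<delta>': "\<delta>' > 0" "\<And>s. s \<noteq> s0 \<Longrightarrow> dist s s0 < \<delta>' \<Longrightarrow> inner (?p' s) T > 0"
    unfolding eventually_at by blast
  define \<delta> where "\<delta> = \<delta>' / 2"
  define a b where "a = s0 - \<delta>" and "b = s0 + \<delta>"
  have \<delta>: "\<delta> > 0" using \<delta>' by (simp add: \<delta>_def)
  have pos: "inner (?p' s) T > 0" if "s \<in> {a..b}" for s
  proof (cases "s = s0")
    case True then show ?thesis using m by (simp add: T_def m_def)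
  next
    case False
    then show ?thesis using that \<delta>' by (intro \<delta>'(2)) (auto simp: a_def b_def \<delta>_def dist_real_def)
  qed
  have mono: "\<tau> s < \<tau> t" if st: "s \<in> {a..b}" "t \<in> {a..b}" "s < t" for s t
  proof (rule DERIV_pos_imp_increasing[OF st(3)])
    fix x assume "s \<le> x" "x \<le> t"
    then have "inner (?p' x) T > 0" using st by (intro pos) auto
    then show "\<exists>y. (\<tau> has_real_derivative y) (at x) \<and> 0 < y"
      using DT[of T x] unfolding \<tau>_def by blast
  qed
  have inj: "inj_on \<tau> {a..b}"
    using mono by (intro linorder_inj_onI) (metis less_irrefl, auto)
  have \<tau>cont: "continuous_on {a..b} \<tau>"
    unfolding \<tau>_def by (intro continuous_intros smooth_loop_continuous p)
  define \<sigma> where "\<sigma> = the_inv_into {a..b} \<tau>"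
  have \<sigma>\<tau>: "\<sigma> (\<tau> s) = s" if "s \<in> {a..b}" for s
    using that inj by (simp add: \<sigma>_def the_inv_into_f_f)
  have ab: "a < s0" "s0 < b" "a < b" using \<delta> by (auto simp: a_def b_def)
  have im: "{\<tau> a..\<tau> b} \<subseteq> \<tau> ` {a..b}"
  proof
    fix y assume "y \<in> {\<tau> a..\<tau> b}"
    then have "\<exists>x\<ge>a. x \<le> b \<and> \<tau> x = y" using \<tau>cont ab by (intro IVT') auto
    then show "y \<in> \<tau> ` {a..b}" by auto
  qed
  have \<sigma>cont: "continuous_on (\<tau> ` {a..b}) \<sigma>"
    using \<sigma>\<tau> by (intro continuous_on_inv[OF \<tau>cont]) auto
  define J where "J = {\<tau> a<..<\<tau> b}"
  have J: "\<sigma> y \<in> {a..b} \<and> \<tau> (\<sigma> y) = y" if "y \<in> J" for y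
  proof -
    from that have "y \<in> \<tau> ` {a..b}" using im by (auto simp: J_def)
    then obtain s where "s \<in> {a..b}" "y = \<tau> s" by (rule imageE) blast
    then show ?thesis using \<sigma>\<tau> by simp
  qed
  have "open J" by (simp add: J_def)
  have \<sigma>J: "continuous_on J \<sigma>"
    using \<sigma>cont by (rule continuous_on_subset) (use im in \<open>auto simp: J_def\<close>)
  define h where "h y = inner (p (\<sigma> y)) N" for y
  define h' where "h' y = inner (?p' (\<sigma> y)) N * inverse (inner (?p' (\<sigma> y)) T)" for y
  have Dh: "(h has_real_derivative h' y) (at y)" if "y \<in> J" for y
  proof -
    have "(\<sigma> has_real_derivative inverse (inner (?p' (\<sigma> y)) T)) (at y)"
    proof (rule DERIV_inverse_function[where f = \<tau> and a = "\<tau> a" and b = "\<tau> b"])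
      show "(\<tau> has_real_derivative inner (?p' (\<sigma> y)) T) (at (\<sigma> y))"
        unfolding \<tau>_def by (rule DT)
      show "inner (?p' (\<sigma> y)) T \<noteq> 0" using pos[of "\<sigma> y"] J[OF that] by auto
      show "isCont \<sigma> y" using \<sigma>J \<open>open J\<close> that continuous_on_eq_continuous_at by blast
    qed (use that J in \<open>auto simp: J_def\<close>)
    from DERIV_chain2[OF DT this] show ?thesis by (simp add: h_def[abs_def] h'_def)
  qed
  have hcont: "continuous_on J h" unfolding h_def
    by (intro continuous_intros continuous_on_compose2[OF smooth_loop_continuous[OF p, of UNIV] \<sigma>J]) auto
  have h'cont: "continuous_on J h'" unfolding h'_def
    by (intro continuous_intros continuous_on_compose2[OF contp'[of UNIV] \<sigma>J]) (use pos J in \<open>force+\<close>)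
  define d where "d x = inner x N - h (inner x T)" for x
  define gd where "gd x = N - h' (inner x T) *\<^sub>R T" for x
  define y0 where "y0 = \<tau> s0"
  have y0: "y0 \<in> J" using mono ab by (auto simp: J_def y0_def)
  have \<sigma>y0: "\<sigma> y0 = s0" using \<sigma>\<tau> ab by (simp add: y0_def)
  obtain \<epsilon>1 where \<epsilon>1: "\<epsilon>1 > 0" "\<And>t. dist (p t) (p s0) < \<epsilon>1 \<Longrightarrow> \<exists>n::int. \<bar>t - of_int n - s0\<bar> < \<delta>"
    using smooth_loop_near[OF p \<delta>] by blast
  define e' where "e' = min e \<epsilon>1 * norm T / 4"
  have e': "e' > 0" using e \<epsilon>1 \<open>T \<noteq> 0\<close> by (simp add: e'_def)
  have "isCont h y0" using hcont \<open>open J\<close> y0 continuous_on_eq_continuous_at by blast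
  then obtain \<alpha>1 where \<alpha>1: "\<alpha>1 > 0" "\<And>y. dist y y0 < \<alpha>1 \<Longrightarrow> dist (h y) (h y0) < e'"
    unfolding continuous_at_eps_delta using e' by metis
  obtain \<alpha>2 where \<alpha>2: "\<alpha>2 > 0" "ball y0 \<alpha>2 \<subseteq> J" using \<open>open J\<close> y0 open_contains_ball by blast
  define \<alpha> where "\<alpha> = min e' (min \<alpha>1 \<alpha>2)"
  have \<alpha>: "\<alpha> > 0" using e' \<alpha>1 \<alpha>2 by (simp add: \<alpha>_def)
  define B where "B = {x. inner x T \<in> ball y0 \<alpha> \<and> \<bar>d x\<bar> < e'}"
  let ?S = "(\<lambda>x. inner x T) -` ball y0 \<alpha>"
  have BJ: "inner x T \<in> J" if "x \<in> ?S" for x using that \<alpha>2 by (auto simp: \<alpha>_def)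
  have "open ?S" by (intro open_vimage continuous_intros) auto
  have dcont: "continuous_on ?S d" unfolding d_def
    by (intro continuous_intros continuous_on_compose2[OF hcont]) (use BJ in auto)
  have Beq: "B = ?S \<inter> d -` {-e'<..<e'}" by (auto simp: B_def)
  have "open B" unfolding Beq
    by (rule continuous_open_preimage[OF dcont \<open>open ?S\<close>]) simp
  have x0B: "p s0 \<in> B"
    using \<alpha> e' by (simp add: B_def d_def h_def \<sigma>y0 y0_def[symmetric] \<tau>_def[symmetric])
  have Bsmall: "dist x (p s0) < min e \<epsilon>1" if "x \<in> B" for x
  proof -
    have 1: "\<bar>inner (x - p s0) T\<bar> < e'"
      using that by (auto simp: B_def \<alpha>_def y0_def \<tau>_def dist_real_def inner_diff_left)
    have "\<bar>h (inner x T) - h y0\<bar> < e'"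
      using that \<alpha>1(2)[of "inner x T"] by (auto simp: B_def \<alpha>_def dist_real_def)
    moreover have "inner (x - p s0) N = d x + (h (inner x T) - h y0)"
      by (simp add: d_def h_def \<sigma>y0 inner_diff_left)
    ultimately have 2: "\<bar>inner (x - p s0) N\<bar> < 2 * e'"
      using that by (auto simp: B_def)
    have nN: "norm N = norm T" by (simp add: N_def norm_mult)
    have mT: "m = norm T * norm T" by (simp add: m_def dot_square_norm power2_eq_square)
    have "m * norm (x - p s0) = norm (inner (x - p s0) T *\<^sub>R T + inner (x - p s0) N *\<^sub>R N)"
      using decomp[of "x - p s0"] m by (metis abs_of_pos norm_scaleR)
    also have "\<dots> \<le> \<bar>inner (x - p s0) T\<bar> * norm T + \<bar>inner (x - p s0) N\<bar> * norm T"
      using norm_triangle_ineq[of "inner (x - p s0) T *\<^sub>R T" "inner (x - p s0) N *\<^sub>R N"] by (simp add: nN)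
    also have "\<dots> < 3 * e' * norm T"
      using 1 2 \<open>T \<noteq> 0\<close> by (simp add: distrib_right[symmetric])
    finally have "norm T * norm (x - p s0) * norm T < 3 * e' * norm T" by (simp add: mT mult_ac)
    then have "norm T * norm (x - p s0) < 3 * e'" using \<open>T \<noteq> 0\<close> by (simp add: mult.commute)
    also have "\<dots> < min e \<epsilon>1 * norm T" using \<open>T \<noteq> 0\<close> e \<epsilon>1(1) unfolding e'_def by (simp add: mult.commute)
    finally show ?thesis using \<open>T \<noteq> 0\<close> by (simp add: dist_norm mult.commute)
  qed
  have on_curve: "d x = 0 \<longleftrightarrow> x \<in> path_image p" if xB: "x \<in> B" for x
  proof
    assume "d x = 0"
    moreover have "inner x T \<in> J" using that BJ by (auto simp: B_def)
    ultimately have "x = p (\<sigma> (inner x T))"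
      using J by (intro eqI) (auto simp: d_def h_def \<tau>_def)
    then show "x \<in> path_image p" using smooth_loop_range[OF p] by auto
  next
    assume "x \<in> path_image p"
    then obtain t where t: "x = p t" by (auto simp: path_image_def)
    then obtain n :: int where "\<bar>t - of_int n - s0\<bar> < \<delta>"
      using \<epsilon>1(2)[of t] Bsmall[OF xB] t by auto
    then have "t - of_int n \<in> {a..b}" by (auto simp: a_def b_def)
    moreover have "x = p (t - of_int n)"
      using smooth_loop_shift_int[OF p, of t "-n"] t by simp
    ultimately have "\<sigma> (inner x T) = t - of_int n"
      using \<sigma>\<tau> by (simp add: \<tau>_def)
    then show "d x = 0" using \<open>x = p (t - of_int n)\<close> by (simp add: d_def h_def)
  qed
  \<comment> \<open>\<open>\<Psi>\<close> inverts \<open>x \<mapsto> (x \<bullet> T, d x)\<close>, which maps \<open>B\<close> to a rectangle: so both sides of the curve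
    in \<open>B\<close> are connected.\<close>
  define \<Psi> where "\<Psi> = (\<lambda>(y, c). (1 / m) *\<^sub>R (y *\<^sub>R T + (c + h y) *\<^sub>R N))"
  have \<Psi>T: "inner (\<Psi> (y, c)) T = y" "inner (\<Psi> (y, c)) N = c + h y" for y c
    using m NN by (simp_all add: \<Psi>_def inner_add_left m_def[symmetric])
  have \<Psi>inv: "\<Psi> (inner x T, d x) = x" for x
    by (rule eqI) (simp_all add: \<Psi>T d_def)
  have conn: "connected {x \<in> B. d x \<in> I}" if "I = {0<..<e'} \<or> I = {-e'<..<0}" for I
  proof -
    have "{x \<in> B. d x \<in> I} = \<Psi> ` (ball y0 \<alpha> \<times> I)"
    proof
      show "{x \<in> B. d x \<in> I} \<subseteq> \<Psi> ` (ball y0 \<alpha> \<times> I)"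
      proof
        fix x assume "x \<in> {x \<in> B. d x \<in> I}"
        then have "(inner x T, d x) \<in> ball y0 \<alpha> \<times> I" by (auto simp: B_def)
        then show "x \<in> \<Psi> ` (ball y0 \<alpha> \<times> I)" using \<Psi>inv[of x] by (metis imageI)
      qed
      show "\<Psi> ` (ball y0 \<alpha> \<times> I) \<subseteq> {x \<in> B. d x \<in> I}"
        using that e' by (auto simp: B_def \<Psi>T d_def)
    qed
    moreover have "continuous_on (ball y0 \<alpha> \<times> I) \<Psi>"
    proof -
      have "continuous_on (ball y0 \<alpha> \<times> I) (\<lambda>z. h (fst z))"
        by (intro continuous_on_compose2[OF hcont] continuous_intros) (use \<alpha>2 in \<open>auto simp: \<alpha>_def\<close>)
      then show ?thesis unfolding \<Psi>_def case_prod_unfold by (intro continuous_intros)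
    qed
    moreover have "connected (ball y0 \<alpha> \<times> I)"
      using that by (intro connected_Times) auto
    ultimately show ?thesis using connected_continuous_image by metis
  qed
  have sets: "{x \<in> B. d x > 0} = {x \<in> B. d x \<in> {0<..<e'}}" "{x \<in> B. d x < 0} = {x \<in> B. d x \<in> {-e'<..<0}}"
    by (auto simp: B_def)
  have dist_bound: "infdist x (path_image p) \<le> (1 / norm T) * \<bar>d x\<bar>" if "x \<in> B" for x
  proof -
    define q where "q = p (\<sigma> (inner x T))"
    have "inner x T \<in> J" using that BJ by (auto simp: B_def)
    then have "inner (x - q) T = 0" "inner (x - q) N = d x"
      using J by (auto simp: inner_diff_left q_def d_def h_def \<tau>_def)
    then have "m *\<^sub>R (x - q) = d x *\<^sub>R N" using decomp[of "x - q"] by simp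
    then have "m * norm (x - q) = \<bar>d x\<bar> * norm N" using m by (metis abs_of_pos norm_scaleR)
    then have "norm T * norm (x - q) * norm T = \<bar>d x\<bar> * norm T"
      by (simp add: m_def dot_square_norm power2_eq_square N_def norm_mult mult_ac)
    then have "norm T * norm (x - q) = \<bar>d x\<bar>" using \<open>T \<noteq> 0\<close> by simp
    then have "dist x q = (1 / norm T) * \<bar>d x\<bar>" using \<open>T \<noteq> 0\<close> by (simp add: dist_norm field_simps)
    moreover have "q \<in> path_image p" using smooth_loop_range[OF p] by (simp add: q_def)
    ultimately show ?thesis using infdist_le by metis
  qed
  show thesis
  proof
    show "(d has_derivative inner (gd x)) (at x)" if "x \<in> B" for x
    proof -
      have "inner x T \<in> J" using that BJ by (auto simp: B_def)
      then have "(h has_derivative (*) (h' (inner x T))) (at (inner x T))"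
        using Dh by (simp add: has_field_derivative_def)
      from has_derivative_compose[OF bounded_linear.has_derivative[OF bounded_linear_inner_left has_derivative_ident] this]
      have "((\<lambda>x. h (inner x T)) has_derivative (\<lambda>v. h' (inner x T) * inner v T)) (at x)" .
      then show ?thesis unfolding d_def
        by (auto intro!: derivative_eq_intros simp: gd_def inner_diff_right inner_commute fun_eq_iff)
    qed
    show "continuous_on B gd" unfolding gd_def
      by (intro continuous_intros continuous_on_compose2[OF h'cont]) (use BJ in \<open>auto simp: B_def\<close>)
    show "gd x \<noteq> 0" for x
    proof
      assume "gd x = 0"
      then have "inner (gd x) N = 0" by simp
      then show False using NN m by (simp add: gd_def inner_diff_left)
    qed
    show "connected {x \<in> B. d x > 0}" "connected {x \<in> B. d x < 0}"
      unfolding sets by (rule conn; simp)+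
    show "B \<subseteq> ball (p s0) e" using Bsmall by (auto simp: dist_commute)
    show "1 / norm T \<ge> 0" by simp
  qed (use \<open>open B\<close> x0B on_curve dist_bound in auto)
qed

text \<open>A defining function of the domain near the boundary point \<open>x0\<close>, with gradient \<open>gd\<close>.\<close>

definition collar ::
  "complex set \<Rightarrow> complex \<Rightarrow> real \<Rightarrow> (complex \<Rightarrow> real) \<Rightarrow> (complex \<Rightarrow> complex) \<Rightarrow> bool" where
  "collar \<Omega> x0 r d gd \<longleftrightarrow> r > 0 \<and> continuous_on (ball x0 r) gd \<and>
     (\<forall>x\<in>ball x0 r. (d has_derivative inner (gd x)) (at x) \<and> gd x \<noteq> 0 \<and>
        (x \<in> \<Omega> \<longleftrightarrow> d x > 0) \<and> (x \<in> frontier \<Omega> \<longleftrightarrow> d x = 0))"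

text \<open>By the Jordan curve theorem each boundary curve has points of its inside and of its outside
  near every one of its points, and a connected domain lies on one side of it only.\<close>

lemma collar_exists:
  assumes dom: "connected_smooth_domain k \<Omega>" and x0: "x0 \<in> frontier \<Omega>"
  obtains r d gd p C where "collar \<Omega> x0 r d gd" "smooth_loop p" "C \<ge> 0"
    "\<And>x. x \<in> ball x0 r \<Longrightarrow> infdist x (path_image p) \<le> C * \<bar>d x\<bar>"
proof -
  have op: "open \<Omega>" and con: "connected \<Omega>"
    using dom by (auto simp: connected_smooth_domain_def)
  obtain \<Gamma> where \<Gamma>: "\<And>i. i < k \<Longrightarrow> smooth_simple_closed_curve (\<Gamma> i)"
      "disjoint_family_on \<Gamma> {..<k}" "frontier \<Omega> = (\<Union>i<k. \<Gamma> i)"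
    using dom unfolding connected_smooth_domain_def by blast
  obtain i where i: "i < k" "x0 \<in> \<Gamma> i" using x0 \<Gamma>(3) by auto
  obtain p where p: "smooth_loop p" "\<Gamma> i = path_image p"
    using \<Gamma>(1)[OF i(1)] unfolding smooth_simple_closed_curve_def by blast
  obtain s0 where s0: "x0 = p s0" using i p by (auto simp: path_image_def)
  define F where "F = (\<Union>j\<in>{..<k} - {i}. \<Gamma> j)"
  have "closed (\<Gamma> j)" if "j < k" for j
    using \<Gamma>(1)[OF that] unfolding smooth_simple_closed_curve_def
    by (metis closed_simple_path_image smooth_loop_simple_path(1))
  then have "closed F" by (auto simp: F_def)
  moreover have "x0 \<notin> F"
    using i \<Gamma>(2) by (auto simp: F_def disjoint_family_on_def)
  ultimately obtain e where e: "e > 0" "ball x0 e \<inter> F = {}"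
    by (metis separate_point_closed disjoint_iff mem_ball not_le)
  obtain B d gd C where B: "open B" "x0 \<in> B" "B \<subseteq> ball x0 e"
    "\<And>x. x \<in> B \<Longrightarrow> (d has_derivative inner (gd x)) (at x)"
    "continuous_on B gd" "\<And>x. x \<in> B \<Longrightarrow> gd x \<noteq> 0"
    "\<And>x. x \<in> B \<Longrightarrow> d x = 0 \<longleftrightarrow> x \<in> path_image p"
    "connected {x \<in> B. d x > 0}" "connected {x \<in> B. d x < 0}"
    "C \<ge> 0" "\<And>x. x \<in> B \<Longrightarrow> infdist x (path_image p) \<le> C * \<bar>d x\<bar>"
    using smooth_loop_collar[OF p(1) e(1), of s0] unfolding s0[symmetric] by blast
  have fr: "x \<in> frontier \<Omega> \<longleftrightarrow> d x = 0" if "x \<in> B" for x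
  proof -
    have "x \<in> frontier \<Omega> \<longleftrightarrow> x \<in> \<Gamma> i"
      using that B(3) e(2) i(1) \<Gamma>(3) unfolding F_def by blast
    then show ?thesis using B(7)[OF that] p(2) by simp
  qed
  have disj: "\<Omega> \<inter> frontier \<Omega> = {}" using op by (auto simp: frontier_def interior_open)
  have half: "S \<subseteq> \<Omega> \<or> S \<inter> \<Omega> = {}"
    if "S = {x \<in> B. d x > 0} \<or> S = {x \<in> B. d x < 0}" for S
  proof -
    have "connected S" "S \<inter> frontier \<Omega> = {}" using that B(8,9) fr by auto
    then show ?thesis using connected_Int_frontier[of S \<Omega>] by blast
  qed
  let ?P = "{x \<in> B. d x > 0}" and ?M = "{x \<in> B. d x < 0}"
  have not_none: "\<not> (?P \<inter> \<Omega> = {} \<and> ?M \<inter> \<Omega> = {})"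
  proof -
    have "x0 \<in> closure \<Omega>" using x0 by (simp add: frontier_def)
    then obtain y where y: "y \<in> B" "y \<in> \<Omega>"
      using B(2) open_Int_closure_eq_empty[OF B(1), of \<Omega>] by blast
    then have "d y \<noteq> 0" using fr disj by blast
    then show ?thesis using y by (auto simp: neq_iff)
  qed
  have not_both: "\<not> (?P \<subseteq> \<Omega> \<and> ?M \<subseteq> \<Omega>)"
  proof
    assume sub: "?P \<subseteq> \<Omega> \<and> ?M \<subseteq> \<Omega>"
    note J = Jordan_inside_outside[OF smooth_loop_simple_path[OF p(1)]]
    have x0p: "x0 \<in> path_image p" using i p by simp
    have Om: "y \<in> \<Omega>" if "y \<in> B" "y \<notin> path_image p" for y
      using that sub B(7) by (cases "d y > 0") (auto simp: not_less le_less)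
    have "x0 \<in> closure (inside (path_image p))" "x0 \<in> closure (outside (path_image p))"
      using J x0p unfolding frontier_def by blast+
    then obtain y z where "y \<in> B" "y \<in> inside (path_image p)" "z \<in> B" "z \<in> outside (path_image p)"
      using B(2) open_Int_closure_eq_empty[OF B(1), of "inside (path_image p)"]
        open_Int_closure_eq_empty[OF B(1), of "outside (path_image p)"] by blast
    moreover from this have "y \<in> \<Omega>" "z \<in> \<Omega>"
      using Om inside_no_overlap[of "path_image p"] outside_no_overlap[of "path_image p"] by blast+
    ultimately have "\<Omega> \<inter> frontier (inside (path_image p)) \<noteq> {}"
      using inside_Int_outside[of "path_image p"] by (intro connected_Int_frontier[OF con]) blast+
    moreover have "path_image p \<subseteq> frontier \<Omega>" using p(2) i(1) \<Gamma>(3) by auto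
    ultimately show False using J disj by auto
  qed
  have "\<exists>\<sigma>::real. (\<sigma> = 1 \<or> \<sigma> = -1) \<and> (\<forall>x\<in>B. x \<in> \<Omega> \<longleftrightarrow> \<sigma> * d x > 0)"
  proof (cases "?P \<subseteq> \<Omega>")
    case True
    have "?M \<inter> \<Omega> = {}" using True not_both half by blast
    have "x \<in> \<Omega> \<longleftrightarrow> d x > 0" if "x \<in> B" for x
      using linorder_cases[of "d x" 0] that True \<open>?M \<inter> \<Omega> = {}\<close> fr[OF that] disj by blast
    then have "\<forall>x\<in>B. x \<in> \<Omega> \<longleftrightarrow> 1 * d x > 0" by simp
    then show ?thesis by blast
  next
    case False
    then have P: "?P \<inter> \<Omega> = {}" using half by blast
    then have M: "?M \<subseteq> \<Omega>" using not_none half by blast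
    have "x \<in> \<Omega> \<longleftrightarrow> d x < 0" if "x \<in> B" for x
      using linorder_cases[of "d x" 0] that P M fr[OF that] disj by blast
    then have "\<forall>x\<in>B. x \<in> \<Omega> \<longleftrightarrow> -1 * d x > 0" by simp
    then show ?thesis by blast
  qed
  then obtain \<sigma> :: real where \<sigma>: "\<sigma> = 1 \<or> \<sigma> = -1" "\<And>x. x \<in> B \<Longrightarrow> x \<in> \<Omega> \<longleftrightarrow> \<sigma> * d x > 0" by blast
  obtain r where r: "r > 0" "ball x0 r \<subseteq> B" using B(1,2) open_contains_ball by blast
  show thesis
  proof
    have "((\<lambda>x. \<sigma> * d x) has_derivative inner (\<sigma> *\<^sub>R gd x)) (at x)" if "x \<in> ball x0 r" for x
      using B(4)[of x] that r(2) by (auto intro!: derivative_eq_intros simp: fun_eq_iff)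
    moreover have "continuous_on (ball x0 r) (\<lambda>x. \<sigma> *\<^sub>R gd x)"
      using continuous_on_subset[OF B(5) r(2)] by (intro continuous_intros)
    ultimately show "collar \<Omega> x0 r (\<lambda>x. \<sigma> * d x) (\<lambda>x. \<sigma> *\<^sub>R gd x)"
      unfolding collar_def using r fr \<sigma> B(6) by (auto simp: subset_iff)
    show "infdist x (path_image p) \<le> C * \<bar>\<sigma> * d x\<bar>" if "x \<in> ball x0 r" for x
      using B(11)[of x] that r(2) \<sigma>(1) by (auto simp: abs_mult)
  qed (use p B in auto)
qed

text \<open>The defining function vanishes along every curve that runs in the boundary, so its gradient is
  normal to all of them, whatever their parametrisation.\<close>

lemma collar_tangent:
  assumes c: "collar \<Omega> x0 r d gd" and p: "smooth_loop p" "path_image p \<subseteq> frontier \<Omega>" and s: "p s \<in> ball x0 r"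
  shows "inner (gd (p s)) (vector_derivative p (at s)) = 0"
proof -
  have 1: "(p has_derivative (\<lambda>h. h *\<^sub>R vector_derivative p (at s))) (at s)"
    using smooth_loop_has_vector_derivative[OF p(1)] by (simp add: has_vector_derivative_def)
  have "(d has_derivative inner (gd (p s))) (at (p s))" using c s by (simp add: collar_def)
  from has_derivative_compose[OF 1 this]
  have D: "((\<lambda>t. d (p t)) has_derivative (\<lambda>h. inner (gd (p s)) (h *\<^sub>R vector_derivative p (at s)))) (at s)" .
  have "open (p -` ball x0 r)"
    using smooth_loop_continuous[OF p(1), of UNIV] by (intro open_vimage) auto
  moreover have "d (p t) = 0" if "t \<in> p -` ball x0 r" for t
  proof -
    have "p t \<in> frontier \<Omega>" using p(2) smooth_loop_range[OF p(1)] by auto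
    then show ?thesis using that c by (simp add: collar_def)
  qed
  ultimately have "((\<lambda>t. 0::real) has_derivative (\<lambda>h. inner (gd (p s)) (h *\<^sub>R vector_derivative p (at s)))) (at s)"
    using s by (intro has_derivative_transform_within_open[OF D, of "p -` ball x0 r"]) auto
  then have "(\<lambda>h. inner (gd (p s)) (h *\<^sub>R vector_derivative p (at s))) = (\<lambda>h. 0)"
    by (rule has_derivative_unique) simp
  from fun_cong[OF this, of 1] show ?thesis by simp
qed

lemma collar_outer_unit_normal:
  assumes dom: "connected_smooth_domain k \<Omega>" and c: "collar \<Omega> x0 r d gd"
    and x: "x \<in> ball x0 r" "x \<in> frontier \<Omega>"
  shows "outer_unit_normal \<Omega> x (- (1 / norm (gd x)) *\<^sub>R gd x)"
proof -
  define g where "g = (1 / norm (gd x)) *\<^sub>R gd x"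
  have g0: "gd x \<noteq> 0" using c x by (simp add: collar_def)
  obtain \<Gamma> where \<Gamma>: "\<And>i. i < k \<Longrightarrow> smooth_simple_closed_curve (\<Gamma> i)" "frontier \<Omega> = (\<Union>i<k. \<Gamma> i)"
    using dom unfolding connected_smooth_domain_def by blast
  then obtain i where i: "i < k" "x \<in> \<Gamma> i" using x(2) by auto
  then obtain p where p: "smooth_loop p" "\<Gamma> i = path_image p"
    using \<Gamma>(1)[OF i(1)] unfolding smooth_simple_closed_curve_def by blast
  then obtain s where s: "x = p s" using i by (auto simp: path_image_def)
  have pf: "path_image p \<subseteq> frontier \<Omega>" using p i \<Gamma>(2) by blast
  have "inner (gd x) (vector_derivative p (at s)) = 0"
    using collar_tangent[OF c p(1) pf] x(1) s by simp
  then have tang: "\<exists>p s. smooth_loop p \<and> path_image p \<subseteq> frontier \<Omega> \<and> p s = x \<and>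
      inner (- g) (vector_derivative p (at s)) = 0"
    using p(1) pf s by (intro exI[of _ p] exI[of _ s]) (auto simp: g_def)
  have d0: "d x = 0" using c x by (simp add: collar_def)
  have 1: "((\<lambda>t. x + t *\<^sub>R g) has_derivative (\<lambda>h. h *\<^sub>R g)) (at 0)"
    by (auto intro!: derivative_eq_intros)
  have "(d has_derivative inner (gd x)) (at (x + 0 *\<^sub>R g))" using c x by (simp add: collar_def)
  from has_derivative_compose[OF 1 this]
  have "((\<lambda>t. d (x + t *\<^sub>R g)) has_derivative (\<lambda>h. inner (gd x) (h *\<^sub>R g))) (at 0)" .
  moreover have "inner (gd x) (h *\<^sub>R g) = norm (gd x) * h" for h
    using g0 by (simp add: g_def dot_square_norm power2_eq_square)
  ultimately have D: "((\<lambda>t. d (x + t *\<^sub>R g)) has_real_derivative norm (gd x)) (at 0)"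
    unfolding has_field_derivative_def by (simp only:)
  obtain e1 where e1: "e1 > 0" "\<And>h. 0 < h \<Longrightarrow> h < e1 \<Longrightarrow> d (x + h *\<^sub>R g) > 0"
    using DERIV_pos_inc_right[OF D] g0 d0 by auto
  obtain e2 where e2: "e2 > 0" "\<And>h. 0 < h \<Longrightarrow> h < e2 \<Longrightarrow> d (x - h *\<^sub>R g) < 0"
    using DERIV_pos_inc_left[OF D] g0 d0 by auto
  have ng: "norm g = 1" using g0 by (simp add: g_def)
  define e where "e = min (r - dist x0 x) (min e1 e2)"
  have "e > 0" using e1 e2 x by (simp add: e_def)
  moreover have "x - t *\<^sub>R (- g) \<in> \<Omega> \<and> x + t *\<^sub>R (- g) \<notin> closure \<Omega>" if t: "0 < t" "t < e" for t
  proof -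
    have "dist x0 (x + t *\<^sub>R g) < r" "dist x0 (x - t *\<^sub>R g) < r"
      using t ng dist_triangle[of x0 "x + t *\<^sub>R g" x] dist_triangle[of x0 "x - t *\<^sub>R g" x]
      by (auto simp: e_def dist_norm)
    then have b: "x + t *\<^sub>R g \<in> ball x0 r" "x - t *\<^sub>R g \<in> ball x0 r" by auto
    have "d (x + t *\<^sub>R g) > 0" "d (x - t *\<^sub>R g) < 0" using e1 e2 t by (auto simp: e_def)
    then have "x + t *\<^sub>R g \<in> \<Omega>" "x - t *\<^sub>R g \<notin> \<Omega>" "x - t *\<^sub>R g \<notin> frontier \<Omega>"
      using c b by (auto simp: collar_def)
    then show ?thesis by (auto simp: closure_Un_frontier)
  qed
  ultimately show ?thesis
    using ng tang unfolding outer_unit_normal_def g_def by auto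
qed

text \<open>The boundary conditions are stated for outer normals only and would be void at a point without
  one.\<close>

lemma outer_unit_normal_exists:
  assumes dom: "connected_smooth_domain k \<Omega>" and x: "x \<in> frontier \<Omega>"
  obtains \<nu> where "outer_unit_normal \<Omega> x \<nu>"
    "\<And>p s. smooth_loop p \<Longrightarrow> path_image p \<subseteq> frontier \<Omega> \<Longrightarrow> p s = x \<Longrightarrow> inner \<nu> (vector_derivative p (at s)) = 0"
proof -
  obtain r d gd p C where c: "collar \<Omega> x r d gd"
    by (rule collar_exists[OF dom x])
  then have "x \<in> ball x r" by (simp add: collar_def)
  then show thesis
    using collar_outer_unit_normal[OF dom c _ x] collar_tangent[OF c] by (intro that) auto
qed

section \<open>The divergence inequality\<close>

text \<open>Modelled on the energy flux, which is differentiable in the open domain only: it contains a power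
  of the density that may not be differentiable at boundary points in a vacuum.\<close>

definition outward_field :: "complex set \<Rightarrow> (complex \<Rightarrow> complex) \<Rightarrow> bool" where
  "outward_field \<Omega> W \<longleftrightarrow> continuous_on (closure \<Omega>) W \<and> (\<forall>x\<in>\<Omega>. W differentiable (at x)) \<and>
     bounded (pd1 W ` \<Omega>) \<and> bounded (pd2 W ` \<Omega>) \<and> continuous_on \<Omega> (divg W) \<and>
     (\<forall>x\<in>frontier \<Omega>. \<forall>\<nu>. outer_unit_normal \<Omega> x \<nu> \<longrightarrow> inner (W x) \<nu> \<ge> 0)"

lemma divg_has_partials:
  assumes "has_partials W a b x"
  shows "divg W x = Re a + Im b"
  using has_partials_pd[OF has_partials_bounded_linear[OF bounded_linear_Re assms]]
    has_partials_pd[OF has_partials_bounded_linear[OF bounded_linear_Im assms]]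
  by (simp add: divg_def)

lemma divg_scaleR:
  assumes "has_partials f a b x" "has_partials W c d x"
  shows "divg (\<lambda>x. f x *\<^sub>R W x) x = f x * divg W x + inner (Complex a b) (W x)"
  using divg_has_partials[OF has_partials_scaleR[OF assms]] divg_has_partials[OF assms(2)]
  by (simp add: inner_complex_def algebra_simps)

lemma integral_divg_compact_support:
  assumes diff: "\<And>x. W differentiable (at x)"
    and bnd: "\<And>x. norm (pd1 W x) \<le> B" "\<And>x. norm (pd2 W x) \<le> B"
    and supp: "\<And>x. norm x > R \<Longrightarrow> W x = 0"
  shows "integrable lborel (divg W)" "integral\<^sup>L lborel (divg W) = 0"
proof -
  have main: "integrable lborel (\<lambda>x. frechet_derivative (\<lambda>y. L (W y)) (at x) v)
     \<and> integral\<^sup>L lborel (\<lambda>x. frechet_derivative (\<lambda>y. L (W y)) (at x) v) = 0"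
    if L: "bounded_linear L" "\<And>z. \<bar>L z\<bar> \<le> norm z" for L :: "complex \<Rightarrow> real" and v
  proof -
    have hp: "has_partials (\<lambda>y. L (W y)) (L (pd1 W x)) (L (pd2 W x)) x" for x
      using diff has_partials_iff by (intro has_partials_bounded_linear[OF L(1)]) blast
    have "\<bar>frechet_derivative (\<lambda>y. L (W y)) (at x) h\<bar> \<le> (2 * B) * norm h" for x h
    proof -
      have "frechet_derivative (\<lambda>y. L (W y)) (at x) h = Re h * L (pd1 W x) + Im h * L (pd2 W x)"
        using frechet_derivative_pd[OF has_partials_differentiable[OF hp]] has_partials_pd[OF hp] by simp
      then have "\<bar>frechet_derivative (\<lambda>y. L (W y)) (at x) h\<bar> \<le> \<bar>Re h\<bar> * \<bar>L (pd1 W x)\<bar> + \<bar>Im h\<bar> * \<bar>L (pd2 W x)\<bar>"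
        by (metis abs_mult abs_triangle_ineq)
      also have "\<dots> \<le> norm h * B + norm h * B"
        using abs_Re_le_cmod abs_Im_le_cmod order_trans[OF L(2) bnd(1)] order_trans[OF L(2) bnd(2)]
        by (intro add_mono mult_mono) auto
      finally show ?thesis by simp
    qed
    note I = integral_derivative_compact_support[OF has_partials_differentiable[OF hp] this, of R v]
    have "L (W x) = 0" if "norm x > R" for x
      using supp[OF that] L(1) by (simp add: linear_simps)
    then show ?thesis using I by blast
  qed
  note R = main[OF bounded_linear_Re abs_Re_le_cmod, of 1] and I = main[OF bounded_linear_Im abs_Im_le_cmod, of \<i>]
  then show "integrable lborel (divg W)" "integral\<^sup>L lborel (divg W) = 0"
    unfolding divg_def[abs_def] pd1_def pd2_def by auto
qed

lemma has_real_derivative_positive_part_square: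
  "((\<lambda>t. (max 0 t)\<^sup>2) has_real_derivative 2 * max 0 t) (at (t::real))"
proof -
  consider "t > 0" | "t < 0" | "t = 0" by linarith
  then show ?thesis
  proof cases
    case 1
    have "((\<lambda>t. t\<^sup>2) has_real_derivative 2 * max 0 t) (at t)"
      using 1 by (auto intro!: derivative_eq_intros)
    then show ?thesis
      by (rule has_field_derivative_transform_within_open[of _ _ _ "{0<..}"]) (use 1 in auto)
  next
    case 2
    have "((\<lambda>t. 0) has_real_derivative 2 * max 0 t) (at t)"
      using 2 by (auto intro!: derivative_eq_intros)
    then show ?thesis
      by (rule has_field_derivative_transform_within_open[of _ _ _ "{..<0}"]) (use 2 in auto)
  next
    case 3
    have "((\<lambda>y::real. max 0 y) \<longlongrightarrow> max 0 0) (at 0)"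
      by (intro tendsto_intros)
    then have "((\<lambda>y::real. max 0 y) \<longlongrightarrow> 0) (at 0)" by simp
    then have "((\<lambda>y::real. (max 0 y)\<^sup>2 / y) \<longlongrightarrow> 0) (at 0)"
      by (rule Lim_transform_within[where d = 1]) (auto simp: max_def power2_eq_square)
    then show ?thesis using 3 by (simp add: has_field_derivative_iff)
  qed
qed

text \<open>A nondecreasing \<open>C\<^sup>1\<close> step from 0 on \<open>(-\<infinity>, 1]\<close> to 1 on \<open>[2, \<infinity>)\<close>.\<close>

definition smooth_step :: "real \<Rightarrow> real" where
  "smooth_step t = 1 - (max 0 (1 - (max 0 (t - 1))\<^sup>2))\<^sup>2"

definition smooth_step_deriv :: "real \<Rightarrow> real" where
  "smooth_step_deriv t = 4 * max 0 (1 - (max 0 (t - 1))\<^sup>2) * max 0 (t - 1)"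

lemma smooth_step_has_derivative:
  "(smooth_step has_real_derivative smooth_step_deriv t) (at t)"
proof -
  note P = has_real_derivative_positive_part_square
  have 1: "((\<lambda>t. (max 0 (t - 1))\<^sup>2) has_real_derivative 2 * max 0 (t - 1) * 1) (at t)"
    by (rule DERIV_chain2[OF P]) (auto intro!: derivative_eq_intros)
  have "((\<lambda>t. (max 0 (1 - (max 0 (t - 1))\<^sup>2))\<^sup>2) has_real_derivative
     2 * max 0 (1 - (max 0 (t - 1))\<^sup>2) * (0 - 2 * max 0 (t - 1) * 1)) (at t)"
    by (rule DERIV_chain2[OF P]) (intro DERIV_diff DERIV_const 1)
  from DERIV_diff[OF DERIV_const[of 1] this] show ?thesis
    unfolding smooth_step_def[abs_def] smooth_step_deriv_def by (simp add: algebra_simps)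
qed

lemma smooth_step_low: "t \<le> 1 \<Longrightarrow> smooth_step t = 0"
  by (simp add: smooth_step_def max_def)

lemma smooth_step_high: "t \<ge> 2 \<Longrightarrow> smooth_step t = 1 \<and> smooth_step_deriv t = 0"
proof -
  assume "t \<ge> 2"
  then have "(max 0 (t - 1))\<^sup>2 \<ge> 1" by (simp add: max_def)
  then have "max 0 (1 - (max 0 (t - 1))\<^sup>2) = 0" by simp
  then show ?thesis by (simp add: smooth_step_def smooth_step_deriv_def)
qed

lemma smooth_step_range: "0 \<le> smooth_step t \<and> smooth_step t \<le> 1"
proof -
  have "0 \<le> max 0 (1 - (max 0 (t - 1))\<^sup>2)" "max 0 (1 - (max 0 (t - 1))\<^sup>2) \<le> 1" by auto
  then show ?thesis by (simp add: smooth_step_def power_le_one)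
qed

lemma smooth_step_deriv_range: "0 \<le> smooth_step_deriv t \<and> smooth_step_deriv t \<le> 4"
proof (cases "t \<ge> 2")
  case False
  have "max 0 (1 - (max 0 (t - 1))\<^sup>2) * max 0 (t - 1) \<le> 1 * 1"
    using False by (intro mult_mono) auto
  then show ?thesis by (simp add: smooth_step_deriv_def)
qed (simp add: smooth_step_high)

lemma set_integrable_continuous_bounded:
  fixes f :: "complex \<Rightarrow> real"
  assumes "open \<Omega>" "bounded \<Omega>" "continuous_on \<Omega> f" "\<And>x. x \<in> \<Omega> \<Longrightarrow> \<bar>f x\<bar> \<le> M"
  shows "set_integrable lborel \<Omega> f"
  unfolding set_integrable_def
proof (rule Bochner_Integration.integrable_bound)
  have "emeasure lborel \<Omega> < \<infinity>" using assms(2) emeasure_bounded_finite by blast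
  then show "integrable lborel (\<lambda>x. M * indicator \<Omega> x)"
    using assms(1) by (intro integrable_mult_right integrable_real_indicator) auto
  show "(\<lambda>x. indicator \<Omega> x *\<^sub>R f x) \<in> borel_measurable lborel"
    using borel_measurable_continuous_on_indicator[OF _ assms(3)] assms(1) by simp
  have "\<bar>f x\<bar> \<le> \<bar>M\<bar>" if "x \<in> \<Omega>" for x using assms(4)[OF that] by linarith
  then show "AE x in lborel. norm (indicator \<Omega> x *\<^sub>R f x) \<le> norm (M * indicator \<Omega> x)"
    by (auto simp: indicator_def)
qed

lemma outward_field_bounds:
  assumes "outward_field \<Omega> W"
  shows "\<exists>M\<ge>0. \<forall>x\<in>\<Omega>. norm (pd1 W x) \<le> M \<and> norm (pd2 W x) \<le> M \<and> \<bar>divg W x\<bar> \<le> 2 * M"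
proof -
  have "bounded (pd1 W ` \<Omega>)" "bounded (pd2 W ` \<Omega>)"
    using assms by (simp_all add: outward_field_def)
  then obtain M1 M2 where M: "\<And>x. x \<in> \<Omega> \<Longrightarrow> norm (pd1 W x) \<le> M1" "\<And>x. x \<in> \<Omega> \<Longrightarrow> norm (pd2 W x) \<le> M2"
    unfolding bounded_iff ball_simps(9) by meson
  define M where "M = max 0 (max M1 M2)"
  have 1: "norm (pd1 W x) \<le> M" "norm (pd2 W x) \<le> M" if "x \<in> \<Omega>" for x
    using M[OF that] by (auto simp: M_def)
  have "\<bar>divg W x\<bar> \<le> 2 * M" if "x \<in> \<Omega>" for x
  proof -
    have "has_partials W (pd1 W x) (pd2 W x) x"
      using assms that by (simp add: has_partials_iff outward_field_def)
    from divg_has_partials[OF this]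
    have "\<bar>divg W x\<bar> \<le> \<bar>Re (pd1 W x)\<bar> + \<bar>Im (pd2 W x)\<bar>" by simp
    then show ?thesis using 1[OF that] abs_Re_le_cmod[of "pd1 W x"] abs_Im_le_cmod[of "pd2 W x"] by linarith
  qed
  moreover have "M \<ge> 0" by (simp add: M_def)
  ultimately show ?thesis using 1 by blast
qed

lemma outward_field_set_integrable:
  assumes "open \<Omega>" "bounded \<Omega>" "outward_field \<Omega> W"
  shows "set_integrable lborel \<Omega> (divg W)"
proof -
  obtain M where "M \<ge> 0" "\<And>x. x \<in> \<Omega> \<Longrightarrow> norm (pd1 W x) \<le> M" "\<And>x. x \<in> \<Omega> \<Longrightarrow> norm (pd2 W x) \<le> M"
    "\<And>x. x \<in> \<Omega> \<Longrightarrow> \<bar>divg W x\<bar> \<le> 2 * M" using outward_field_bounds[OF assms(3)] by blast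
  then show ?thesis using assms unfolding outward_field_def
    by (intro set_integrable_continuous_bounded[where M = "2 * M"]) auto
qed

lemma has_partials_zero_extension:
  assumes "open V" "x \<in> V" "\<And>y. y \<in> V \<Longrightarrow> f y = 0"
  shows "has_partials f 0 0 x"
  using has_partials_cong_open[OF assms(1,2), of "\<lambda>_. 0" f] assms(3) has_partials_const by metis

text \<open>A field supported in a disc inside the domain can be extended by zero to the whole plane.\<close>

lemma local_divergence_inequality_interior:
  assumes op: "open \<Omega>" and bd: "bounded \<Omega>" and sub: "cball x0 r \<subseteq> \<Omega>"
    and W: "outward_field \<Omega> W" and supp: "\<And>x. x \<in> closure \<Omega> \<Longrightarrow> x \<notin> ball x0 r \<Longrightarrow> W x = 0"
  shows "(LINT x:\<Omega>|lborel. divg W x) = 0"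
proof -
  obtain M where M: "M \<ge> 0" "\<And>x. x \<in> \<Omega> \<Longrightarrow> norm (pd1 W x) \<le> M" "\<And>x. x \<in> \<Omega> \<Longrightarrow> norm (pd2 W x) \<le> M"
    "\<And>x. x \<in> \<Omega> \<Longrightarrow> \<bar>divg W x\<bar> \<le> 2 * M" using outward_field_bounds[OF W] by blast
  define W' where "W' x = (if x \<in> \<Omega> then W x else 0)" for x
  have in\<Omega>: "has_partials W' (pd1 W x) (pd2 W x) x" if "x \<in> \<Omega>" for x
  proof (rule has_partials_cong_open[OF op that])
    show "has_partials W (pd1 W x) (pd2 W x) x"
      using W that by (simp add: has_partials_iff outward_field_def)
  qed (simp add: W'_def)
  have out: "has_partials W' 0 0 x" if "x \<notin> cball x0 r" for x
  proof (rule has_partials_zero_extension[of "- cball x0 r"])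
    fix y assume "y \<in> - cball x0 r"
    then show "W' y = 0" using supp[of y] closure_subset[of \<Omega>] by (auto simp: W'_def)
  qed (use that in \<open>auto simp: open_Compl\<close>)
  have diff: "W' differentiable (at x)" for x
    using in\<Omega>[of x] out[of x] sub has_partials_differentiable by blast
  have b: "norm (pd1 W' x) \<le> M" "norm (pd2 W' x) \<le> M" for x
  proof -
    consider "x \<in> \<Omega>" | "x \<notin> cball x0 r" using sub by blast
    then show "norm (pd1 W' x) \<le> M" "norm (pd2 W' x) \<le> M"
      by (cases; simp add: has_partials_pd[OF in\<Omega>] has_partials_pd[OF out] M)+
  qed
  obtain R where R: "\<And>x. x \<in> \<Omega> \<Longrightarrow> norm x \<le> R" using bd unfolding bounded_iff by blast
  have z: "W' x = 0" if "norm x > R" for x using R[of x] that by (auto simp: W'_def)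
  have eq: "indicator \<Omega> x *\<^sub>R divg W x = divg W' x" for x
  proof (cases "x \<in> \<Omega>")
    case True
    then show ?thesis using divg_has_partials[OF in\<Omega>[OF True]]
        divg_has_partials[of W "pd1 W x" "pd2 W x" x] W by (simp add: has_partials_iff outward_field_def)
  next
    case False
    then have "x \<notin> cball x0 r" using sub by blast
    then show ?thesis using divg_has_partials[OF out] False by simp
  qed
  show ?thesis
    unfolding set_lebesgue_integral_def eq by (rule integral_divg_compact_support(2)[OF diff b z])
qed

text \<open>The field is multiplied by a cut-off function that depends on \<open>d / \<epsilon>\<close>; the product has compact
  support in the domain, and its divergence has integral zero. The gradient of the cut-off
  function is of size \<open>1 / \<epsilon>\<close> and lives in a layer of area of order \<open>\<epsilon>\<close> at the boundary, where the
  field has an inward component of order at most \<open>\<eta>\<close>. So the integral of the divergence is at least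
  a multiple of \<open>- \<eta>\<close> in the limit \<open>\<epsilon> \<longrightarrow> 0\<close>.\<close>

lemma local_divergence_inequality_boundary:
  assumes dom: "connected_smooth_domain k \<Omega>" and c: "collar \<Omega> x0 r d gd"
    and p: "smooth_loop p" and C: "C \<ge> 0" "\<And>x. x \<in> ball x0 r \<Longrightarrow> infdist x (path_image p) \<le> C * \<bar>d x\<bar>"
    and W: "outward_field \<Omega> W" and supp: "\<And>x. x \<in> closure \<Omega> \<Longrightarrow> x \<notin> ball x0 (r / 2) \<Longrightarrow> W x = 0"
  shows "0 \<le> (LINT x:\<Omega>|lborel. divg W x)"
proof -
  have op: "open \<Omega>" and bd: "bounded \<Omega>" using dom by (auto simp: connected_smooth_domain_def)
  have r: "r > 0" using c by (simp add: collar_def)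
  define Q where "Q = \<Omega> \<inter> ball x0 r"
  have oQ: "open Q" using op by (simp add: Q_def open_Int)
  define Kc where "Kc = closure \<Omega> \<inter> cball x0 (r / 2)"
  have Kb: "x \<in> ball x0 r" if "x \<in> cball x0 (r / 2)" for x using that r by auto
  have cK: "compact Kc" unfolding Kc_def using compact_cball by (metis closed_Int_compact closed_closure)
  have Dd: "(d has_derivative inner (gd x)) (at x)" if "x \<in> ball x0 r" for x
    using c that by (simp add: collar_def)
  have dcont: "continuous_on S d" if "S \<subseteq> ball x0 r" for S
    using Dd that has_derivative_continuous by (meson continuous_at_imp_continuous_on subsetD)
  have gdcont: "continuous_on Kc gd"
    using c Kb unfolding collar_def Kc_def by (meson IntD2 continuous_on_subset subsetI)
  have Wcont: "continuous_on (closure \<Omega>) W" using W by (simp add: outward_field_def)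
  then have WK: "continuous_on Kc W" by (rule continuous_on_subset) (simp add: Kc_def)
  obtain M where M: "M \<ge> 0" "\<And>x. x \<in> \<Omega> \<Longrightarrow> norm (pd1 W x) \<le> M" "\<And>x. x \<in> \<Omega> \<Longrightarrow> norm (pd2 W x) \<le> M"
    "\<And>x. x \<in> \<Omega> \<Longrightarrow> \<bar>divg W x\<bar> \<le> 2 * M" using outward_field_bounds[OF W] by blast
  have hpW: "has_partials W (pd1 W x) (pd2 W x) x" if "x \<in> \<Omega>" for x
    using W that by (simp add: has_partials_iff outward_field_def)
  have "bounded (gd ` Kc)" "bounded (W ` Kc)"
    using cK gdcont WK compact_continuous_image compact_imp_bounded by blast+
  then obtain G1 G2 where G12: "\<And>x. x \<in> Kc \<Longrightarrow> norm (gd x) \<le> G1" "\<And>x. x \<in> Kc \<Longrightarrow> norm (W x) \<le> G2"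
    unfolding bounded_iff ball_simps(9) by meson
  define G where "G = max 0 (max G1 G2)"
  have G: "norm (gd x) \<le> G" "norm (W x) \<le> G" if "x \<in> Kc" for x
    using G12[OF that] by (auto simp: G_def)
  have "G \<ge> 0" by (simp add: G_def)
  obtain L where L: "L \<ge> 0" "\<And>s t. s \<in> {0..1} \<Longrightarrow> t \<in> {0..1} \<Longrightarrow> dist (p s) (p t) \<le> L * \<bar>s - t\<bar>"
    using smooth_loop_lipschitz[OF p] by blast
  obtain C2 where C2: "C2 \<ge> 0"
    "\<And>e. 0 < e \<Longrightarrow> e \<le> 1 \<Longrightarrow> measure lborel {x. infdist x (path_image p) < e} \<le> C2 * e"
    using measure_neighbourhood_of_curve[OF L(2,1)] by blast
  \<comment> \<open>By compactness the sign of the normal component at the boundary persists, up to \<open>\<eta>\<close>, in a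
    thin layer; \<open>gd\<close> points inward.\<close>
  have thin: "\<exists>\<delta>>0. \<forall>x\<in>Kc. d x < \<delta> \<longrightarrow> inner (gd x) (W x) \<le> \<eta>" if \<eta>: "\<eta> > 0" for \<eta>
  proof -
    let ?g = "\<lambda>x. inner (gd x) (W x)"
    let ?S = "Kc \<inter> ?g -` {\<eta>..}"
    have gc: "continuous_on Kc ?g" using gdcont WK by (intro continuous_intros)
    have cS: "compact ?S"
      using continuous_on_closed_vimage[of Kc ?g] gc cK compact_imp_closed
      by (metis (no_types, lifting) closed_real_atLeast Int_commute compact_Int_closed inf.idem inf_assoc)
    have dpos: "d x > 0" if x: "x \<in> ?S" for x
    proof -
      have xb: "x \<in> ball x0 r" "x \<in> closure \<Omega>" using x Kb by (auto simp: Kc_def)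
      show ?thesis
      proof (cases "x \<in> \<Omega>")
        case True then show ?thesis using c xb by (simp add: collar_def)
      next
        case False
        then have fr: "x \<in> frontier \<Omega>" using xb by (auto simp: closure_Un_frontier)
        have "inner (W x) (- (1 / norm (gd x)) *\<^sub>R gd x) \<ge> 0"
          using collar_outer_unit_normal[OF dom c xb(1) fr] W fr unfolding outward_field_def by blast
        moreover have "norm (gd x) > 0" using c xb by (simp add: collar_def)
        ultimately have "?g x \<le> 0"
          by (simp add: inner_commute[of "W x"] divide_le_0_iff)
        then show ?thesis using x \<eta> by auto
      qed
    qed
    show ?thesis
    proof (cases "?S = {}")
      case True
      then show ?thesis by (intro exI[of _ 1]) (auto simp: not_le)
    next
      case False
      have "continuous_on ?S d" using Kb by (intro dcont) (auto simp: Kc_def)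
      then obtain y where y: "y \<in> ?S" "\<forall>x\<in>?S. d y \<le> d x"
        using continuous_attains_inf[OF cS False] by blast
      have "\<forall>x\<in>Kc. d x < d y \<longrightarrow> ?g x \<le> \<eta>"
      proof (intro ballI impI)
        fix x assume x: "x \<in> Kc" "d x < d y"
        then have "x \<notin> ?S" using y(2) not_le by blast
        then show "?g x \<le> \<eta>" using x(1) by simp
      qed
      then show ?thesis using dpos[OF y(1)] by blast
    qed
  qed
  define W\<epsilon> where "W\<epsilon> \<epsilon> x = (if x \<in> Q then smooth_step (d x / \<epsilon>) *\<^sub>R W x else 0)" for \<epsilon> x
  define \<chi>1 where "\<chi>1 \<epsilon> x = smooth_step_deriv (d x / \<epsilon>) / \<epsilon>" for \<epsilon> x
  have hp_in: "has_partials (W\<epsilon> \<epsilon>)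
       ((\<chi>1 \<epsilon> x * Re (gd x)) *\<^sub>R W x + smooth_step (d x / \<epsilon>) *\<^sub>R pd1 W x)
       ((\<chi>1 \<epsilon> x * Im (gd x)) *\<^sub>R W x + smooth_step (d x / \<epsilon>) *\<^sub>R pd2 W x) x"
     and div_in: "divg (W\<epsilon> \<epsilon>) x = smooth_step (d x / \<epsilon>) * divg W x + \<chi>1 \<epsilon> x * inner (gd x) (W x)"
    if x: "x \<in> Q" and \<epsilon>: "\<epsilon> > 0" for x \<epsilon>
  proof -
    have xb: "x \<in> ball x0 r" "x \<in> \<Omega>" using x by (auto simp: Q_def)
    have 1: "((\<lambda>x. d x / \<epsilon>) has_derivative (\<lambda>h. inner (gd x) h / \<epsilon>)) (at x)"
      using Dd[OF xb(1)] \<epsilon> by (auto intro!: derivative_eq_intros)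
    have "(smooth_step has_derivative (*) (smooth_step_deriv (d x / \<epsilon>))) (at (d x / \<epsilon>))"
      using smooth_step_has_derivative by (simp add: has_field_derivative_def)
    from has_derivative_compose[OF 1 this]
    have hp\<chi>: "has_partials (\<lambda>x. smooth_step (d x / \<epsilon>)) (\<chi>1 \<epsilon> x * Re (gd x)) (\<chi>1 \<epsilon> x * Im (gd x)) x"
      unfolding has_partials_def
      by (rule has_derivative_eq_rhs) (use \<epsilon> in \<open>auto simp: \<chi>1_def inner_complex_def fun_eq_iff field_simps\<close>)
    have eqW: "W\<epsilon> \<epsilon> y = smooth_step (d y / \<epsilon>) *\<^sub>R W y" if "y \<in> Q" for y
      using that by (simp add: W\<epsilon>_def)
    show hp: "has_partials (W\<epsilon> \<epsilon>)
       ((\<chi>1 \<epsilon> x * Re (gd x)) *\<^sub>R W x + smooth_step (d x / \<epsilon>) *\<^sub>R pd1 W x)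
       ((\<chi>1 \<epsilon> x * Im (gd x)) *\<^sub>R W x + smooth_step (d x / \<epsilon>) *\<^sub>R pd2 W x) x"
      by (rule has_partials_cong_open[OF oQ x eqW[symmetric] has_partials_scaleR[OF hp\<chi> hpW[OF xb(2)]]])
    show "divg (W\<epsilon> \<epsilon>) x = smooth_step (d x / \<epsilon>) * divg W x + \<chi>1 \<epsilon> x * inner (gd x) (W x)"
      using divg_has_partials[OF hp] divg_has_partials[OF hpW[OF xb(2)]]
      by (simp add: inner_complex_def algebra_simps)
  qed
  have hp_out: "has_partials (W\<epsilon> \<epsilon>) 0 0 x" if x: "x \<notin> Q \<inter> cball x0 (r / 2)" and \<epsilon>: "\<epsilon> > 0" for x \<epsilon>
  proof (cases "x \<in> cball x0 (r / 2)")
    case False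
    show ?thesis
    proof (rule has_partials_zero_extension[of "- cball x0 (r / 2)"])
      fix y assume "y \<in> - cball x0 (r / 2)"
      then show "W\<epsilon> \<epsilon> y = 0" using supp[of y] closure_subset[of \<Omega>] by (auto simp: W\<epsilon>_def Q_def)
    qed (use False in \<open>auto simp: open_Compl\<close>)
  next
    case True
    then have xb: "x \<in> ball x0 r" using Kb by blast
    then have "x \<notin> \<Omega>" using x True by (auto simp: Q_def)
    then have dx: "d x < \<epsilon>" using c xb \<epsilon> by (auto simp: collar_def not_less)
    show ?thesis
    proof (rule has_partials_zero_extension[of "ball x0 r \<inter> d -` {..<\<epsilon>}"])
      show "open (ball x0 r \<inter> d -` {..<\<epsilon>})"
        by (rule continuous_open_preimage[OF dcont]) auto
      fix y assume "y \<in> ball x0 r \<inter> d -` {..<\<epsilon>}"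
      then have "d y / \<epsilon> \<le> 1" using \<epsilon> by simp
      then show "W\<epsilon> \<epsilon> y = 0" by (simp add: W\<epsilon>_def smooth_step_low)
    qed (use xb dx in auto)
  qed
  have int\<epsilon>: "integrable lborel (divg (W\<epsilon> \<epsilon>)) \<and> integral\<^sup>L lborel (divg (W\<epsilon> \<epsilon>)) = 0" if \<epsilon>: "\<epsilon> > 0" for \<epsilon>
  proof -
    have diff: "W\<epsilon> \<epsilon> differentiable (at x)" for x
      using has_partials_differentiable hp_in[OF _ \<epsilon>] hp_out[OF _ \<epsilon>] by (cases "x \<in> Q") blast+
    let ?B = "4 / \<epsilon> * G * G + M"
    have B0: "?B \<ge> 0" using \<epsilon> M \<open>G \<ge> 0\<close> by simp
    have bb: "norm ((\<chi>1 \<epsilon> x * t) *\<^sub>R W x + smooth_step (d x / \<epsilon>) *\<^sub>R w) \<le> ?B"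
      if "x \<in> Q \<inter> cball x0 (r / 2)" "\<bar>t\<bar> \<le> norm (gd x)" "norm w \<le> M" for x t w
    proof -
      have xK: "x \<in> Kc" using that(1) closure_subset by (auto simp: Q_def Kc_def)
      have "\<bar>\<chi>1 \<epsilon> x\<bar> \<le> 4 / \<epsilon>"
        using smooth_step_deriv_range[of "d x / \<epsilon>"] \<epsilon> by (simp add: \<chi>1_def divide_right_mono)
      then have "norm ((\<chi>1 \<epsilon> x * t) *\<^sub>R W x) \<le> 4 / \<epsilon> * G * G"
        unfolding norm_scaleR abs_mult using order_trans[OF that(2) G(1)[OF xK]] G(2)[OF xK] \<open>G \<ge> 0\<close> \<epsilon>
        by (intro mult_mono) auto
      moreover have "norm (smooth_step (d x / \<epsilon>) *\<^sub>R w) \<le> 1 * M"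
        unfolding norm_scaleR using smooth_step_range[of "d x / \<epsilon>"] that(3) by (intro mult_mono) auto
      ultimately show ?thesis by (intro order_trans[OF norm_triangle_ineq]) auto
    qed
    have b: "norm (pd1 (W\<epsilon> \<epsilon>) x) \<le> ?B \<and> norm (pd2 (W\<epsilon> \<epsilon>) x) \<le> ?B" for x
    proof (cases "x \<in> Q \<inter> cball x0 (r / 2)")
      case True
      then have "x \<in> Q" "x \<in> \<Omega>" by (auto simp: Q_def)
      then show ?thesis
        using bb[OF True abs_Re_le_cmod M(2)] bb[OF True abs_Im_le_cmod M(3)] has_partials_pd[OF hp_in[OF \<open>x \<in> Q\<close> \<epsilon>]]
        by simp
    next
      case False
      then show ?thesis using has_partials_pd[OF hp_out[OF False \<epsilon>]] B0 by simp
    qed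
    obtain R where R: "\<And>x. x \<in> \<Omega> \<Longrightarrow> norm x \<le> R" using bd unfolding bounded_iff by blast
    have z: "W\<epsilon> \<epsilon> x = 0" if "norm x > R" for x using R[of x] that by (auto simp: W\<epsilon>_def Q_def)
    show ?thesis
      using integral_divg_compact_support[OF diff conjunct1[OF b] conjunct2[OF b] z] by blast
  qed
  have divW0: "divg W x = 0" if "x \<in> \<Omega>" "x \<notin> cball x0 (r / 2)" for x
  proof -
    have "has_partials W 0 0 x"
    proof (rule has_partials_zero_extension[of "\<Omega> - cball x0 (r / 2)"])
      fix y assume "y \<in> \<Omega> - cball x0 (r / 2)"
      then show "W y = 0" using supp[of y] closure_subset[of \<Omega>] by auto
    qed (use that op in \<open>auto simp: open_Diff\<close>)
    from divg_has_partials[OF this] show ?thesis by simp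
  qed
  define f where "f \<epsilon> x = indicator Q x *\<^sub>R (smooth_step (d x / \<epsilon>) * divg W x)" for \<epsilon> x
  have domi: "integrable lborel (\<lambda>x. 2 * M * indicator \<Omega> x)"
  proof -
    have "emeasure lborel \<Omega> < \<infinity>" using bd emeasure_bounded_finite by blast
    then show ?thesis using op by (intro integrable_mult_right integrable_real_indicator) auto
  qed
  have fb: "norm (f \<epsilon> x) \<le> 2 * M * indicator \<Omega> x" for \<epsilon> x
  proof (cases "x \<in> Q")
    case True
    then have "x \<in> \<Omega>" by (simp add: Q_def)
    have "\<bar>smooth_step (d x / \<epsilon>)\<bar> * \<bar>divg W x\<bar> \<le> 1 * (2 * M)"
      using smooth_step_range[of "d x / \<epsilon>"] M(4)[OF \<open>x \<in> \<Omega>\<close>] by (intro mult_mono) auto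
    then show ?thesis using True \<open>x \<in> \<Omega>\<close> by (simp add: f_def abs_mult)
  qed (use M in \<open>auto simp: f_def indicator_def\<close>)
  have fm: "f \<epsilon> \<in> borel_measurable lborel" for \<epsilon>
  proof -
    have ssc: "continuous_on UNIV smooth_step"
      using smooth_step_has_derivative DERIV_continuous_on by blast
    have "continuous_on Q (\<lambda>x. d x / \<epsilon>)" unfolding divide_inverse
      by (intro continuous_intros dcont) (auto simp: Q_def)
    then have "continuous_on Q (\<lambda>x. smooth_step (d x / \<epsilon>))"
      by (rule continuous_on_compose2[OF ssc]) auto
    moreover have "continuous_on Q (divg W)"
      using W continuous_on_subset[of \<Omega> "divg W" Q] by (auto simp: outward_field_def Q_def)
    ultimately have "continuous_on Q (\<lambda>x. smooth_step (d x / \<epsilon>) * divg W x)"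
      by (rule continuous_on_mult)
    from borel_measurable_continuous_on_indicator[OF _ this] oQ show ?thesis
      unfolding f_def[abs_def] by simp
  qed
  have fi: "integrable lborel (f \<epsilon>)" for \<epsilon>
    by (rule Bochner_Integration.integrable_bound[OF domi fm])
      (use fb M in \<open>force simp: abs_mult\<close>)
  let ?I = "LINT x:\<Omega>|lborel. divg W x"
  \<comment> \<open>The cut-off function varies only where \<open>d < 2 \<epsilon>\<close>, that is within distance \<open>2 C \<epsilon>\<close> of the
    curve; \<open>C + 1\<close> replaces \<open>C\<close> to have a positive radius also for \<open>C = 0\<close>.\<close>
  have lower: "integral\<^sup>L lborel (f \<epsilon>) \<ge> - (8 * C2 * (C + 1)) * \<eta>"
    if \<eta>: "\<eta> > 0" and \<delta>: "\<And>x. x \<in> Kc \<Longrightarrow> d x < \<delta> \<Longrightarrow> inner (gd x) (W x) \<le> \<eta>"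
      and \<epsilon>: "\<epsilon> > 0" "2 * \<epsilon> < \<delta>" "2 * (C + 1) * \<epsilon> \<le> 1" for \<eta> \<delta> \<epsilon>
  proof -
    let ?N = "{x. infdist x (path_image p) < 2 * (C + 1) * \<epsilon>}"
    have e1: "0 < 2 * (C + 1) * \<epsilon>" using \<epsilon> C by simp
    have Nm: "?N \<in> sets lborel"
    proof -
      have "open ?N" by (intro open_Collect_less continuous_intros)
      then show ?thesis by simp
    qed
    have Nf: "emeasure lborel ?N < \<infinity>"
    proof -
      have "compact {x. infdist x (path_image p) \<le> 2 * (C + 1) * \<epsilon>}"
        using e1 smooth_loop_simple_path[OF p] by (intro compact_infdist_le compact_simple_path_image) auto
      then have "bounded ?N" by (rule bounded_subset[OF compact_imp_bounded]) auto
      then show ?thesis by (rule emeasure_bounded_finite)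
    qed
    have Ni: "integrable lborel (\<lambda>x. (4 * \<eta> / \<epsilon>) * indicator ?N x)"
      using Nm Nf by (intro integrable_mult_right integrable_real_indicator) auto
    have pw: "divg (W\<epsilon> \<epsilon>) x \<le> f \<epsilon> x + (4 * \<eta> / \<epsilon>) * indicator ?N x" for x
    proof (cases "x \<in> Q \<inter> cball x0 (r / 2)")
      case True
      then have x: "x \<in> Q" "x \<in> Kc" "x \<in> ball x0 r" "x \<in> \<Omega>"
        using closure_subset[of \<Omega>] by (auto simp: Q_def Kc_def)
      have "\<chi>1 \<epsilon> x * inner (gd x) (W x) \<le> (4 * \<eta> / \<epsilon>) * indicator ?N x"
      proof (cases "d x < 2 * \<epsilon>")
        case True
        have "d x > 0" using c x by (simp add: collar_def)
        have "C * \<bar>d x\<bar> \<le> C * (2 * \<epsilon>)" using True \<open>d x > 0\<close> C by (intro mult_left_mono) auto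
        then have "infdist x (path_image p) < 2 * (C + 1) * \<epsilon>"
          using C(2)[OF x(3)] \<epsilon> by (simp add: algebra_simps)
        then have xN: "x \<in> ?N" by simp
        have "0 \<le> \<chi>1 \<epsilon> x" "\<chi>1 \<epsilon> x \<le> 4 / \<epsilon>"
          using smooth_step_deriv_range[of "d x / \<epsilon>"] \<epsilon> by (auto simp: \<chi>1_def divide_right_mono)
        then have "\<chi>1 \<epsilon> x * inner (gd x) (W x) \<le> 4 / \<epsilon> * \<eta>"
          using \<delta>[OF x(2)] True \<epsilon> \<eta> by (meson mult_left_mono mult_right_mono order_trans less_imp_le less_trans)
        then show ?thesis using xN by simp
      next
        case False
        then have "smooth_step_deriv (d x / \<epsilon>) = 0"
          using \<epsilon> smooth_step_high[of "d x / \<epsilon>"] by (simp add: field_simps)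
        then show ?thesis using \<eta> \<epsilon> by (simp add: \<chi>1_def)
      qed
      then show ?thesis using div_in[OF x(1) \<epsilon>(1)] x(1) by (simp add: f_def)
    next
      case False
      have "f \<epsilon> x = 0" using False divW0 by (auto simp: f_def Q_def indicator_def)
      moreover have "divg (W\<epsilon> \<epsilon>) x = 0" using divg_has_partials[OF hp_out[OF False \<epsilon>(1)]] by simp
      ultimately show ?thesis using \<eta> \<epsilon> by simp
    qed
    have "0 = integral\<^sup>L lborel (divg (W\<epsilon> \<epsilon>))" using int\<epsilon>[OF \<epsilon>(1)] by simp
    also have "\<dots> \<le> integral\<^sup>L lborel (\<lambda>x. f \<epsilon> x + (4 * \<eta> / \<epsilon>) * indicator ?N x)"
      using int\<epsilon>[OF \<epsilon>(1)] fi Ni pw by (intro integral_mono Bochner_Integration.integrable_add) auto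
    also have "\<dots> = integral\<^sup>L lborel (f \<epsilon>) + (4 * \<eta> / \<epsilon>) * measure lborel ?N"
      using fi Ni Nm by (subst Bochner_Integration.integral_add) auto
    also have "\<dots> \<le> integral\<^sup>L lborel (f \<epsilon>) + (4 * \<eta> / \<epsilon>) * (C2 * (2 * (C + 1) * \<epsilon>))"
      using C2(2)[OF e1 \<epsilon>(3)] \<eta> \<epsilon> by (intro add_left_mono mult_left_mono) auto
    also have "(4 * \<eta> / \<epsilon>) * (C2 * (2 * (C + 1) * \<epsilon>)) = 8 * C2 * (C + 1) * \<eta>"
      using \<epsilon> by (simp add: field_simps)
    finally show ?thesis by simp
  qed
  have lim: "(\<lambda>n. integral\<^sup>L lborel (f (1 / real (Suc n)))) \<longlonglongrightarrow> ?I"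
    unfolding set_lebesgue_integral_def
  proof (rule integral_dominated_convergence[OF _ fm domi])
    show "(\<lambda>x. indicator \<Omega> x *\<^sub>R divg W x) \<in> borel_measurable lborel"
      using borel_measurable_continuous_on_indicator[of \<Omega> "divg W"] W op by (simp add: outward_field_def)
    show "AE x in lborel. norm (f (1 / real (Suc n)) x) \<le> 2 * M * indicator \<Omega> x" for n
      using fb by simp
    have "(\<lambda>n. f (1 / real (Suc n)) x) \<longlonglongrightarrow> indicator \<Omega> x *\<^sub>R divg W x" for x
    proof (cases "x \<in> Q")
      case True
      then have "d x > 0" using c by (auto simp: Q_def collar_def)
      obtain N :: nat where N: "2 / d x \<le> real N" using real_arch_simple by blast
      have "f (1 / real (Suc n)) x = indicator \<Omega> x *\<^sub>R divg W x" if "n \<ge> N" for n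
      proof -
        have "2 / d x \<le> real (Suc n)" using that N by simp
        then have "2 \<le> d x / (1 / real (Suc n))"
          using \<open>d x > 0\<close> by (simp add: divide_le_eq mult.commute)
        then show ?thesis using smooth_step_high True by (simp add: f_def Q_def del: of_nat_Suc)
      qed
      then show ?thesis by (intro tendsto_eventually) (auto simp: eventually_sequentially)
    next
      case False
      then have "indicator \<Omega> x *\<^sub>R divg W x = 0"
        using divW0[of x] Kb by (auto simp: Q_def indicator_def)
      moreover have "f (1 / real (Suc n)) x = 0" for n using False by (simp add: f_def)
      ultimately show ?thesis by (simp only: tendsto_const)
    qed
    then show "AE x in lborel. (\<lambda>n. f (1 / real (Suc n)) x) \<longlonglongrightarrow> indicator \<Omega> x *\<^sub>R divg W x"
      by simp
  qed
  have Ilow: "?I \<ge> - (8 * C2 * (C + 1)) * \<eta>" if \<eta>: "\<eta> > 0" for \<eta>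
  proof -
    obtain \<delta> where \<delta>: "\<delta> > 0" "\<And>x. x \<in> Kc \<Longrightarrow> d x < \<delta> \<Longrightarrow> inner (gd x) (W x) \<le> \<eta>"
      using thin[OF \<eta>] by blast
    have to0: "(\<lambda>n. 1 / real (Suc n)) \<longlonglongrightarrow> 0" using LIMSEQ_inverse_real_of_nat by (simp add: inverse_eq_divide)
    have "0 < min (\<delta> / 2) (1 / (2 * (C + 1)))" using \<delta> C by simp
    from order_tendstoD(2)[OF to0 this]
    have "\<forall>\<^sub>F n in sequentially. integral\<^sup>L lborel (f (1 / real (Suc n))) \<ge> - (8 * C2 * (C + 1)) * \<eta>"
    proof eventually_elim
      case (elim n)
      then show ?case
        using C by (intro lower[OF \<eta> \<delta>(2)]) (auto simp: field_simps)
    qed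
    then show ?thesis by (rule tendsto_lowerbound[OF lim]) simp
  qed
  show ?thesis
  proof (rule ccontr)
    assume neg: "\<not> 0 \<le> ?I"
    define K where "K = 8 * C2 * (C + 1)"
    have "K \<ge> 0" using C C2 by (simp add: K_def)
    have "?I \<ge> - K * (- ?I / (2 * (K + 1)))"
      unfolding K_def by (rule Ilow) (use neg \<open>K \<ge> 0\<close> in \<open>auto simp: K_def intro!: divide_neg_pos\<close>)
    also have "- K * (- ?I / (2 * (K + 1))) \<ge> ?I / 2"
      using neg \<open>K \<ge> 0\<close> by (simp add: field_simps)
    finally show False using neg by simp
  qed
qed

text \<open>Boundary points have a collar; the radius is halved because the field has to vanish near the rim
  of the collar.\<close>

lemma local_divergence_inequality:
  assumes dom: "connected_smooth_domain k \<Omega>" and x0: "x0 \<in> closure \<Omega>"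
  shows "\<exists>r>0. \<forall>W. outward_field \<Omega> W \<longrightarrow> (\<forall>x\<in>closure \<Omega>. x \<notin> ball x0 r \<longrightarrow> W x = 0) \<longrightarrow>
     0 \<le> (LINT x:\<Omega>|lborel. divg W x)"
proof (cases "x0 \<in> \<Omega>")
  case True
  have op: "open \<Omega>" and bd: "bounded \<Omega>" using dom by (auto simp: connected_smooth_domain_def)
  obtain r where "r > 0" "cball x0 r \<subseteq> \<Omega>" using op True open_contains_cball by blast
  then show ?thesis
    using local_divergence_inequality_interior[OF op bd] by (intro exI[of _ r]) force
next
  case False
  then have "x0 \<in> frontier \<Omega>" using x0 by (auto simp: closure_Un_frontier)
  then obtain r d gd p C where c: "collar \<Omega> x0 r d gd" "smooth_loop p" "C \<ge> 0"
      "\<And>x. x \<in> ball x0 r \<Longrightarrow> infdist x (path_image p) \<le> C * \<bar>d x\<bar>"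
    using collar_exists[OF dom] by blast
  have "r / 2 > 0" using c by (simp add: collar_def)
  then show ?thesis
    using local_divergence_inequality_boundary[OF dom c] by (intro exI[of _ "r / 2"]) blast
qed

lemma outward_field_scaleR:
  assumes op: "open \<Omega>" and bd: "bounded \<Omega>" and W: "outward_field \<Omega> W"
    and \<phi>: "\<And>x. x \<in> closure \<Omega> \<Longrightarrow> \<phi> x \<ge> 0"
    and D: "\<And>x. x \<in> closure \<Omega> \<Longrightarrow> (\<phi> has_derivative inner (g x)) (at x)"
    and g: "continuous_on (closure \<Omega>) g"
  shows "outward_field \<Omega> (\<lambda>x. \<phi> x *\<^sub>R W x)"
proof -
  have cl: "x \<in> closure \<Omega>" if "x \<in> \<Omega>" for x using that closure_subset by blast
  have \<phi>c: "continuous_on (closure \<Omega>) \<phi>"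
    using D has_derivative_continuous continuous_at_imp_continuous_on by blast
  have Wc: "continuous_on (closure \<Omega>) W" using W by (simp add: outward_field_def)
  have hp\<phi>: "has_partials \<phi> (Re (g x)) (Im (g x)) x" if "x \<in> \<Omega>" for x
    using D[OF cl[OF that]] unfolding has_partials_def
    by (rule has_derivative_eq_rhs) (auto simp: inner_complex_def fun_eq_iff)
  have hpW: "has_partials W (pd1 W x) (pd2 W x) x" if "x \<in> \<Omega>" for x
    using W that by (simp add: has_partials_iff outward_field_def)
  have hp: "has_partials (\<lambda>x. \<phi> x *\<^sub>R W x) (Re (g x) *\<^sub>R W x + \<phi> x *\<^sub>R pd1 W x)
      (Im (g x) *\<^sub>R W x + \<phi> x *\<^sub>R pd2 W x) x" if "x \<in> \<Omega>" for x
    by (rule has_partials_scaleR[OF hp\<phi>[OF that] hpW[OF that]])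
  have comp: "compact (closure \<Omega>)" using bd by simp
  obtain M where M: "M \<ge> 0" "\<And>x. x \<in> \<Omega> \<Longrightarrow> norm (pd1 W x) \<le> M" "\<And>x. x \<in> \<Omega> \<Longrightarrow> norm (pd2 W x) \<le> M"
    using outward_field_bounds[OF W] by blast
  have "bounded (g ` closure \<Omega>)" "bounded (W ` closure \<Omega>)" "bounded (\<phi> ` closure \<Omega>)"
    using comp g Wc \<phi>c compact_continuous_image compact_imp_bounded by blast+
  then obtain G1 G2 G3 where G: "\<And>x. x \<in> closure \<Omega> \<Longrightarrow> norm (g x) \<le> G1" "\<And>x. x \<in> closure \<Omega> \<Longrightarrow> norm (W x) \<le> G2"
      "\<And>x. x \<in> closure \<Omega> \<Longrightarrow> norm (\<phi> x) \<le> G3"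
    unfolding bounded_iff ball_simps(9) by meson
  have bb: "norm (t *\<^sub>R W x + \<phi> x *\<^sub>R w) \<le> G1 * G2 + G3 * M"
    if "x \<in> \<Omega>" "\<bar>t\<bar> \<le> norm (g x)" "norm w \<le> M" for x t w
  proof -
    have "norm (t *\<^sub>R W x) \<le> G1 * G2" "norm (\<phi> x *\<^sub>R w) \<le> G3 * M"
      unfolding norm_scaleR
      using G[OF cl[OF that(1)]] that order_trans[OF norm_ge_zero] by (intro mult_mono; force)+
    then show ?thesis by (intro order_trans[OF norm_triangle_ineq] add_mono)
  qed
  have "bounded (pd1 (\<lambda>x. \<phi> x *\<^sub>R W x) ` \<Omega>)"
    unfolding bounded_iff using has_partials_pd(1)[OF hp] bb[OF _ abs_Re_le_cmod M(2)] by auto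
  moreover have "bounded (pd2 (\<lambda>x. \<phi> x *\<^sub>R W x) ` \<Omega>)"
    unfolding bounded_iff using has_partials_pd(2)[OF hp] bb[OF _ abs_Im_le_cmod M(3)] by auto
  moreover have "continuous_on \<Omega> (divg (\<lambda>x. \<phi> x *\<^sub>R W x))"
  proof -
    have "continuous_on \<Omega> (\<lambda>x. \<phi> x * divg W x + inner (g x) (W x))"
      using W continuous_on_subset[OF \<phi>c closure_subset] continuous_on_subset[OF Wc closure_subset]
        continuous_on_subset[OF g closure_subset]
      by (intro continuous_intros) (auto simp: outward_field_def)
    moreover have "divg (\<lambda>x. \<phi> x *\<^sub>R W x) x = \<phi> x * divg W x + inner (g x) (W x)" if "x \<in> \<Omega>" for x
      using divg_scaleR[OF hp\<phi>[OF that] hpW[OF that]] by simp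
    ultimately show ?thesis using continuous_on_cong[of \<Omega> \<Omega>] by simp
  qed
  moreover have "inner (\<phi> x *\<^sub>R W x) \<nu> \<ge> 0" if "x \<in> frontier \<Omega>" "outer_unit_normal \<Omega> x \<nu>" for x \<nu>
  proof -
    have "x \<in> closure \<Omega>" using that(1) by (simp add: frontier_def)
    then show ?thesis using \<phi> that W by (simp add: outward_field_def)
  qed
  ultimately show ?thesis
    unfolding outward_field_def
    using has_partials_differentiable[OF hp] continuous_on_scaleR[OF \<phi>c Wc] by blast
qed

definition bump :: "complex \<Rightarrow> real \<Rightarrow> complex \<Rightarrow> real" where
  "bump a r x = (max 0 (r\<^sup>2 - inner (x - a) (x - a)))\<^sup>2"

definition bump_grad :: "complex \<Rightarrow> real \<Rightarrow> complex \<Rightarrow> complex" where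
  "bump_grad a r x = (- 4 * max 0 (r\<^sup>2 - inner (x - a) (x - a))) *\<^sub>R (x - a)"

lemma bump_has_derivative: "(bump a r has_derivative inner (bump_grad a r x)) (at x)"
proof -
  have 1: "((\<lambda>x. r\<^sup>2 - inner (x - a) (x - a)) has_derivative (\<lambda>h. - 2 * inner (x - a) h)) (at x)"
    by (auto intro!: derivative_eq_intros simp: inner_commute)
  have "((\<lambda>t. (max 0 t)\<^sup>2) has_derivative (*) (2 * max 0 (r\<^sup>2 - inner (x - a) (x - a)))) (at (r\<^sup>2 - inner (x - a) (x - a)))"
    using has_real_derivative_positive_part_square by (simp add: has_field_derivative_def)
  from has_derivative_compose[OF 1 this] show ?thesis
    unfolding bump_def[abs_def] by (rule has_derivative_eq_rhs) (auto simp: bump_grad_def fun_eq_iff)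
qed

lemma bump_nonneg: "bump a r x \<ge> 0"
  by (simp add: bump_def)

lemma bump_pos: "x \<in> ball a r \<Longrightarrow> bump a r x > 0"
proof -
  assume "x \<in> ball a r"
  then have "(norm (x - a))\<^sup>2 < r\<^sup>2" by (intro power_strict_mono) (auto simp: dist_norm norm_minus_commute)
  then show ?thesis by (simp add: bump_def dot_square_norm max_def)
qed

lemma bump_zero: "x \<notin> ball a r \<Longrightarrow> r > 0 \<Longrightarrow> bump a r x = 0"
proof -
  assume "x \<notin> ball a r" "r > 0"
  then have "r\<^sup>2 \<le> (norm (x - a))\<^sup>2" by (intro power_mono) (auto simp: dist_norm norm_minus_commute)
  then show ?thesis by (simp add: bump_def dot_square_norm max_def)
qed

text \<open>A partition of unity, built from finitely many bumps, reduces the inequality to fields with small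
  support.\<close>

theorem divergence_inequality:
  assumes dom: "connected_smooth_domain k \<Omega>" and W: "outward_field \<Omega> W"
  shows "0 \<le> (LINT x:\<Omega>|lborel. divg W x)"
proof -
  have op: "open \<Omega>" and bd: "bounded \<Omega>" using dom by (auto simp: connected_smooth_domain_def)
  have "\<forall>x0\<in>closure \<Omega>. \<exists>r>0. \<forall>W. outward_field \<Omega> W \<longrightarrow> (\<forall>x\<in>closure \<Omega>. x \<notin> ball x0 r \<longrightarrow> W x = 0) \<longrightarrow>
     0 \<le> (LINT x:\<Omega>|lborel. divg W x)"
    using local_divergence_inequality[OF dom] by blast
  then obtain r where r: "\<And>a. a \<in> closure \<Omega> \<Longrightarrow> r a > 0"
    "\<And>a W. a \<in> closure \<Omega> \<Longrightarrow> outward_field \<Omega> W \<Longrightarrow> (\<And>x. x \<in> closure \<Omega> \<Longrightarrow> x \<notin> ball a (r a) \<Longrightarrow> W x = 0) \<Longrightarrow>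
     0 \<le> (LINT x:\<Omega>|lborel. divg W x)"
    unfolding bchoice_iff by blast
  have "compact (closure \<Omega>)" using bd by simp
  moreover have "closure \<Omega> \<subseteq> (\<Union>a\<in>closure \<Omega>. ball a (r a))" using r(1) by fastforce
  ultimately obtain A where A: "A \<subseteq> closure \<Omega>" "finite A" "closure \<Omega> \<subseteq> (\<Union>a\<in>A. ball a (r a))"
    using compactE_image[of "closure \<Omega>" "closure \<Omega>" "\<lambda>a. ball a (r a)"] by auto
  define \<Psi> where "\<Psi> x = (\<Sum>a\<in>A. bump a (r a) x)" for x
  define g where "g x = (\<Sum>a\<in>A. bump_grad a (r a) x)" for x
  have \<Psi>pos: "\<Psi> x > 0" if x: "x \<in> closure \<Omega>" for x
  proof -
    obtain a where "a \<in> A" "x \<in> ball a (r a)" using A(3) x by blast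
    then show ?thesis unfolding \<Psi>_def using A(2) bump_pos bump_nonneg
      by (intro sum_pos2[of A a]) auto
  qed
  have D\<Psi>: "(\<Psi> has_derivative inner (g x)) (at x)" for x
    unfolding \<Psi>_def[abs_def] g_def inner_sum_left[abs_def]
    by (rule has_derivative_sum) (rule bump_has_derivative)
  have bgc: "continuous_on S (bump_grad a q)" for S a q
    unfolding bump_grad_def by (intro continuous_intros)
  have gc: "continuous_on S g" for S
    unfolding g_def by (intro continuous_on_sum bgc)
  have \<Psi>c: "continuous_on S \<Psi>" for S
    by (rule continuous_at_imp_continuous_on) (use has_derivative_continuous[OF D\<Psi>] in auto)
  define W' where "W' x = (1 / \<Psi> x) *\<^sub>R W x" for x
  have W': "outward_field \<Omega> W'" unfolding W'_def
  proof (rule outward_field_scaleR[OF op bd W])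
    show "((\<lambda>x. 1 / \<Psi> x) has_derivative inner ((- 1 / (\<Psi> x)\<^sup>2) *\<^sub>R g x)) (at x)" if "x \<in> closure \<Omega>" for x
      using D\<Psi>[of x] \<Psi>pos[OF that]
      by (auto intro!: derivative_eq_intros simp: fun_eq_iff power2_eq_square field_simps)
    show "continuous_on (closure \<Omega>) (\<lambda>x. (- 1 / (\<Psi> x)\<^sup>2) *\<^sub>R g x)"
      using \<Psi>pos by (intro continuous_intros gc \<Psi>c) fastforce
    show "1 / \<Psi> x \<ge> 0" if "x \<in> closure \<Omega>" for x using \<Psi>pos[OF that] by simp
  qed
  define V where "V a x = bump a (r a) x *\<^sub>R W' x" for a x
  have V: "outward_field \<Omega> (V a)" for a
    unfolding V_def
    by (rule outward_field_scaleR[OF op bd W' bump_nonneg bump_has_derivative bgc])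
  have pos: "0 \<le> (LINT x:\<Omega>|lborel. divg (V a) x)" if "a \<in> A" for a
    using that A(1) by (intro r(2)[OF _ V]) (auto simp: V_def bump_zero r(1))
  have eq: "divg W x = (\<Sum>a\<in>A. divg (V a) x)" if x: "x \<in> \<Omega>" for x
  proof -
    have hp: "has_partials (V a) (pd1 (V a) x) (pd2 (V a) x) x" for a
      using V[of a] x by (simp add: has_partials_iff outward_field_def)
    have "has_partials (\<lambda>y. \<Sum>a\<in>A. V a y) (\<Sum>a\<in>A. pd1 (V a) x) (\<Sum>a\<in>A. pd2 (V a) x) x"
      using has_derivative_sum[of A V "\<lambda>a h. Re h *\<^sub>R pd1 (V a) x + Im h *\<^sub>R pd2 (V a) x" "at x"] hp
      unfolding has_partials_def by (simp add: scaleR_sum_right sum.distrib)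
    note sum_hp = this
    have W_eq: "(\<Sum>a\<in>A. V a y) = W y" if y: "y \<in> \<Omega>" for y
    proof -
      have "y \<in> closure \<Omega>" using y closure_subset by blast
      then have "\<Psi> y \<noteq> 0" using \<Psi>pos[of y] by simp
      moreover have "(\<Sum>a\<in>A. V a y) = \<Psi> y *\<^sub>R W' y"
        by (simp only: V_def \<Psi>_def scaleR_sum_left)
      ultimately show ?thesis by (simp add: W'_def)
    qed
    have "has_partials W (\<Sum>a\<in>A. pd1 (V a) x) (\<Sum>a\<in>A. pd2 (V a) x) x"
      by (rule has_partials_cong_open[OF op x W_eq sum_hp])
    from divg_has_partials[OF this] show ?thesis
      using divg_has_partials[OF hp] by (simp add: sum.distrib)
  qed
  have "(LINT x:\<Omega>|lborel. divg W x) = (LINT x:\<Omega>|lborel. \<Sum>a\<in>A. divg (V a) x)"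
    unfolding set_lebesgue_integral_def using eq by (intro Bochner_Integration.integral_cong) (auto simp: indicator_def)
  also have "\<dots> = (\<Sum>a\<in>A. LINT x:\<Omega>|lborel. divg (V a) x)"
    unfolding set_lebesgue_integral_def scaleR_sum_right
    using outward_field_set_integrable[OF op bd V]
    by (intro Bochner_Integration.integral_sum) (auto simp: set_integrable_def)
  also have "\<dots> \<ge> 0" using pos by (intro sum_nonneg) auto
  finally show ?thesis .
qed

section \<open>The energy identity\<close>

lemma perp_bounded_linear: "bounded_linear perp"
proof (rule bounded_linear_intro[where K = 1])
  show "norm (perp x) \<le> norm x * 1" for x by (simp add: perp_def cmod_def add.commute)
qed (auto simp: perp_def complex_eq_iff)

lemma smooth_open_components:
  assumes "open U" "smooth_open U u"
  shows "smooth_open U (\<lambda>y. Re (u y))" "smooth_open U (\<lambda>y. Im (u y))"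
  using smooth_open_bounded_linear[OF bounded_linear_Re assms]
    smooth_open_bounded_linear[OF bounded_linear_Im assms] by auto

lemma pd_components:
  assumes "smooth_open U u" "x \<in> U"
  shows "pd1 (\<lambda>y. Re (u y)) x = Re (pd1 u x)" "pd2 (\<lambda>y. Re (u y)) x = Re (pd2 u x)"
    "pd1 (\<lambda>y. Im (u y)) x = Im (pd1 u x)" "pd2 (\<lambda>y. Im (u y)) x = Im (pd2 u x)"
  using has_partials_pd[OF has_partials_bounded_linear[OF bounded_linear_Re has_partials_smooth_open[OF assms]]]
    has_partials_pd[OF has_partials_bounded_linear[OF bounded_linear_Im has_partials_smooth_open[OF assms]]]
  by auto

lemma divg_curl_eq:
  assumes "smooth_open U u" "x \<in> U"
  shows "divg u x = Re (pd1 u x) + Im (pd2 u x)" "curl u x = Re (pd2 u x) - Im (pd1 u x)"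
  by (simp_all add: divg_def curl_def pd_components[OF assms])

lemma smooth_open_divg_curl:
  assumes "open U" "smooth_open U u"
  shows "smooth_open U (divg u)" "smooth_open U (curl u)"
proof -
  note s = smooth_open_components[OF assms]
  note p = smooth_open_pd1[OF s(1)] smooth_open_pd2[OF s(1)] smooth_open_pd1[OF s(2)] smooth_open_pd2[OF s(2)]
  show "smooth_open U (divg u)"
    unfolding divg_def[abs_def] using p assms by (intro smooth_open_add) auto
  have "smooth_open U (\<lambda>x. pd2 (\<lambda>y. Re (u y)) x + (-1) * pd1 (\<lambda>y. Im (u y)) x)"
    using p assms by (intro smooth_open_add smooth_open_mult smooth_open_const) auto
  then show "smooth_open U (curl u)" unfolding curl_def[abs_def] by simp
qed

text \<open>The plane version of \<open>\<Delta> = grad div - curl curl\<close>.\<close>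

lemma laplacian_eq:
  assumes "open U" "smooth_open U u" "x \<in> U"
  shows "laplacian u x = Complex (pd1 (divg u) x + pd2 (curl u) x) (pd2 (divg u) x - pd1 (curl u) x)"
proof -
  let ?a = "\<lambda>y. Re (u y)" and ?b = "\<lambda>y. Im (u y)"
  note s = smooth_open_components[OF assms(1,2)]
  have hp: "has_partials (pd1 ?a) (pd1 (pd1 ?a) x) (pd2 (pd1 ?a) x) x"
    "has_partials (pd2 ?a) (pd1 (pd2 ?a) x) (pd2 (pd2 ?a) x) x"
    "has_partials (pd1 ?b) (pd1 (pd1 ?b) x) (pd2 (pd1 ?b) x) x"
    "has_partials (pd2 ?b) (pd1 (pd2 ?b) x) (pd2 (pd2 ?b) x) x"
    using s assms(3) by (auto intro!: has_partials_smooth_open[of U] smooth_open_pd1 smooth_open_pd2)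
  have d: "pd1 (divg u) x = pd1 (pd1 ?a) x + pd1 (pd2 ?b) x" "pd2 (divg u) x = pd2 (pd1 ?a) x + pd2 (pd2 ?b) x"
    using has_partials_pd[OF has_partials_add[OF hp(1,4)]] by (auto simp: divg_def[abs_def])
  have c: "pd1 (curl u) x = pd1 (pd2 ?a) x - pd1 (pd1 ?b) x" "pd2 (curl u) x = pd2 (pd2 ?a) x - pd2 (pd1 ?b) x"
    using has_partials_pd[OF has_partials_diff[OF hp(2,3)]] by (auto simp: curl_def[abs_def])
  have l: "Re (pd1 (pd1 u) x) = pd1 (pd1 ?a) x" "Im (pd1 (pd1 u) x) = pd1 (pd1 ?b) x"
    "Re (pd2 (pd2 u) x) = pd2 (pd2 ?a) x" "Im (pd2 (pd2 u) x) = pd2 (pd2 ?b) x"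
    using pd_components[OF smooth_open_pd1[OF assms(2)] assms(3)] pd_components[OF smooth_open_pd2[OF assms(2)] assms(3)]
      pd_cong_open[OF assms(1,3), of "\<lambda>y. Re (pd1 u y)" "pd1 ?a"] pd_cong_open[OF assms(1,3), of "\<lambda>y. Im (pd1 u y)" "pd1 ?b"]
      pd_cong_open[OF assms(1,3), of "\<lambda>y. Re (pd2 u y)" "pd2 ?a"] pd_cong_open[OF assms(1,3), of "\<lambda>y. Im (pd2 u y)" "pd2 ?b"]
      pd_components[OF assms(2)] by simp_all
  show ?thesis
    using pd_mixed[OF assms(1,3) s(1)] pd_mixed[OF assms(1,3) s(2)]
    by (simp add: complex_eq_iff laplacian_def d c l)
qed

lemma divg_momentum:
  assumes "smooth_open U \<rho>" "smooth_open U u" "x \<in> U"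
  shows "divg (\<lambda>y. \<rho> y *\<^sub>R u y) x = \<rho> x * divg u x + (pd1 \<rho> x * Re (u x) + pd2 \<rho> x * Im (u x))"
  using divg_scaleR[OF has_partials_smooth_open[OF assms(1,3)] has_partials_smooth_open[OF assms(2,3)]]
  by (simp add: inner_complex_def)

lemma div_tensor_momentum:
  assumes "open U" "smooth_open U \<rho>" "smooth_open U u" "x \<in> U"
  shows "div_tensor (\<lambda>y. \<rho> y *\<^sub>R u y) u x =
    divg (\<lambda>y. \<rho> y *\<^sub>R u y) x *\<^sub>R u x + \<rho> x *\<^sub>R (Re (u x) *\<^sub>R pd1 u x + Im (u x) *\<^sub>R pd2 u x)"
proof -
  note s = smooth_open_components[OF assms(1,3)]
  note hu = has_partials_smooth_open[OF assms(3,4)]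
  note ra = has_partials_mult[OF has_partials_smooth_open[OF assms(2,4)] has_partials_smooth_open[OF s(1) assms(4)]]
  note rb = has_partials_mult[OF has_partials_smooth_open[OF assms(2,4)] has_partials_smooth_open[OF s(2) assms(4)]]
  show ?thesis
    using has_partials_pd[OF has_partials_scaleR[OF ra hu]] has_partials_pd[OF has_partials_scaleR[OF rb hu]]
      has_partials_pd[OF ra] has_partials_pd[OF rb]
    by (simp add: div_tensor_def divg_def algebra_simps)
qed

lemma integral_nonpos_imp_zero:
  fixes f :: "complex \<Rightarrow> real"
  assumes op: "open \<Omega>" and c: "continuous_on \<Omega> f" and i: "set_integrable lborel \<Omega> f"
    and nn: "\<And>x. x \<in> \<Omega> \<Longrightarrow> f x \<ge> 0" and le: "(LINT x:\<Omega>|lborel. f x) \<le> 0" and x: "x \<in> \<Omega>"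
  shows "f x = 0"
proof (rule ccontr)
  assume "f x \<noteq> 0"
  then have "f x > 0" using nn[OF x] by simp
  have "isCont f x" using c op x continuous_on_eq_continuous_at by blast
  then obtain e where e: "e > 0" "\<And>y. dist y x < e \<Longrightarrow> dist (f y) (f x) < f x / 2"
    unfolding continuous_at_eps_delta using \<open>f x > 0\<close> by (meson half_gt_zero)
  obtain e' where e': "e' > 0" "ball x e' \<subseteq> \<Omega>" using op x open_contains_ball by blast
  define r where "r = min e e'"
  have r: "r > 0" "ball x r \<subseteq> \<Omega>" using e e' by (auto simp: r_def)
  have low: "f x / 2 \<le> f y" if "y \<in> ball x r" for y
    using e(2)[of y] that by (auto simp: r_def dist_commute dist_real_def abs_if split: if_splits)
  have "f x / 2 * measure lborel (ball x r) = (\<integral>y. (f x / 2) * indicator (ball x r) y \<partial>lborel)"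
    by simp
  also have "\<dots> \<le> (LINT y:\<Omega>|lborel. f y)"
    unfolding set_lebesgue_integral_def
  proof (rule integral_mono)
    show "integrable lborel (\<lambda>y. (f x / 2) * indicator (ball x r) y)"
      using emeasure_lborel_ball_finite[of x r] by (intro integrable_mult_right integrable_real_indicator) auto
    show "integrable lborel (\<lambda>y. indicator \<Omega> y *\<^sub>R f y)" using i by (simp add: set_integrable_def)
    show "(f x / 2) * indicator (ball x r) y \<le> indicator \<Omega> y *\<^sub>R f y" for y
      using low[of y] r(2) nn[of y] by (auto simp: indicator_def)
  qed
  finally have "f x / 2 * measure lborel (ball x r) \<le> 0" using le by simp
  moreover have "measure lborel (ball x r) > 0" using r by (simp add: content_ball_pos)
  ultimately show False using \<open>f x > 0\<close> by (simp add: mult_le_0_iff)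
qed

text \<open>The algebra behind the energy identity at a single point: \<open>H\<close> is the kinetic energy plus
  the enthalpy, per volume, minus the effective viscous pressure, \<open>Q\<close> stands for \<open>\<rho>\<^bsup>\<gamma> - 1\<^esup>\<close> and \<open>k\<close> for \<open>\<gamma> / (\<gamma> - 1)\<close>. The
  divergence of the energy flux is a linear combination of the equations.\<close>

lemma energy_flux_algebra:
  fixes a b a1 a2 b1 b2 :: real
  assumes "\<rho> * (a * a1 + b * a2) + \<gamma> * Q * r1 = \<mu> * (t1 + w2) + F1"
    and "\<rho> * (a * b1 + b * b2) + \<gamma> * Q * r2 = \<mu> * (t2 - w1) + F2"
    and "\<rho> * t + (r1 * a + r2 * b) = 0" "k * (\<gamma> - 1) = \<gamma>" "t = a1 + b2" "w = a2 - b1"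
    and "H = \<rho> * (a\<^sup>2 + b\<^sup>2) / 2 + k * (Q * \<rho>) - (\<mu> * t + F)"
    and "H1 = (r1 * (a\<^sup>2 + b\<^sup>2) + \<rho> * (2 * a * a1 + 2 * b * b1)) / 2 + k * (\<gamma> * Q * r1) - (\<mu> * t1 + F1)"
    and "H2 = (r2 * (a\<^sup>2 + b\<^sup>2) + \<rho> * (2 * a * a2 + 2 * b * b2)) / 2 + k * (\<gamma> * Q * r2) - (\<mu> * t2 + F2)"
  shows "(H1 * a + H * a1 + (\<mu> * w1 * b + \<mu> * w * b1)) + (H2 * b + H * b2 - (\<mu> * w2 * a + \<mu> * w * a2)) =
    - ((\<mu> * t + F) * t + \<mu> * w\<^sup>2)"
proof -
  have "(H1 * a + H * a1 + (\<mu> * w1 * b + \<mu> * w * b1)) + (H2 * b + H * b2 - (\<mu> * w2 * a + \<mu> * w * a2))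
       + ((\<mu> * t + F) * t + \<mu> * w\<^sup>2) =
     a * ((\<rho> * (a * a1 + b * a2) + \<gamma> * Q * r1) - (\<mu> * (t1 + w2) + F1))
     + b * ((\<rho> * (a * b1 + b * b2) + \<gamma> * Q * r2) - (\<mu> * (t2 - w1) + F2))
     + ((a\<^sup>2 + b\<^sup>2) / 2 + k * Q) * (\<rho> * t + (r1 * a + r2 * b))
     + (k * (\<gamma> - 1) - \<gamma>) * (Q * (r1 * a + r2 * b))"
    unfolding assms(5-9) by (simp add: field_simps power2_eq_square)
  also have "\<dots> = 0" using assms(1-4) by simp
  finally show ?thesis by simp
qed

text \<open>The energy flux \<open>V\<close> below has divergence \<open>- (2 \<mu> + \<rho>\<^sup>\<beta>) (div u)\<^sup>2 - \<mu> (curl u)\<^sup>2\<close>. On the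
  boundary only its viscous part contributes to the normal component, which by the slip condition
  is \<open>\<mu> K (u \<bullet> n\<^sup>\<bottom>)\<^sup>2\<close> and so not negative. By the divergence inequality the divergence of \<open>V\<close>
  vanishes.\<close>

theorem solution_potential:
  assumes dom: "connected_smooth_domain k \<Omega>" and params: "\<mu> > 0" "\<beta> > 0" "\<gamma> > 1"
    and K: "\<And>x. x \<in> frontier \<Omega> \<Longrightarrow> K x \<ge> 0"
    and U: "open U" "closure \<Omega> \<subseteq> U" "smooth_open U \<rho>" "smooth_open U u"
    and sol: "smooth_solution \<Omega> \<mu> \<beta> \<gamma> K \<rho>0 \<rho> u"
    and x: "x \<in> \<Omega>"
  shows "divg u x = 0 \<and> curl u x = 0"
proof -
  have op: "open \<Omega>" and bd: "bounded \<Omega>" using dom by (auto simp: connected_smooth_domain_def)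
  have cl: "\<Omega> \<subseteq> closure \<Omega>" by (rule closure_subset)
  have inU: "x \<in> \<Omega> \<Longrightarrow> x \<in> U" for x using cl U(2) by blast
  let ?a = "\<lambda>y. Re (u y)" and ?b = "\<lambda>y. Im (u y)"
  define F where "F y = (\<mu> + \<rho> y powr \<beta>) * divg u y" for y
  define \<kappa> where "\<kappa> = \<gamma> / (\<gamma> - 1)"
  define G where "G y = \<mu> * divg u y + F y" for y
  define H where "H y = (1 / 2) * (\<rho> y * (?a y * ?a y + ?b y * ?b y)) + \<kappa> * \<rho> y powr \<gamma> - G y" for y
  define V where "V y = H y *\<^sub>R u y + (\<mu> * curl u y) *\<^sub>R perp (u y)" for y
  have \<rho>0: "\<rho> y \<ge> 0" if "y \<in> closure \<Omega>" for y using sol that by (simp add: smooth_solution_def)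
  note s = smooth_open_components[OF U(1,4)]
  note dc = smooth_open_divg_curl[OF U(1,4)]
  have cont: "continuous_on (closure \<Omega>) f" if "smooth_open U f" for f :: "complex \<Rightarrow> 'b::real_normed_vector"
    using smooth_open_continuous[OF that] U(2) continuous_on_subset by blast
  note conts = cont[OF U(3)] cont[OF U(4)] cont[OF s(1)] cont[OF s(2)] cont[OF dc(1)] cont[OF dc(2)]
    cont[OF smooth_open_pd1[OF U(3)]] cont[OF smooth_open_pd2[OF U(3)]]
    cont[OF smooth_open_pd1[OF U(4)]] cont[OF smooth_open_pd2[OF U(4)]]
    cont[OF smooth_open_pd1[OF dc(1)]] cont[OF smooth_open_pd2[OF dc(1)]]
    cont[OF smooth_open_pd1[OF dc(2)]] cont[OF smooth_open_pd2[OF dc(2)]]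
    bounded_linear.continuous_on[OF perp_bounded_linear]
  have contp: "continuous_on (closure \<Omega>) (\<lambda>y. \<rho> y powr e)" if "e > 0" for e
    using cont[OF U(3)] \<rho>0 that by (intro continuous_on_powr' continuous_on_const) auto
  have gg: "\<gamma> > 0" "\<gamma> - 1 > 0" using params by auto
  note ci = continuous_on_add continuous_on_diff continuous_on_mult continuous_on_scaleR continuous_on_power
    continuous_on_const continuous_on_Re continuous_on_Im
    conts contp[OF gg(1)] contp[OF gg(2)] contp[OF params(2)]
  \<comment> \<open>The momentum equation bounds the gradient of \<open>F\<close>, whose regularity up to a vacuum on the
    boundary is otherwise unknown.\<close>
  define F1 where "F1 y = \<rho> y * (?a y * Re (pd1 u y) + ?b y * Re (pd2 u y)) + \<gamma> * \<rho> y powr (\<gamma> - 1) * pd1 \<rho> y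
      - \<mu> * (pd1 (divg u) y + pd2 (curl u) y)" for y
  define F2 where "F2 y = \<rho> y * (?a y * Im (pd1 u y) + ?b y * Im (pd2 u y)) + \<gamma> * \<rho> y powr (\<gamma> - 1) * pd2 \<rho> y
      - \<mu> * (pd2 (divg u) y - pd1 (curl u) y)" for y
  have hpP: "has_partials (\<lambda>y. \<rho> y powr \<gamma>) (\<gamma> * \<rho> y powr (\<gamma> - 1) * pd1 \<rho> y) (\<gamma> * \<rho> y powr (\<gamma> - 1) * pd2 \<rho> y) y"
    if "y \<in> \<Omega>" for y
    using \<rho>0 cl params(3) by (intro has_partials_powr[OF op that _ has_partials_smooth_open[OF U(3) inU[OF that]]]) auto
  have hpF: "has_partials F (F1 y) (F2 y) y" if y: "y \<in> \<Omega>" for y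
  proof -
    have "F differentiable (at y)" using sol y unfolding smooth_solution_def F_def[abs_def] by blast
    then have F: "has_partials F (pd1 F y) (pd2 F y) y" by (simp add: has_partials_iff)
    have "divg (\<lambda>y. \<rho> y *\<^sub>R u y) y = 0" using sol y by (simp add: smooth_solution_def)
    moreover have "div_tensor (\<lambda>y. \<rho> y *\<^sub>R u y) u y + grad (\<lambda>y. \<rho> y powr \<gamma>) y = \<mu> *\<^sub>R laplacian u y + grad F y"
      using sol y unfolding smooth_solution_def F_def[abs_def] by blast
    ultimately have "\<rho> y *\<^sub>R (?a y *\<^sub>R pd1 u y + ?b y *\<^sub>R pd2 u y) + grad (\<lambda>y. \<rho> y powr \<gamma>) y
        = \<mu> *\<^sub>R laplacian u y + grad F y"
      using div_tensor_momentum[OF U(1,3,4) inU[OF y]] by simp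
    then have "pd1 F y = F1 y" "pd2 F y = F2 y"
      using has_partials_pd[OF hpP[OF y]] laplacian_eq[OF U(1,4) inU[OF y]]
      by (simp_all add: complex_eq_iff grad_def F1_def F2_def algebra_simps)
    then show ?thesis using F by simp
  qed
  define H1 where "H1 y = (1 / 2) * (pd1 \<rho> y * (?a y * ?a y + ?b y * ?b y) + \<rho> y * ((Re (pd1 u y) * ?a y + ?a y * Re (pd1 u y)) + (Im (pd1 u y) * ?b y + ?b y * Im (pd1 u y))))
     + \<kappa> * (\<gamma> * \<rho> y powr (\<gamma> - 1) * pd1 \<rho> y) - (\<mu> * pd1 (divg u) y + F1 y)" for y
  define H2 where "H2 y = (1 / 2) * (pd2 \<rho> y * (?a y * ?a y + ?b y * ?b y) + \<rho> y * ((Re (pd2 u y) * ?a y + ?a y * Re (pd2 u y)) + (Im (pd2 u y) * ?b y + ?b y * Im (pd2 u y))))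
     + \<kappa> * (\<gamma> * \<rho> y powr (\<gamma> - 1) * pd2 \<rho> y) - (\<mu> * pd2 (divg u) y + F2 y)" for y
  have cmult: "has_partials (\<lambda>y. c * f y) (c * f1) (c * f2) y" if "has_partials f f1 f2 y" for c f1 f2 y and f :: "complex \<Rightarrow> real"
    using has_partials_bounded_linear[OF bounded_linear_mult_right that, of c] .
  have hpH: "has_partials H (H1 y) (H2 y) y" if y: "y \<in> \<Omega>" for y
  proof -
    have ha: "has_partials ?a (Re (pd1 u y)) (Re (pd2 u y)) y" "has_partials ?b (Im (pd1 u y)) (Im (pd2 u y)) y"
      using has_partials_bounded_linear[OF bounded_linear_Re has_partials_smooth_open[OF U(4) inU[OF y]]]
       has_partials_bounded_linear[OF bounded_linear_Im has_partials_smooth_open[OF U(4) inU[OF y]]] by auto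
    show ?thesis unfolding H_def[abs_def] G_def H1_def H2_def
      by (intro has_partials_add has_partials_diff cmult has_partials_mult ha hpP[OF y] hpF[OF y]
          has_partials_smooth_open[OF dc(1) inU[OF y]] has_partials_smooth_open[OF U(3) inU[OF y]])
  qed
  define V1 where "V1 y = (H1 y *\<^sub>R u y + H y *\<^sub>R pd1 u y) + ((\<mu> * pd1 (curl u) y) *\<^sub>R perp (u y) + (\<mu> * curl u y) *\<^sub>R perp (pd1 u y))" for y
  define V2 where "V2 y = (H2 y *\<^sub>R u y + H y *\<^sub>R pd2 u y) + ((\<mu> * pd2 (curl u) y) *\<^sub>R perp (u y) + (\<mu> * curl u y) *\<^sub>R perp (pd2 u y))" for y
  have hpV: "has_partials V (V1 y) (V2 y) y" if y: "y \<in> \<Omega>" for y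
  proof -
    note hu = has_partials_smooth_open[OF U(4) inU[OF y]]
    note hc = has_partials_smooth_open[OF dc(2) inU[OF y]]
    show ?thesis
      unfolding V_def[abs_def] V1_def V2_def
      by (rule has_partials_add[OF has_partials_scaleR[OF hpH[OF y] hu]
          has_partials_scaleR[OF cmult[OF hc] has_partials_bounded_linear[OF perp_bounded_linear hu]]])
  qed
  have cH: "continuous_on (closure \<Omega>) H"
    unfolding H_def G_def F_def by (intro ci)
  have cF: "continuous_on (closure \<Omega>) F1" "continuous_on (closure \<Omega>) F2"
    unfolding F1_def F2_def by (intro ci)+
  have cV: "continuous_on (closure \<Omega>) V"
    unfolding V_def by (intro ci cH)
  have cHp: "continuous_on (closure \<Omega>) H1" "continuous_on (closure \<Omega>) H2"
    unfolding H1_def H2_def by (intro ci cF)+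
  have cVp: "continuous_on (closure \<Omega>) V1" "continuous_on (closure \<Omega>) V2"
    unfolding V1_def V2_def by (intro ci cH cHp)+
  define D where "D y = (2 * \<mu> + \<rho> y powr \<beta>) * (divg u y)\<^sup>2 + \<mu> * (curl u y)\<^sup>2" for y
  have cD: "continuous_on (closure \<Omega>) D"
    unfolding D_def by (intro ci)
  have divV: "divg V y = - D y" if y: "y \<in> \<Omega>" for y
  proof -
    have "\<rho> y powr (\<gamma> - 1) * \<rho> y = \<rho> y powr \<gamma>"
      using \<rho>0[of y] y cl by (cases "\<rho> y = 0") (auto simp: powr_diff)
    moreover have "divg (\<lambda>y. \<rho> y *\<^sub>R u y) y = 0" using sol y by (simp add: smooth_solution_def)
    note this[unfolded divg_momentum[OF U(3,4) inU[OF y]]]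
    moreover have "\<kappa> * (\<gamma> - 1) = \<gamma>" using params by (simp add: \<kappa>_def)
    ultimately have "(H1 y * ?a y + H y * Re (pd1 u y) + (\<mu> * pd1 (curl u) y * ?b y + \<mu> * curl u y * Im (pd1 u y)))
        + (H2 y * ?b y + H y * Im (pd2 u y) - (\<mu> * pd2 (curl u) y * ?a y + \<mu> * curl u y * Re (pd2 u y)))
        = - ((\<mu> * divg u y + F y) * divg u y + \<mu> * (curl u y)\<^sup>2)"
      by (intro energy_flux_algebra[where \<rho> = "\<rho> y" and Q = "\<rho> y powr (\<gamma> - 1)" and ?r1.0 = "pd1 \<rho> y" and ?r2.0 = "pd2 \<rho> y"
            and \<gamma> = \<gamma> and ?F1.0 = "F1 y" and ?F2.0 = "F2 y" and ?t1.0 = "pd1 (divg u) y" and ?t2.0 = "pd2 (divg u) y" and k = \<kappa>])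
        (auto simp: F1_def F2_def H_def H1_def H2_def G_def divg_curl_eq[OF U(4) inU[OF y]] power2_eq_square)
    moreover have "(\<mu> * divg u y + F y) * divg u y + \<mu> * (curl u y)\<^sup>2 = D y"
      by (simp add: D_def F_def power2_eq_square algebra_simps)
    ultimately show ?thesis
      using divg_has_partials[OF hpV[OF y]] by (simp add: V1_def V2_def perp_def algebra_simps)
  qed
  have Vn: "inner (V y) \<nu> \<ge> 0" if y: "y \<in> frontier \<Omega>" and \<nu>: "outer_unit_normal \<Omega> y \<nu>" for y \<nu>
  proof -
    have ycl: "y \<in> closure \<Omega>" "y \<notin> \<Omega>" using y op by (auto simp: frontier_def interior_open)
    have bc: "inner (u y) \<nu> = 0" "(curl u \<longlongrightarrow> - K y * inner (u y) (perp \<nu>)) (at y within \<Omega>)"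
      using sol y \<nu> unfolding smooth_solution_def by blast+
    have "(curl u \<longlongrightarrow> curl u y) (at y within \<Omega>)"
      using cont[OF dc(2)] ycl(1) cl unfolding continuous_on_def by (meson tendsto_within_subset)
    moreover have "at y within \<Omega> \<noteq> bot"
      using ycl by (simp add: trivial_limit_within islimpt_in_closure)
    ultimately have cu: "curl u y = - K y * inner (u y) (perp \<nu>)"
      using bc(2) tendsto_unique by blast
    have "inner (perp (u y)) \<nu> = - inner (u y) (perp \<nu>)"
      by (simp add: perp_def inner_complex_def)
    then have "inner (V y) \<nu> = \<mu> * K y * (inner (u y) (perp \<nu>))\<^sup>2"
      by (simp add: V_def inner_add_left inner_diff_left bc(1) cu power2_eq_square)
    then show ?thesis using K[OF y] params by simp
  qed
  have comp: "compact (closure \<Omega>)" using bd by simp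
  have bnd: "bounded (f ` \<Omega>)" if "continuous_on (closure \<Omega>) f" for f :: "complex \<Rightarrow> complex"
    using compact_imp_bounded[OF compact_continuous_image[OF that comp]] cl by (meson bounded_subset image_mono)
  have "outward_field \<Omega> V"
  proof -
    have "pd1 V ` \<Omega> = V1 ` \<Omega>" "pd2 V ` \<Omega> = V2 ` \<Omega>"
      using has_partials_pd[OF hpV] by (auto intro!: image_cong)
    moreover have "continuous_on \<Omega> (divg V)"
      using continuous_on_cong[of \<Omega> \<Omega> "divg V" "\<lambda>y. - D y"] divV continuous_on_minus[OF continuous_on_subset[OF cD cl]] by simp
    ultimately show ?thesis
      using cV bnd[OF cVp(1)] bnd[OF cVp(2)] has_partials_differentiable[OF hpV] Vn
      unfolding outward_field_def by simp
  qed
  from divergence_inequality[OF dom this]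
  have "0 \<le> (LINT y:\<Omega>|lborel. divg V y)" .
  also have "\<dots> = (LINT y:\<Omega>|lborel. - D y)"
    using divV op by (intro set_lebesgue_integral_cong) auto
  finally have D0: "(LINT y:\<Omega>|lborel. D y) \<le> 0"
    unfolding set_lebesgue_integral_def by simp
  have "bounded (D ` closure \<Omega>)" using compact_continuous_image[OF cD comp] compact_imp_bounded by blast
  then obtain M where M: "\<And>y. y \<in> closure \<Omega> \<Longrightarrow> \<bar>D y\<bar> \<le> M" unfolding bounded_iff by auto
  have Di: "set_integrable lborel \<Omega> D"
    using M cl by (intro set_integrable_continuous_bounded[OF op bd continuous_on_subset[OF cD cl]]) auto
  have "D y \<ge> 0" for y using params by (simp add: D_def)
  then have "D x = 0"
    using integral_nonpos_imp_zero[OF op continuous_on_subset[OF cD cl] Di _ D0 x] by blast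
  moreover have "(2 * \<mu> + \<rho> x powr \<beta>) * (divg u x)\<^sup>2 \<ge> 0" "\<mu> * (curl u x)\<^sup>2 \<ge> 0" "2 * \<mu> + \<rho> x powr \<beta> > 0"
    using params by (auto intro!: add_pos_nonneg mult_nonneg_nonneg)
  ultimately show ?thesis
    using params unfolding D_def by (simp add: add_nonneg_eq_0_iff)
qed

section \<open>Potential flows\<close>

text \<open>The Cauchy-Riemann equations for \<open>u\<^sub>1 - \<i> u\<^sub>2\<close>.\<close>

lemma potential_flow_holomorphic:
  assumes "smooth_open U u" "x \<in> U" "divg u x = 0" "curl u x = 0"
  shows "((\<lambda>z. cnj (u z)) has_field_derivative cnj (pd1 u x)) (at x)"
proof -
  have "((\<lambda>z. cnj (u z)) has_derivative (\<lambda>h. Re h *\<^sub>R cnj (pd1 u x) + Im h *\<^sub>R cnj (pd2 u x))) (at x)"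
    using has_partials_bounded_linear[OF bounded_linear_cnj has_partials_smooth_open[OF assms(1,2)]]
    by (simp add: has_partials_def)
  moreover have "(\<lambda>h. Re h *\<^sub>R cnj (pd1 u x) + Im h *\<^sub>R cnj (pd2 u x)) = (*) (cnj (pd1 u x))"
    using assms(3,4) unfolding divg_curl_eq[OF assms(1,2)]
    by (simp add: fun_eq_iff complex_eq_iff algebra_simps eq_neg_iff_add_eq_0[symmetric])
  ultimately show ?thesis by (simp add: has_field_derivative_def)
qed

lemma frontier_loop:
  assumes dom: "connected_smooth_domain k \<Omega>" and x: "x \<in> frontier \<Omega>"
  obtains p s where "smooth_loop p" "path_image p \<subseteq> frontier \<Omega>" "p s = x"
proof -
  obtain \<Gamma> where \<Gamma>: "\<And>i. i < k \<Longrightarrow> smooth_simple_closed_curve (\<Gamma> i)" "frontier \<Omega> = (\<Union>i<k. \<Gamma> i)"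
    using dom unfolding connected_smooth_domain_def by blast
  then obtain i where i: "i < k" "x \<in> \<Gamma> i" using x by auto
  then obtain p where p: "smooth_loop p" "\<Gamma> i = path_image p"
    using \<Gamma>(1) unfolding smooth_simple_closed_curve_def by blast
  then obtain s where "p s = x" using i by (auto simp: path_image_def)
  moreover have "path_image p \<subseteq> frontier \<Omega>" using p i \<Gamma>(2) by blast
  ultimately show thesis using that p by blast
qed

text \<open>Extended by zero across an arc on which the velocity vanishes, the function
  \<open>u\<^sub>1 - \<i> u\<^sub>2\<close> stays complex differentiable, because its derivative vanishes on the arc as well.\<close>

lemma potential_flow_zero_on_arc:
  assumes dom: "connected_smooth_domain k \<Omega>"
    and U: "open U" "closure \<Omega> \<subseteq> U" "smooth_open U u"
    and pot: "\<And>x. x \<in> \<Omega> \<Longrightarrow> divg u x = 0 \<and> curl u x = 0"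
    and x0: "x0 \<in> frontier \<Omega>" "e > 0" and van: "\<And>x. x \<in> frontier \<Omega> \<Longrightarrow> x \<in> ball x0 e \<Longrightarrow> u x = 0"
    and x: "x \<in> \<Omega>"
  shows "u x = 0"
proof -
  have op: "open \<Omega>" and con: "connected \<Omega>" using dom by (auto simp: connected_smooth_domain_def)
  let ?f = "\<lambda>z. cnj (u z)"
  have cont: "continuous_on (closure \<Omega>) f" if "smooth_open U f" for f :: "complex \<Rightarrow> real"
    using smooth_open_continuous[OF that] U(2) continuous_on_subset by blast
  have "divg u y = 0" "curl u y = 0" if "y \<in> closure \<Omega>" for y
    using continuous_constant_on_closure[OF cont[OF smooth_open_divg_curl(1)[OF U(1,3)]] _ that, of 0]
      continuous_constant_on_closure[OF cont[OF smooth_open_divg_curl(2)[OF U(1,3)]] _ that, of 0] pot by auto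
  then have Df: "(?f has_field_derivative cnj (pd1 u y)) (at y)" if "y \<in> closure \<Omega>" for y
    using potential_flow_holomorphic[OF U(3)] U(2) that by blast
  have D0: "pd1 u y = 0" if y: "y \<in> frontier \<Omega>" "y \<in> ball x0 e" for y
  proof -
    obtain p s where p: "smooth_loop p" "path_image p \<subseteq> frontier \<Omega>" "p s = y"
      using frontier_loop[OF dom y(1)] by blast
    have ycl: "y \<in> closure \<Omega>" using y(1) by (simp add: frontier_def)
    have 1: "(p has_derivative (\<lambda>h. h *\<^sub>R vector_derivative p (at s))) (at s)"
      using smooth_loop_has_vector_derivative[OF p(1)] by (simp add: has_vector_derivative_def)
    have 2: "(?f has_derivative (*) (cnj (pd1 u y))) (at (p s))"
      using Df[OF ycl] p(3) by (simp add: has_field_derivative_def)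
    from has_derivative_compose[OF 1 2]
    have D: "((\<lambda>t. ?f (p t)) has_derivative (\<lambda>h. cnj (pd1 u y) * (h *\<^sub>R vector_derivative p (at s)))) (at s)" .
    have "open (p -` ball x0 e)"
      using smooth_loop_continuous[OF p(1), of UNIV] by (intro open_vimage) auto
    moreover have "?f (p t) = 0" if "t \<in> p -` ball x0 e" for t
    proof -
      have "p t \<in> frontier \<Omega>" using p(2) smooth_loop_range[OF p(1)] by auto
      then show ?thesis using van that by simp
    qed
    ultimately have "((\<lambda>t. 0::complex) has_derivative (\<lambda>h. cnj (pd1 u y) * (h *\<^sub>R vector_derivative p (at s)))) (at s)"
      using y(2) p(3) by (intro has_derivative_transform_within_open[OF D, of "p -` ball x0 e"]) auto
    then have "(\<lambda>h::real. cnj (pd1 u y) * (h *\<^sub>R vector_derivative p (at s))) = (\<lambda>h. 0)"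
      by (rule has_derivative_unique) simp
    from fun_cong[OF this, of 1] have "cnj (pd1 u y) * vector_derivative p (at s) = 0" by simp
    then show ?thesis using p(1) by (simp add: smooth_loop_def)
  qed
  define h where "h z = (if z \<in> \<Omega> then ?f z else 0)" for z
  have "h field_differentiable at z" if z: "z \<in> ball x0 e" for z
  proof -
    consider "z \<in> \<Omega>" | "z \<notin> closure \<Omega>" | "z \<in> frontier \<Omega>"
      using op by (auto simp: frontier_def interior_open)
    then show ?thesis
    proof cases
      case 1
      have "(h has_field_derivative cnj (pd1 u z)) (at z)"
      proof (rule has_field_derivative_transform_within_open[OF Df op 1])
        show "z \<in> closure \<Omega>" using 1 closure_subset by blast
      qed (simp add: h_def)
      then show ?thesis by (auto simp: field_differentiable_def)
    next
      case 2
      have "(h has_field_derivative 0) (at z)"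
      proof (rule has_field_derivative_transform_within_open[OF DERIV_const, of "- closure \<Omega>"])
        show "(0::complex) = h y" if "y \<in> - closure \<Omega>" for y using that closure_subset[of \<Omega>] by (auto simp: h_def)
      qed (use 2 in \<open>auto simp: open_Compl\<close>)
      then show ?thesis by (auto simp: field_differentiable_def)
    next
      case 3
      then have zcl: "z \<in> closure \<Omega>" by (simp add: frontier_def)
      have z0: "?f z = 0" "h z = 0" using van[OF 3 z] by (auto simp: h_def)
      have "((\<lambda>y. (?f y - ?f z) / (y - z)) \<longlongrightarrow> 0) (at z)"
        using Df[OF zcl] D0[OF 3 z] by (simp add: has_field_derivative_iff)
      then have "((\<lambda>y. norm ((?f y - ?f z) / (y - z))) \<longlongrightarrow> 0) (at z)"
        using tendsto_norm_zero by blast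
      then have "((\<lambda>y. (h y - h z) / (y - z)) \<longlongrightarrow> 0) (at z)"
        by (rule Lim_null_comparison[rotated]) (auto simp: z0 h_def divide_right_mono norm_divide intro!: always_eventually)
      then show ?thesis by (auto simp: field_differentiable_def has_field_derivative_iff)
    qed
  qed
  then have hol: "h holomorphic_on ball x0 e"
    by (simp add: holomorphic_on_def field_differentiable_at_within)
  have out: "ball x0 e - closure \<Omega> \<noteq> {}"
  proof -
    obtain \<nu> where "outer_unit_normal \<Omega> x0 \<nu>" by (rule outer_unit_normal_exists[OF dom x0(1)])
    then obtain e1 where e1: "e1 > 0" "norm \<nu> = 1" "\<And>t. 0 < t \<Longrightarrow> t < e1 \<Longrightarrow> x0 + t *\<^sub>R \<nu> \<notin> closure \<Omega>"
      unfolding outer_unit_normal_def by blast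
    define t where "t = min e e1 / 2"
    have "0 < t" "t < e1" "t < e" using e1 x0(2) by (auto simp: t_def)
    then have "x0 + t *\<^sub>R \<nu> \<in> ball x0 e - closure \<Omega>" using e1 by (simp add: dist_norm)
    then show ?thesis by blast
  qed
  have h0: "h z = 0" if "z \<in> ball x0 e" for z
  proof (rule analytic_continuation_open[of "ball x0 e - closure \<Omega>" "ball x0 e" h "\<lambda>_. 0"])
    show "h y = 0" if "y \<in> ball x0 e - closure \<Omega>" for y using that closure_subset[of \<Omega>] by (auto simp: h_def)
  qed (use hol out that in \<open>auto simp: open_Diff\<close>)
  have fhol: "?f holomorphic_on \<Omega>"
  proof (rule holomorphic_onI)
    fix z assume "z \<in> \<Omega>"
    then have "z \<in> closure \<Omega>" using closure_subset by blast
    then show "?f field_differentiable at z within \<Omega>"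
      using Df field_differentiable_def field_differentiable_at_within by blast
  qed
  have ne: "\<Omega> \<inter> ball x0 e \<noteq> {}"
  proof -
    have "x0 \<in> closure \<Omega>" using x0 by (simp add: frontier_def)
    moreover have "x0 \<in> ball x0 e" using x0(2) by simp
    ultimately show ?thesis using open_Int_closure_eq_empty[OF open_ball, of x0 e \<Omega>] by blast
  qed
  have "?f x = 0"
  proof (rule analytic_continuation_open[of "\<Omega> \<inter> ball x0 e" \<Omega> ?f "\<lambda>_. 0"])
    show "?f y = 0" if "y \<in> \<Omega> \<inter> ball x0 e" for y using h0[of y] that by (simp add: h_def)
  qed (use op con fhol x ne in \<open>auto simp: open_Int\<close>)
  then show ?thesis by simp
qed

lemma holomorphic_imaginary_constant:
  assumes "open S" "connected S" "\<And>z. z \<in> S \<Longrightarrow> Re (q z) = 0" "q holomorphic_on S"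
  shows "\<exists>c. \<forall>z\<in>S. q z = c"
proof -
  have D0: "(q has_field_derivative 0) (at z)" if z: "z \<in> S" for z
  proof -
    obtain D where D: "(q has_field_derivative D) (at z)"
      using assms(1,4) z unfolding holomorphic_on_def field_differentiable_def by (metis at_within_open)
    have "((\<lambda>z. Re (q z)) has_derivative (\<lambda>h. Re (D * h))) (at z)"
      using bounded_linear.has_derivative[OF bounded_linear_Re] D unfolding has_field_derivative_def by blast
    then have "((\<lambda>z. 0::real) has_derivative (\<lambda>h. Re (D * h))) (at z)"
      by (rule has_derivative_transform_within_open[OF _ assms(1) z]) (use assms(3) in auto)
    then have "(\<lambda>h. Re (D * h)) = (\<lambda>h. 0)" by (rule has_derivative_unique) simp
    from fun_cong[OF this, of "cnj D"] have "D = 0" by (simp add: complex_mult_cnj complex_eq_iff sum_power2_eq_zero_iff)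
    then show ?thesis using D by simp
  qed
  show ?thesis
  proof (cases "S = {}")
    case False
    then obtain z0 where z0: "z0 \<in> S" by blast
    have "q z = q z0" if "z \<in> S" for z
      using has_derivative_zero_unique_connected[OF assms(1,2) _ that z0, of q] D0
      by (simp add: has_field_derivative_def lambda_zero)
    then show ?thesis by blast
  qed auto
qed

text \<open>The hypothesis says that the speed is constant along stream lines. It makes \<open>f' / f\<^sup>2\<close>, the
  derivative of \<open>- 1 / f\<close>, purely imaginary, hence constant.\<close>

lemma reciprocal_affine:
  assumes "open \<Omega>" "connected \<Omega>"
    and f: "\<And>z. z \<in> \<Omega> \<Longrightarrow> (f has_field_derivative f' z) (at z)"
    and im: "\<And>z. z \<in> \<Omega> \<Longrightarrow> Re ((f z)\<^sup>2 * cnj (f' z)) = 0"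
    and nz: "z1 \<in> \<Omega>" "f z1 \<noteq> 0"
  shows "\<exists>(c::real) d. \<forall>z\<in>\<Omega>. f z * (\<i> * of_real c * z + d) = 1"
proof -
  have fhol: "f holomorphic_on \<Omega>"
    using f assms(1) by (auto simp: holomorphic_on_open)
  have "isCont f z1" using f[OF nz(1)] DERIV_isCont by blast
  then obtain e1 where e1: "e1 > 0" "\<And>z. dist z z1 < e1 \<Longrightarrow> dist (f z) (f z1) < norm (f z1)"
    unfolding continuous_at_eps_delta using nz(2) by (meson zero_less_norm_iff)
  obtain e2 where e2: "e2 > 0" "ball z1 e2 \<subseteq> \<Omega>" using assms(1) nz(1) open_contains_ball by blast
  \<comment> \<open>Near \<open>z1\<close> there are no zeros of \<open>f\<close>; unique continuation extends the result afterwards.\<close>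
  define S where "S = ball z1 (min e1 e2)"
  have S: "open S" "connected S" "S \<subseteq> \<Omega>" "z1 \<in> S" "convex S" using e1(1) e2 by (auto simp: S_def)
  have fnz: "f z \<noteq> 0" if "z \<in> S" for z
    using e1(2)[of z] that by (auto simp: S_def dist_commute)
  define q where "q z = - f' z / (f z)\<^sup>2" for z
  have Dinv: "((\<lambda>z. 1 / f z) has_field_derivative q z) (at z)" if "z \<in> S" for z
    using f[of z] that S(3) fnz[OF that] unfolding q_def
    by (auto intro!: derivative_eq_intros simp: power2_eq_square)
  have "q holomorphic_on S"
  proof -
    have "deriv f holomorphic_on S" using fhol S holomorphic_deriv holomorphic_on_subset assms(1) by blast
    moreover have "deriv f z = f' z" if "z \<in> S" for z using f[of z] that S(3) DERIV_imp_deriv by blast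
    ultimately have "f' holomorphic_on S" using holomorphic_cong[of S S "deriv f" f'] by simp
    then show ?thesis unfolding q_def using fhol S(3) fnz
      by (intro holomorphic_intros) (auto intro: holomorphic_on_subset)
  qed
  moreover have "Re (q z) = 0" if z: "z \<in> S" for z
  proof -
    have "Re (f' z * cnj ((f z)\<^sup>2)) = 0"
      using im[of z] z S(3) by (auto simp: algebra_simps simp del: complex_cnj_power)
    then show ?thesis by (simp add: q_def complex_div_cnj[of _ "(f z)\<^sup>2"] Re_divide_of_real)
  qed
  ultimately obtain w where w: "\<And>z. z \<in> S \<Longrightarrow> q z = w" "Re w = 0"
    using holomorphic_imaginary_constant[of S q] S by metis
  define c where "c = Im w"
  have wc: "w = \<i> * of_real c" using w(2) by (simp add: c_def complex_eq_iff)
  have "((\<lambda>z. 1 / f z - w * z) has_field_derivative 0) (at z)" if "z \<in> S" for z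
    using DERIV_diff[OF Dinv[OF that] DERIV_cmult_Id[of w]] w(1)[OF that] by simp
  then have "((\<lambda>z. 1 / f z - w * z) has_derivative (\<lambda>h. 0)) (at z)" if "z \<in> S" for z
    using that by (simp add: has_field_derivative_def lambda_zero)
  note const = has_derivative_zero_unique_connected[OF S(1,2) this _ S(4)]
  define d where "d = 1 / f z1 - w * z1"
  have d: "1 / f z - w * z = d" if "z \<in> S" for z
    unfolding d_def by (rule const[OF _ that])
  have "f z * (w * z + d) = 1" if z: "z \<in> \<Omega>" for z
  proof (rule analytic_continuation_open[of S \<Omega> "\<lambda>z. f z * (w * z + d)" "\<lambda>_. 1"])
    show "f y * (w * y + d) = 1" if "y \<in> S" for y
      using d[OF that] fnz[OF that] by (auto simp: field_simps)
    show "(\<lambda>z. f z * (w * z + d)) holomorphic_on \<Omega>" by (intro holomorphic_intros fhol)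
  qed (use S assms z in auto)
  then show ?thesis unfolding wc by blast
qed

text \<open>Rolle's theorem for a closed curve: its tangent cannot avoid a direction.\<close>

lemma smooth_loop_rolle:
  assumes p: "smooth_loop p"
    and D: "\<And>s. ((\<lambda>s. G (p s)) has_vector_derivative G' s) (at s)"
    and re: "\<And>s. Im (G (p s)) = 0"
  shows "\<exists>s. G' s = 0"
proof -
  have DR: "((\<lambda>s. Re (G (p s))) has_real_derivative Re (G' s)) (at s)" for s
    using bounded_linear.has_vector_derivative[OF bounded_linear_Re D]
    by (simp add: has_real_derivative_iff_has_vector_derivative)
  have DI: "((\<lambda>s. Im (G (p s))) has_vector_derivative Im (G' s)) (at s)" for s
    using bounded_linear.has_vector_derivative[OF bounded_linear_Im D] .
  have im0: "Im (G' s) = 0" for s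
    using DI[of s] re by (simp add: has_vector_derivative_const vector_derivative_unique_at[OF _ has_vector_derivative_const])
  have "p 1 = p 0" using p unfolding smooth_loop_def by (metis add.left_neutral)
  then have "\<exists>z>0. z < 1 \<and> Re (G (p 1)) - Re (G (p 0)) = (1 - 0) * Re (G' z)"
    using DR by (intro MVT2) auto
  then obtain z where "Re (G' z) = 0" using \<open>p 1 = p 0\<close> by auto
  then show ?thesis using im0 by (auto simp: complex_eq_iff)
qed

lemma parallel_tangent_line_contradiction:
  assumes p: "smooth_loop p" and d: "d \<noteq> 0" and par: "\<And>s. Im (vector_derivative p (at s) / d) = 0"
  shows False
proof -
  have D: "((\<lambda>s. p s / d) has_vector_derivative (vector_derivative p (at s) / d)) (at s)" for s
    using bounded_linear.has_vector_derivative[OF bounded_linear_divide smooth_loop_has_vector_derivative[OF p]] .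
  have "((\<lambda>s. Im (p s / d)) has_real_derivative 0) (at s)" for s
    using bounded_linear.has_vector_derivative[OF bounded_linear_Im D, of s] par[of s]
    by (simp add: has_real_derivative_iff_has_vector_derivative)
  then have const: "Im (p s / d) = Im (p 0 / d)" for s
    using DERIV_isconst_all[of "\<lambda>s. Im (p s / d)" s 0] by blast
  define G where "G z = (z - p 0) / d" for z
  have "((\<lambda>s. G (p s)) has_vector_derivative (vector_derivative p (at s) / d)) (at s)" for s
    unfolding G_def diff_divide_distrib
    using has_vector_derivative_diff[OF D has_vector_derivative_const] by simp
  moreover have "Im (G (p s)) = 0" for s
    using const[of s] by (simp add: G_def diff_divide_distrib)
  ultimately obtain s where "vector_derivative p (at s) / d = 0"
    using smooth_loop_rolle[OF p, of G "\<lambda>s. vector_derivative p (at s) / d"] by blast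
  then show False using d p by (simp add: smooth_loop_def)
qed

text \<open>The Cayley transform with pole at a point missed by the curve maps the circle to the real line.\<close>

lemma smooth_loop_in_sphere:
  assumes p: "smooth_loop p" and sub: "path_image p \<subseteq> sphere z0 r"
  shows "path_image p = sphere z0 r"
proof (rule ccontr)
  assume "path_image p \<noteq> sphere z0 r"
  then obtain q where q: "q \<in> sphere z0 r" "q \<notin> path_image p" using sub by blast
  have rng: "p s \<in> path_image p" for s using smooth_loop_range[OF p] by auto
  have ne: "p s \<noteq> q" for s using rng q by metis
  define G where "G z = \<i> * ((q - z0) + (z - z0)) / (q - z)" for z
  define G' where "G' s = vector_derivative p (at s) * (2 * \<i> * (q - z0) / (q - p s)\<^sup>2)" for s
  have "((\<lambda>s. G (p s)) has_vector_derivative G' s) (at s)" for s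
  proof -
    have "(G has_field_derivative (2 * \<i> * (q - z0) / (q - p s)\<^sup>2)) (at (p s))"
      unfolding G_def using ne[of s]
      by (auto intro!: derivative_eq_intros simp: power2_eq_square field_simps)
    from field_vector_diff_chain_at[OF smooth_loop_has_vector_derivative[OF p] this] show ?thesis
      by (simp add: G'_def o_def)
  qed
  moreover have "Im (G (p s)) = 0" for s
  proof -
    have "p s \<in> sphere z0 r" using sub rng by blast
    then have "norm (q - z0) = r" "norm (p s - z0) = r"
      using q(1) by (simp_all add: dist_norm norm_minus_commute)
    then have "(norm (q - z0))\<^sup>2 = (norm (p s - z0))\<^sup>2" by simp
    then have "Re (((q - z0) + (p s - z0)) * cnj ((q - z0) - (p s - z0))) = 0"
      unfolding cmod_power2 by (simp add: power2_eq_square algebra_simps)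
    then have orth: "Re (((q - z0) + (p s - z0)) * cnj (q - p s)) = 0" by simp
    have "Re (((q - z0) + (p s - z0)) / (q - p s)) = 0"
      unfolding complex_div_cnj[of "(q - z0) + (p s - z0)" "q - p s"] using orth
      by (simp only: of_real_power[symmetric] Re_divide_of_real div_0)
    moreover have "G (p s) = \<i> * (((q - z0) + (p s - z0)) / (q - p s))" by (simp add: G_def)
    ultimately show ?thesis by (simp only: Im_i_times)
  qed
  ultimately obtain s where "G' s = 0" using smooth_loop_rolle[OF p, of G G'] by blast
  moreover have "q \<noteq> z0"
  proof
    assume "q = z0"
    then have "r = 0" using q by simp
    then have "p 0 = z0" using sub rng[of 0] by auto
    then show False using ne[of 0] \<open>q = z0\<close> by simp
  qed
  ultimately show False using ne[of s] p by (auto simp: G'_def smooth_loop_def)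
qed

section \<open>Rotations\<close>

lemma cross_zero_if_orthogonal:
  assumes "inner v n = 0" "inner n w = 0" "n \<noteq> 0"
  shows "Im (cnj v * w) = 0"
proof -
  have 1: "Re v * Re n + Im v * Im n = 0" "Re n * Re w + Im n * Im w = 0"
    using assms by (simp_all add: inner_complex_def)
  have "(Re v * Im w - Im v * Re w) * Re n = 0" "(Re v * Im w - Im v * Re w) * Im n = 0"
    using 1 by algebra+
  then have "Re v * Im w - Im v * Re w = 0" using assms(3) by (auto simp: complex_eq_iff)
  then show ?thesis by (simp add: algebra_simps)
qed

text \<open>The radii not attained by a connected domain but adherent to its range of radii are the end
  points of an interval, so there are at most two of them.\<close>

lemma at_most_two_concentric_circles:
  fixes z0 :: complex
  assumes "connected \<Omega>" "\<And>c. c \<in> {a, b, c'} \<Longrightarrow> sphere z0 c \<subseteq> frontier \<Omega>" "open \<Omega>" "0 \<le> a" "a < b" "b < c'"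
  shows False
proof -
  have no: "dist z0 z \<noteq> b" if "z \<in> \<Omega>" for z
    using assms(2)[of b] assms(3) that by (auto simp: frontier_def interior_open)
  have conn: "connected (dist z0 ` \<Omega>)"
    using assms(1) by (intro connected_continuous_image continuous_intros)
  have ad: "\<exists>z\<in>\<Omega>. \<bar>dist z0 z - c\<bar> < e" if ce: "c \<in> {a, c'}" "e > 0" for c e
  proof -
    have "z0 + of_real c \<in> sphere z0 c" using ce(1) assms(4-6) by (auto simp: dist_norm)
    moreover have "sphere z0 c \<subseteq> frontier \<Omega>" using assms(2)[of c] ce(1) by blast
    ultimately have "z0 + of_real c \<in> closure \<Omega>" unfolding frontier_def by blast
    then obtain z where "z \<in> \<Omega>" "dist z (z0 + of_real c) < e"
      using ce(2) unfolding closure_approachable by blast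
    moreover have "dist z0 (z0 + of_real c) = c" using ce(1) assms(4-6) by (auto simp: dist_norm)
    ultimately show ?thesis
      using dist_triangle[of z0 z "z0 + of_real c"] dist_triangle[of z0 "z0 + of_real c" z]
      by (intro bexI[of _ z]) (auto simp: dist_commute abs_if)
  qed
  obtain z1 where z1: "z1 \<in> \<Omega>" "dist z0 z1 < b" using ad[of a "b - a"] assms(5) by (auto simp: abs_if split: if_splits)
  obtain z2 where z2: "z2 \<in> \<Omega>" "dist z0 z2 > b" using ad[of c' "c' - b"] assms(6) by (auto simp: abs_if split: if_splits)
  have "b \<in> dist z0 ` \<Omega>"
    using connectedD_interval[OF conn, of "dist z0 z1" "dist z0 z2" b] z1 z2 by auto
  then show False using no by auto
qed

text \<open>In the plane, both the velocity and the tangent are orthogonal to the same normal.\<close>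

lemma velocity_parallel_to_boundary:
  assumes dom: "connected_smooth_domain k \<Omega>"
    and slip: "\<And>x \<nu>. x \<in> frontier \<Omega> \<Longrightarrow> outer_unit_normal \<Omega> x \<nu> \<Longrightarrow> inner (u x) \<nu> = 0"
    and p: "smooth_loop p" "path_image p \<subseteq> frontier \<Omega>"
  shows "Im (cnj (u (p s)) * vector_derivative p (at s)) = 0"
proof -
  have x: "p s \<in> frontier \<Omega>" using p(2) smooth_loop_range[OF p(1)] by auto
  obtain \<nu> where \<nu>: "outer_unit_normal \<Omega> (p s) \<nu>"
    "\<And>q t. smooth_loop q \<Longrightarrow> path_image q \<subseteq> frontier \<Omega> \<Longrightarrow> q t = p s \<Longrightarrow> inner \<nu> (vector_derivative q (at t)) = 0"
    using outer_unit_normal_exists[OF dom x] by metis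
  have "\<nu> \<noteq> 0" using \<nu>(1) by (auto simp: outer_unit_normal_def)
  then show ?thesis
    using cross_zero_if_orthogonal[OF slip[OF x \<nu>(1)] \<nu>(2)[OF p refl]] by blast
qed

text \<open>If \<open>u\<^sub>1 - \<i> u\<^sub>2 = 1 / (\<i> c z + d)\<close> is tangent to the boundary, the stream lines through boundary
  points are straight lines if \<open>c = 0\<close>, which contain no closed curve, and otherwise circles around
  the pole.\<close>

lemma rotation_boundary:
  fixes c :: real
  assumes dom: "connected_smooth_domain k \<Omega>" and k: "k \<ge> 2"
    and u: "\<And>z. z \<in> closure \<Omega> \<Longrightarrow> cnj (u z) * (\<i> * of_real c * z + d) = 1"
    and slip: "\<And>x \<nu>. x \<in> frontier \<Omega> \<Longrightarrow> outer_unit_normal \<Omega> x \<nu> \<Longrightarrow> inner (u x) \<nu> = 0"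
  shows "\<exists>C1 z0. bounded_by_concentric_circles z0 \<Omega> \<and>
     (\<forall>z\<in>closure \<Omega>. z \<noteq> z0 \<and> cnj (u z) = \<i> * of_real C1 / (z - z0)) \<and>
     (\<exists>r>0. sphere z0 r \<subseteq> frontier \<Omega>)"
proof -
  have op: "open \<Omega>" and con: "connected \<Omega>" using dom by (auto simp: connected_smooth_domain_def)
  obtain \<Gamma> where \<Gamma>: "\<And>i. i < k \<Longrightarrow> smooth_simple_closed_curve (\<Gamma> i)" "frontier \<Omega> = (\<Union>i<k. \<Gamma> i)"
      "disjoint_family_on \<Gamma> {..<k}"
    using dom unfolding connected_smooth_domain_def by blast
  have cl: "x \<in> closure \<Omega>" if "x \<in> frontier \<Omega>" for x using that by (simp add: frontier_def)
  have "\<exists>p. smooth_loop p \<and> \<Gamma> i = path_image p" if "i < k" for i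
    using \<Gamma>(1)[OF that] by (simp add: smooth_simple_closed_curve_def)
  then obtain P where P: "\<And>i. i < k \<Longrightarrow> smooth_loop (P i) \<and> \<Gamma> i = path_image (P i)" by metis
  have Pf: "path_image (P i) \<subseteq> frontier \<Omega>" if "i < k" for i using P[OF that] \<Gamma>(2) that by blast
  have Pcl: "P i s \<in> closure \<Omega>" if "i < k" for i s
    using Pf[OF that] P[OF that] smooth_loop_range cl by blast
  have tang: "Im (vector_derivative (P i) (at s) / (\<i> * of_real c * P i s + d)) = 0" if i: "i < k" for i s
  proof -
    have "cnj (u (P i s)) * (\<i> * of_real c * P i s + d) = 1" using u[OF Pcl[OF i]] .
    then have "cnj (u (P i s)) = 1 / (\<i> * of_real c * P i s + d)"
      by (metis divide_eq_eq mult_zero_right zero_neq_one nonzero_divide_eq_eq)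
    then show ?thesis
      using velocity_parallel_to_boundary[where u = u and s = s, OF dom slip conjunct1[OF P[OF i]] Pf[OF i]] by simp
  qed
  have "c \<noteq> 0"
  proof
    assume c0: "c = 0"
    have "closure \<Omega> \<noteq> {}" using dom by (auto simp: connected_smooth_domain_def)
    then have "d \<noteq> 0" using u c0 by fastforce
    moreover have "0 < k" using k by simp
    ultimately show False
      using parallel_tangent_line_contradiction[of "P 0" d] P[of 0] tang[of 0] c0 by simp
  qed
  define z0 where "z0 = \<i> * d / of_real c"
  have aff: "\<i> * of_real c * z + d = \<i> * of_real c * (z - z0)" for z
    using \<open>c \<noteq> 0\<close> by (simp add: z0_def algebra_simps)
  define C1 where "C1 = - 1 / c"
  have form: "z \<noteq> z0 \<and> cnj (u z) = \<i> * of_real C1 / (z - z0)" if "z \<in> closure \<Omega>" for z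
  proof -
    have 1: "cnj (u z) * (\<i> * of_real c * (z - z0)) = 1" using u[OF that] aff by simp
    then have "z \<noteq> z0" by auto
    moreover have "(\<i> * of_real C1 / w) * (\<i> * of_real c * w) = 1" if "w \<noteq> 0" for w
      using that \<open>c \<noteq> 0\<close> by (simp add: C1_def)
    note this[of "z - z0"]
    moreover have "\<i> * of_real c * (z - z0) \<noteq> 0" using \<open>z \<noteq> z0\<close> \<open>c \<noteq> 0\<close> by simp
    ultimately show ?thesis using 1 by (metis mult_right_cancel right_minus_eq)
  qed
  have circ: "\<exists>r>0. \<Gamma> i = sphere z0 r" if i: "i < k" for i
  proof -
    let ?p = "P i"
    have p: "smooth_loop ?p" "\<Gamma> i = path_image ?p" using P[OF i] by auto
    have nz: "?p s \<noteq> z0" for s using form[OF Pcl[OF i]] by blast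
    have "inner (?p s - z0) (vector_derivative ?p (at s)) = 0" for s
    proof -
      have "Im (vector_derivative ?p (at s) / (\<i> * of_real c * (?p s - z0))) = 0"
        using tang[OF i, of s] by (simp only: aff)
      then have "Im (vector_derivative ?p (at s) * cnj (\<i> * of_real c * (?p s - z0)) /
          of_real ((norm (\<i> * of_real c * (?p s - z0)))\<^sup>2)) = 0"
        by (simp only: complex_div_cnj[of _ "\<i> * of_real c * (?p s - z0)"] of_real_power)
      then have "Im (vector_derivative ?p (at s) * cnj (\<i> * of_real c * (?p s - z0))) = 0"
        using nz[of s] \<open>c \<noteq> 0\<close> by (simp only: Im_divide_of_real) (simp add: norm_mult)
      moreover have "Im (v * cnj (\<i> * of_real c * w)) = - c * inner w v" for v w
        by (simp add: inner_complex_def algebra_simps)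
      ultimately have "- c * inner (?p s - z0) (vector_derivative ?p (at s)) = 0" by (simp only:)
      then show ?thesis using \<open>c \<noteq> 0\<close> by simp
    qed
    note orth = this
    have "((\<lambda>s. inner (?p s - z0) (?p s - z0)) has_real_derivative 0) (at s)" for s
    proof -
      have "(?p has_derivative (\<lambda>h. h *\<^sub>R vector_derivative ?p (at s))) (at s)"
        using smooth_loop_has_vector_derivative[OF p(1)] by (simp add: has_vector_derivative_def)
      from has_derivative_diff[OF this has_derivative_const[of z0]]
      have 1: "((\<lambda>s. ?p s - z0) has_derivative (\<lambda>h. h *\<^sub>R vector_derivative ?p (at s))) (at s)" by simp
      have "((\<lambda>s. inner (?p s - z0) (?p s - z0)) has_derivative (\<lambda>h. 0)) (at s)"
        by (rule has_derivative_eq_rhs[OF has_derivative_inner[OF 1 1]])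
          (simp add: orth inner_commute[of "vector_derivative ?p (at s)"])
      then show ?thesis by (simp add: has_field_derivative_def lambda_zero)
    qed
    then have "inner (?p s - z0) (?p s - z0) = inner (?p 0 - z0) (?p 0 - z0)" for s
      using DERIV_isconst_all[of "\<lambda>s. inner (?p s - z0) (?p s - z0)" s 0] by blast
    then have "norm (?p s - z0) = norm (?p 0 - z0)" for s by (simp add: norm_eq_sqrt_inner)
    then have "path_image ?p \<subseteq> sphere z0 (norm (?p 0 - z0))"
      by (auto simp: path_image_def dist_norm norm_minus_commute)
    then have "\<Gamma> i = sphere z0 (norm (?p 0 - z0))" using smooth_loop_in_sphere[OF p(1)] p(2) by simp
    moreover have "norm (?p 0 - z0) > 0" using nz[of 0] by simp
    ultimately show ?thesis by blast
  qed
  then obtain R where R: "\<And>i. i < k \<Longrightarrow> R i > 0 \<and> \<Gamma> i = sphere z0 (R i)" by metis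
  have Rinj: "R i \<noteq> R j" if "i < k" "j < k" "i \<noteq> j" for i j
  proof
    assume "R i = R j"
    then have "\<Gamma> i = \<Gamma> j" using R that by metis
    moreover have "\<Gamma> i \<inter> \<Gamma> j = {}" using \<Gamma>(3) that by (auto simp: disjoint_family_on_def)
    moreover have "\<Gamma> i \<noteq> {}" using P[OF that(1)] by simp
    ultimately show False by auto
  qed
  have sub: "sphere z0 (R i) \<subseteq> frontier \<Omega>" if "i < k" for i using R[OF that] \<Gamma>(2) that by blast
  have tri: False if "i < k" "j < k" "l < k" "R i < R j" "R j < R l" for i j l
    using at_most_two_concentric_circles[OF con, of "R i" "R j" "R l" z0] sub that op R[OF that(1)] by auto
  have "k = 2"
  proof (rule ccontr)
    assume "k \<noteq> 2"
    then have lt: "0 < k" "1 < k" "2 < k" using k by auto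
    then have ne: "R 0 \<noteq> R 1" "R 0 \<noteq> R 2" "R 1 \<noteq> R 2" using Rinj by auto
    show False
      using ne tri[of 0 1 2] tri[of 0 2 1] tri[of 1 0 2] tri[of 1 2 0] tri[of 2 0 1] tri[of 2 1 0] lt
      by (auto simp: neq_iff)
  qed
  then have "{..<k} = {0, 1}" by auto
  then have fr: "frontier \<Omega> = sphere z0 (R 0) \<union> sphere z0 (R 1)" using \<Gamma>(2) R \<open>k = 2\<close> by auto
  have pos: "R 0 > 0" "R 1 > 0" "R 0 \<noteq> R 1" using R[of 0] R[of 1] Rinj[of 0 1] \<open>k = 2\<close> by auto
  have "bounded_by_concentric_circles z0 \<Omega>"
    unfolding bounded_by_concentric_circles_def
  proof (cases "R 0 < R 1")
    case True
    then show "\<exists>r R. 0 < r \<and> r < R \<and> frontier \<Omega> = sphere z0 r \<union> sphere z0 R" using pos fr by blast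
  next
    case False
    then have "R 1 < R 0" "frontier \<Omega> = sphere z0 (R 1) \<union> sphere z0 (R 0)" using pos fr by auto
    then show "\<exists>r R. 0 < r \<and> r < R \<and> frontier \<Omega> = sphere z0 r \<union> sphere z0 R" using pos by blast
  qed
  then show ?thesis using form sub[of 0] pos(1) k by (intro exI[of _ C1] exI[of _ z0]) auto
qed

text \<open>Compare the distances from the origin of the four points \<open>z0 \<plusminus> r\<close> and \<open>z0 \<plusminus> \<i> r\<close>.\<close>

lemma sphere_subset_centre_eq:
  fixes z0 :: complex
  assumes "sphere z0 r \<subseteq> sphere 0 R" "r > 0"
  shows "z0 = 0"
proof -
  have "norm w = R" if "norm (w - z0) = r" for w
    using assms(1) that by (auto simp: dist_norm norm_minus_commute subset_iff)
  note R = this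
  have e: "norm (z0 + of_real r) = R" "norm (z0 - of_real r) = R"
    "norm (z0 + \<i> * of_real r) = R" "norm (z0 - \<i> * of_real r) = R"
    using assms(2) by (intro R; simp add: norm_mult)+
  have "(norm (z0 + of_real r))\<^sup>2 = (norm (z0 - of_real r))\<^sup>2"
    "(norm (z0 + \<i> * of_real r))\<^sup>2 = (norm (z0 - \<i> * of_real r))\<^sup>2"
    unfolding e by simp_all
  then have "Re z0 * r = 0" "Im z0 * r = 0"
    unfolding cmod_power2 by (simp_all add: power2_eq_square algebra_simps)
  then show ?thesis using assms(2) by (simp add: complex_eq_iff)
qed

lemma concentric_centre_unique:
  fixes z0 :: complex
  assumes "sphere z0 r \<subseteq> frontier \<Omega>" "r > 0" "bounded_by_concentric_circles 0 \<Omega>"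
  shows "z0 = 0"
proof -
  obtain a b where ab: "0 < a" "a < b" "frontier \<Omega> = sphere 0 a \<union> sphere 0 b"
    using assms(3) by (auto simp: bounded_by_concentric_circles_def)
  have "sphere (0::complex) a \<inter> sphere 0 b = {}" using ab(2) by auto
  moreover have sub: "sphere z0 r \<subseteq> sphere 0 a \<union> sphere 0 b" using assms(1) ab(3) by simp
  moreover have conn: "connected (sphere z0 r)" by (rule connected_sphere) simp
  ultimately have "sphere 0 a \<inter> sphere z0 r = {} \<or> sphere 0 b \<inter> sphere z0 r = {}"
    using connected_closedD[OF conn, of "sphere 0 a" "sphere 0 b"] closed_sphere by blast
  then have "sphere z0 r \<subseteq> sphere 0 a \<or> sphere z0 r \<subseteq> sphere 0 b" using sub by blast
  then show ?thesis using sphere_subset_centre_eq[OF _ assms(2)] by metis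
qed

section \<open>Solutions and their extensions\<close>

lemma smooth_solution_cong:
  assumes op: "open \<Omega>" and eq: "\<And>x. x \<in> closure \<Omega> \<Longrightarrow> \<rho> x = \<rho>' x \<and> u x = u' x"
    and sol: "smooth_solution \<Omega> \<mu> \<beta> \<gamma> K \<rho>0 \<rho> u"
  shows "smooth_solution \<Omega> \<mu> \<beta> \<gamma> K \<rho>0 \<rho>' u'"
proof -
  have e: "\<rho> x = \<rho>' x" "u x = u' x" if "x \<in> \<Omega>" for x using eq[of x] that closure_subset by auto
  have d: "divg f x = divg g x" if "x \<in> \<Omega>" "\<And>y. y \<in> \<Omega> \<Longrightarrow> f y = g y" for f g x
    unfolding divg_def
    using pd_cong_open[OF op that(1), of "\<lambda>y. Re (f y)" "\<lambda>y. Re (g y)"] pd_cong_open[OF op that(1), of "\<lambda>y. Im (f y)" "\<lambda>y. Im (g y)"] that(2)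
    by simp
  have c: "curl u x = curl u' x" if "x \<in> \<Omega>" for x
    unfolding curl_def
    using pd_cong_open[OF op that, of "\<lambda>y. Re (u y)" "\<lambda>y. Re (u' y)"] pd_cong_open[OF op that, of "\<lambda>y. Im (u y)" "\<lambda>y. Im (u' y)"] e
    by simp
  have l: "laplacian u x = laplacian u' x" if x: "x \<in> \<Omega>" for x
    unfolding laplacian_def
    using pd_cong_open[OF op x, of "pd1 u" "pd1 u'"] pd_cong_open[OF op x, of "pd2 u" "pd2 u'"]
      pd_cong_open[OF op _ e(2)] by simp
  have t: "div_tensor (\<lambda>y. \<rho> y *\<^sub>R u y) u x = div_tensor (\<lambda>y. \<rho>' y *\<^sub>R u' y) u' x" if x: "x \<in> \<Omega>" for x
    unfolding div_tensor_def
    using pd_cong_open[OF op x, of "\<lambda>y. Re (\<rho> y *\<^sub>R u y) *\<^sub>R u y" "\<lambda>y. Re (\<rho>' y *\<^sub>R u' y) *\<^sub>R u' y"]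
      pd_cong_open[OF op x, of "\<lambda>y. Im (\<rho> y *\<^sub>R u y) *\<^sub>R u y" "\<lambda>y. Im (\<rho>' y *\<^sub>R u' y) *\<^sub>R u' y"] e
    by simp
  have g: "grad f x = grad f' x" if "x \<in> \<Omega>" "\<And>y. y \<in> \<Omega> \<Longrightarrow> f y = f' y" for f f' x
    unfolding grad_def using pd_cong_open[OF op that] by simp
  have F: "(\<mu> + \<rho> y powr \<beta>) * divg u y = (\<mu> + \<rho>' y powr \<beta>) * divg u' y" if "y \<in> \<Omega>" for y
    using d[OF that e(2)] e(1)[OF that] by simp
  have A1: "smooth_set (closure \<Omega>) \<rho>'" and A2: "smooth_set (closure \<Omega>) u'"
  proof -
    obtain U g where "open U" "closure \<Omega> \<subseteq> U" "smooth_open U g" "\<forall>x\<in>closure \<Omega>. g x = \<rho> x"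
      using sol unfolding smooth_solution_def smooth_set_def by blast
    then show "smooth_set (closure \<Omega>) \<rho>'"
      unfolding smooth_set_def using eq by (intro exI[of _ U] exI[of _ g]) simp
    obtain U g where "open U" "closure \<Omega> \<subseteq> U" "smooth_open U g" "\<forall>x\<in>closure \<Omega>. g x = u x"
      using sol unfolding smooth_solution_def smooth_set_def by blast
    then show "smooth_set (closure \<Omega>) u'"
      unfolding smooth_set_def using eq by (intro exI[of _ U] exI[of _ g]) simp
  qed
  have A3: "\<forall>x\<in>closure \<Omega>. \<rho>' x \<ge> 0" using sol eq by (simp add: smooth_solution_def)
  have A4: "\<forall>x\<in>\<Omega>. divg (\<lambda>y. \<rho>' y *\<^sub>R u' y) x = 0"
    using sol d[of _ "\<lambda>y. \<rho> y *\<^sub>R u y" "\<lambda>y. \<rho>' y *\<^sub>R u' y"] e by (simp add: smooth_solution_def)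
  have A5: "(\<lambda>y. (\<mu> + \<rho>' y powr \<beta>) * divg u' y) differentiable (at x) \<and>
        div_tensor (\<lambda>y. \<rho>' y *\<^sub>R u' y) u' x + grad (\<lambda>y. \<rho>' y powr \<gamma>) x =
        \<mu> *\<^sub>R laplacian u' x + grad (\<lambda>y. (\<mu> + \<rho>' y powr \<beta>) * divg u' y) x" if x: "x \<in> \<Omega>" for x
  proof -
    have "(\<lambda>y. (\<mu> + \<rho> y powr \<beta>) * divg u y) differentiable (at x) \<and>
        div_tensor (\<lambda>y. \<rho> y *\<^sub>R u y) u x + grad (\<lambda>y. \<rho> y powr \<gamma>) x =
        \<mu> *\<^sub>R laplacian u x + grad (\<lambda>y. (\<mu> + \<rho> y powr \<beta>) * divg u y) x"
      using sol x unfolding smooth_solution_def by blast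
    moreover have "grad (\<lambda>y. \<rho> y powr \<gamma>) x = grad (\<lambda>y. \<rho>' y powr \<gamma>) x"
      using e(1) by (intro g[OF x]) simp
    moreover note differentiable_cong_open[where f = "\<lambda>y. (\<mu> + \<rho> y powr \<beta>) * divg u y"
        and g = "\<lambda>y. (\<mu> + \<rho>' y powr \<beta>) * divg u' y", OF op x F]
      g[where f = "\<lambda>y. (\<mu> + \<rho> y powr \<beta>) * divg u y"
        and f' = "\<lambda>y. (\<mu> + \<rho>' y powr \<beta>) * divg u' y", OF x F]
    ultimately show ?thesis using t[OF x] l[OF x] by simp
  qed
  have "(LINT x:\<Omega>|lebesgue. \<rho>' x) = (LINT x:\<Omega>|lebesgue. \<rho> x)"
    using e(1) op by (intro set_lebesgue_integral_cong) auto
  then have A6: "(LINT x:\<Omega>|lebesgue. \<rho>' x) = (LINT x:\<Omega>|lebesgue. \<rho>0 x)"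
    using sol by (simp add: smooth_solution_def)
  have A7: "inner (u' x) \<nu> = 0 \<and> (curl u' \<longlongrightarrow> - K x * inner (u' x) (perp \<nu>)) (at x within \<Omega>)"
    if x: "x \<in> frontier \<Omega>" and \<nu>: "outer_unit_normal \<Omega> x \<nu>" for x \<nu>
  proof -
    have "x \<in> closure \<Omega>" using x by (simp add: frontier_def)
    then have "u' x = u x" using eq by simp
    moreover have "inner (u x) \<nu> = 0" "(curl u \<longlongrightarrow> - K x * inner (u x) (perp \<nu>)) (at x within \<Omega>)"
      using sol x \<nu> unfolding smooth_solution_def by blast+
    moreover have "\<forall>\<^sub>F y in at x within \<Omega>. curl u y = curl u' y"
      using c by (auto simp: eventually_at_filter intro!: always_eventually)
    ultimately show ?thesis using tendsto_cong by metis
  qed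
  show ?thesis
    unfolding smooth_solution_def
    by (intro conjI ballI[OF A5] ballI[OF allI[OF impI[OF A7]]] A1 A2 A3 A4 A6)
qed

lemma smooth_solution_extension:
  assumes "open \<Omega>" "smooth_solution \<Omega> \<mu> \<beta> \<gamma> K \<rho>0 \<rho> u"
  shows "\<exists>U \<rho>' u'. open U \<and> closure \<Omega> \<subseteq> U \<and> smooth_open U \<rho>' \<and> smooth_open U u' \<and>
    (\<forall>x\<in>closure \<Omega>. \<rho>' x = \<rho> x \<and> u' x = u x) \<and> smooth_solution \<Omega> \<mu> \<beta> \<gamma> K \<rho>0 \<rho>' u'"
proof -
  have "smooth_set (closure \<Omega>) \<rho>" "smooth_set (closure \<Omega>) u"
    using assms(2) by (simp_all add: smooth_solution_def)
  then obtain U1 \<rho>' U2 u' where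
    1: "open U1" "closure \<Omega> \<subseteq> U1" "smooth_open U1 \<rho>'" "\<forall>x\<in>closure \<Omega>. \<rho>' x = \<rho> x" and
    2: "open U2" "closure \<Omega> \<subseteq> U2" "smooth_open U2 u'" "\<forall>x\<in>closure \<Omega>. u' x = u x"
    unfolding smooth_set_def by blast
  have "smooth_solution \<Omega> \<mu> \<beta> \<gamma> K \<rho>0 \<rho>' u'"
    by (rule smooth_solution_cong[OF assms(1) _ assms(2)]) (simp add: 1 2)
  then show ?thesis
    using 1 2 smooth_open_subset[OF 1(3), of "U1 \<inter> U2"] smooth_open_subset[OF 2(3), of "U1 \<inter> U2"]
    by (intro exI[of _ "U1 \<inter> U2"] exI[of _ \<rho>'] exI[of _ u']) auto
qed

text \<open>For a potential flow the viscous terms drop out, and the system becomes the stationary Euler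
  system.\<close>

lemma potential_flow_equations:
  assumes op: "open \<Omega>" and U: "open U" "\<Omega> \<subseteq> U" "smooth_open U \<rho>" "smooth_open U u"
    and \<rho>: "\<And>y. y \<in> \<Omega> \<Longrightarrow> \<rho> y \<ge> 0" and \<gamma>: "\<gamma> > 1"
    and pot: "\<And>y. y \<in> \<Omega> \<Longrightarrow> divg u y = 0 \<and> curl u y = 0" and x: "x \<in> \<Omega>"
  shows "(\<lambda>y. (\<mu> + \<rho> y powr \<beta>) * divg u y) differentiable (at x)"
    and "divg (\<lambda>y. \<rho> y *\<^sub>R u y) x = pd1 \<rho> x * Re (u x) + pd2 \<rho> x * Im (u x)"
    and "divg (\<lambda>y. \<rho> y *\<^sub>R u y) x = 0 \<Longrightarrow>
       div_tensor (\<lambda>y. \<rho> y *\<^sub>R u y) u x + grad (\<lambda>y. \<rho> y powr \<gamma>) x =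
       \<mu> *\<^sub>R laplacian u x + grad (\<lambda>y. (\<mu> + \<rho> y powr \<beta>) * divg u y) x \<longleftrightarrow>
       \<rho> x * (Re (u x) * Re (pd1 u x) + Im (u x) * Im (pd1 u x)) + \<gamma> * \<rho> x powr (\<gamma> - 1) * pd1 \<rho> x = 0 \<and>
       \<rho> x * (Re (u x) * Re (pd2 u x) + Im (u x) * Im (pd2 u x)) + \<gamma> * \<rho> x powr (\<gamma> - 1) * pd2 \<rho> x = 0"
proof -
  have xU: "x \<in> U" using x U by blast
  have F: "has_partials (\<lambda>y. (\<mu> + \<rho> y powr \<beta>) * divg u y) 0 0 x"
    by (rule has_partials_zero_extension[OF op x]) (simp add: pot)
  then show "(\<lambda>y. (\<mu> + \<rho> y powr \<beta>) * divg u y) differentiable (at x)" by (rule has_partials_differentiable)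
  show "divg (\<lambda>y. \<rho> y *\<^sub>R u y) x = pd1 \<rho> x * Re (u x) + pd2 \<rho> x * Im (u x)"
    using divg_momentum[OF U(3,4) xU] pot[OF x] by simp
  have P: "has_partials (\<lambda>y. \<rho> y powr \<gamma>) (\<gamma> * \<rho> x powr (\<gamma> - 1) * pd1 \<rho> x) (\<gamma> * \<rho> x powr (\<gamma> - 1) * pd2 \<rho> x) x"
    using \<rho> \<gamma> by (intro has_partials_powr[OF op x _ has_partials_smooth_open[OF U(3) xU]]) auto
  have "has_partials (divg u) 0 0 x" "has_partials (curl u) 0 0 x"
    by (rule has_partials_zero_extension[OF op x]; simp add: pot)+
  then have lap: "laplacian u x = 0"
    using laplacian_eq[OF U(1,4) xU] has_partials_pd[of "divg u" 0 0 x] has_partials_pd[of "curl u" 0 0 x] by (simp add: complex_eq_iff)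
  have "Re (pd2 u x) = Im (pd1 u x)" "Im (pd2 u x) = - Re (pd1 u x)"
    using pot[OF x] divg_curl_eq[OF U(4) xU] by simp_all
  then show "div_tensor (\<lambda>y. \<rho> y *\<^sub>R u y) u x + grad (\<lambda>y. \<rho> y powr \<gamma>) x =
       \<mu> *\<^sub>R laplacian u x + grad (\<lambda>y. (\<mu> + \<rho> y powr \<beta>) * divg u y) x \<longleftrightarrow>
       \<rho> x * (Re (u x) * Re (pd1 u x) + Im (u x) * Im (pd1 u x)) + \<gamma> * \<rho> x powr (\<gamma> - 1) * pd1 \<rho> x = 0 \<and>
       \<rho> x * (Re (u x) * Re (pd2 u x) + Im (u x) * Im (pd2 u x)) + \<gamma> * \<rho> x powr (\<gamma> - 1) * pd2 \<rho> x = 0"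
    if "divg (\<lambda>y. \<rho> y *\<^sub>R u y) x = 0"
  proof -
    have "Re (div_tensor (\<lambda>y. \<rho> y *\<^sub>R u y) u x) = \<rho> x * (Re (u x) * Re (pd1 u x) + Im (u x) * Im (pd1 u x))"
      "Im (div_tensor (\<lambda>y. \<rho> y *\<^sub>R u y) u x) = \<rho> x * (Re (u x) * Re (pd2 u x) + Im (u x) * Im (pd2 u x))"
      using div_tensor_momentum[OF U(1,3,4) xU] that \<open>Re (pd2 u x) = Im (pd1 u x)\<close> by simp_all
    then show ?thesis
      by (simp add: lap has_partials_pd[OF F] has_partials_pd[OF P] grad_def complex_eq_iff)
  qed
qed

lemma has_partials_zero_constant:
  fixes f :: "complex \<Rightarrow> real"
  assumes "open \<Omega>" "connected \<Omega>" "\<And>x. x \<in> \<Omega> \<Longrightarrow> has_partials f 0 0 x"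
  shows "\<exists>c. \<forall>x\<in>\<Omega>. f x = c"
proof (cases "\<Omega> = {}")
  case False
  then obtain x0 where x0: "x0 \<in> \<Omega>" by blast
  have "(f has_derivative (\<lambda>h. 0)) (at x)" if "x \<in> \<Omega>" for x using assms(3)[OF that] by (simp add: has_partials_def)
  then have "f x = f x0" if "x \<in> \<Omega>" for x
    using has_derivative_zero_unique_connected[OF assms(1,2) _ that x0] by blast
  then show ?thesis by blast
qed auto

lemma measure_domain_pos:
  assumes "open \<Omega>" "bounded \<Omega>" "\<Omega> \<noteq> {}"
  shows "measure lebesgue \<Omega> > 0" "\<Omega> \<in> sets lebesgue" "emeasure lebesgue \<Omega> < \<infinity>"
proof -
  obtain x e where xe: "e > 0" "ball x e \<subseteq> \<Omega>" using assms(1,3) by (meson all_not_in_conv open_contains_ball)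
  have fin: "emeasure lborel \<Omega> < \<infinity>" using assms(2) emeasure_bounded_finite by blast
  then have "\<Omega> \<in> fmeasurable lborel" using assms(1) by (intro fmeasurableI) (auto simp: less_top[symmetric])
  then have "measure lborel (ball x e) \<le> measure lborel \<Omega>"
    using xe(2) by (intro measure_mono_fmeasurable) auto
  moreover have "measure lborel (ball x e) > 0" using xe by (simp add: content_ball_pos)
  ultimately have "measure lborel \<Omega> > 0" by linarith
  then show "measure lebesgue \<Omega> > 0" using assms(1) by (simp add: measure_completion)
  show "\<Omega> \<in> sets lebesgue" using assms(1) by simp
  show "emeasure lebesgue \<Omega> < \<infinity>" using fin assms(1) by (simp add: emeasure_completion)
qed

lemma integral_constant_on:
  assumes "open \<Omega>" "bounded \<Omega>" "\<Omega> \<noteq> {}" "\<And>x. x \<in> \<Omega> \<Longrightarrow> \<rho> x = (c::real)"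
  shows "(LINT x:\<Omega>|lebesgue. \<rho> x) = c * measure lebesgue \<Omega>"
proof -
  note m = measure_domain_pos[OF assms(1-3)]
  have "(LINT x:\<Omega>|lebesgue. \<rho> x) = (LINT x:\<Omega>|lebesgue. c)"
    using assms(4) m by (intro set_lebesgue_integral_cong) auto
  then show ?thesis unfolding set_lebesgue_integral_def using m by (simp add: mult.commute)
qed

text \<open>Without velocity the momentum equation says that the pressure is constant. As no division by the
  density is involved, a vacuum is allowed.\<close>

lemma solution_at_rest_trivial:
  assumes dom: "connected_smooth_domain k \<Omega>" and \<gamma>: "\<gamma> > 1"
    and U: "open U" "closure \<Omega> \<subseteq> U" "smooth_open U \<rho>" "smooth_open U u"
    and sol: "smooth_solution \<Omega> \<mu> \<beta> \<gamma> K \<rho>0 \<rho> u" and rest: "\<And>x. x \<in> \<Omega> \<Longrightarrow> u x = 0"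
  shows "trivial_solution \<Omega> \<rho>0 \<rho> u"
proof -
  have op: "open \<Omega>" and con: "connected \<Omega>" and bd: "bounded \<Omega>" and ne: "\<Omega> \<noteq> {}"
    using dom by (auto simp: connected_smooth_domain_def)
  have cl: "\<Omega> \<subseteq> closure \<Omega>" by (rule closure_subset)
  have \<Omega>U: "\<Omega> \<subseteq> U" using cl U(2) by blast
  have \<rho>n: "\<rho> y \<ge> 0" if "y \<in> closure \<Omega>" for y using sol that by (simp add: smooth_solution_def)
  then have \<rho>\<Omega>: "\<rho> y \<ge> 0" if "y \<in> \<Omega>" for y using that cl by blast
  have hu: "has_partials u 0 0 x" if "x \<in> \<Omega>" for x
    using has_partials_zero_extension[OF op that] rest by blast
  have pot: "divg u y = 0 \<and> curl u y = 0" if "y \<in> \<Omega>" for y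
    using has_partials_pd[OF hu[OF that]] divg_curl_eq[OF U(4)] that \<Omega>U by auto
  have "has_partials (\<lambda>y. \<rho> y powr \<gamma>) 0 0 x" if x: "x \<in> \<Omega>" for x
  proof -
    note E = potential_flow_equations[OF op U(1) \<Omega>U U(3,4) \<rho>\<Omega> \<gamma> pot x]
    have z: "\<gamma> * \<rho> x powr (\<gamma> - 1) * pd1 \<rho> x = 0 \<and> \<gamma> * \<rho> x powr (\<gamma> - 1) * pd2 \<rho> x = 0"
      using E(3)[of \<mu> \<beta>] sol x rest[OF x] by (simp add: smooth_solution_def)
    have "has_partials (\<lambda>y. \<rho> y powr \<gamma>) (\<gamma> * \<rho> x powr (\<gamma> - 1) * pd1 \<rho> x) (\<gamma> * \<rho> x powr (\<gamma> - 1) * pd2 \<rho> x) x"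
      using \<rho>\<Omega> \<gamma> \<Omega>U x by (intro has_partials_powr[OF op x _ has_partials_smooth_open[OF U(3)]]) auto
    then show ?thesis by (simp only: z)
  qed
  from has_partials_zero_constant[OF op con this]
  obtain c where c: "\<And>x. x \<in> \<Omega> \<Longrightarrow> \<rho> x powr \<gamma> = c" by blast
  define m where "m = c powr (1 / \<gamma>)"
  have \<rho>m: "\<rho> x = m" if "x \<in> \<Omega>" for x
    using c[OF that] \<rho>\<Omega>[OF that] \<gamma> by (auto simp: m_def powr_powr)
  have "m * measure lebesgue \<Omega> = (LINT x:\<Omega>|lebesgue. \<rho>0 x)"
    using integral_constant_on[OF op bd ne \<rho>m] sol by (simp add: smooth_solution_def)
  then have m: "m = mean_value \<Omega> \<rho>0"
    using measure_domain_pos(1)[OF op bd ne] by (simp add: mean_value_def field_simps)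
  have c1: "continuous_on (closure \<Omega>) \<rho>" "continuous_on (closure \<Omega>) u"
    using continuous_on_subset[OF smooth_open_continuous[OF U(3)] U(2)]
      continuous_on_subset[OF smooth_open_continuous[OF U(4)] U(2)] by auto
  show ?thesis
    unfolding trivial_solution_def m[symmetric]
    using continuous_constant_on_closure[of \<Omega> \<rho> m, OF c1(1) \<rho>m] continuous_constant_on_closure[of \<Omega> u 0, OF c1(2) rest] by simp
qed

lemma trivial_solution_smooth_solution:
  assumes dom: "connected_smooth_domain k \<Omega>" and \<gamma>: "\<gamma> > 1"
    and pos: "(LINT x:\<Omega>|lebesgue. \<rho>0 x) > 0" and triv: "trivial_solution \<Omega> \<rho>0 \<rho> u"
  shows "smooth_solution \<Omega> \<mu> \<beta> \<gamma> K \<rho>0 \<rho> u" "nonvacuum \<Omega> \<rho>"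
proof -
  have op: "open \<Omega>" and con: "connected \<Omega>" and bd: "bounded \<Omega>" and ne: "\<Omega> \<noteq> {}"
    using dom by (auto simp: connected_smooth_domain_def)
  define m where "m = mean_value \<Omega> \<rho>0"
  have "m > 0" using measure_domain_pos(1)[OF op bd ne] pos by (simp add: m_def mean_value_def)
  then show "nonvacuum \<Omega> \<rho>" using triv by (simp add: nonvacuum_def trivial_solution_def m_def)
  have hp0: "has_partials (\<lambda>_. c) 0 0 x" for c :: "'b::real_normed_vector" and x by (rule has_partials_const)
  have div0: "divg (\<lambda>_. 0) x = 0" "curl (\<lambda>_. 0) x = 0" for x
    using has_partials_pd[OF hp0[of "0::real" x]] by (simp_all add: divg_def curl_def)
  have sm: "smooth_open UNIV (\<lambda>_::complex. c)" for c :: "'b::real_normed_vector" by (rule smooth_open_const)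
  have m0: "m \<ge> 0" using \<open>m > 0\<close> by simp
  have pot0: "divg (\<lambda>_. 0) y = 0 \<and> curl (\<lambda>_. 0) y = 0" for y using div0 by simp
  note E = potential_flow_equations(3)[where \<mu> = \<mu> and \<beta> = \<beta>, OF op open_UNIV subset_UNIV sm[of m] sm[of 0] m0 \<gamma> pot0]
  have "smooth_solution \<Omega> \<mu> \<beta> \<gamma> K \<rho>0 (\<lambda>_. m) (\<lambda>_. 0)"
    unfolding smooth_solution_def
  proof (intro conjI ballI allI impI)
    show "smooth_set (closure \<Omega>) (\<lambda>_. m)" "smooth_set (closure \<Omega>) (\<lambda>_. 0::complex)"
      unfolding smooth_set_def using sm by blast+
    show "(LINT x:\<Omega>|lebesgue. m) = (LINT x:\<Omega>|lebesgue. \<rho>0 x)"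
      using integral_constant_on[OF op bd ne, of "\<lambda>_. m" m] measure_domain_pos(1)[OF op bd ne]
      by (simp add: m_def mean_value_def)
    fix x assume x: "x \<in> \<Omega>"
    show d: "divg (\<lambda>y. m *\<^sub>R 0) x = 0" using div0 by simp
    show "(\<lambda>y. (\<mu> + m powr \<beta>) * divg (\<lambda>_. 0) y) differentiable at x" by (simp add: div0)
    show "div_tensor (\<lambda>y. m *\<^sub>R 0) (\<lambda>_. 0) x + grad (\<lambda>y. m powr \<gamma>) x =
         \<mu> *\<^sub>R laplacian (\<lambda>_. 0) x + grad (\<lambda>y. (\<mu> + m powr \<beta>) * divg (\<lambda>_. 0) y) x"
      using E[OF x d] has_partials_pd[OF hp0[of m x]] by simp
  next
    fix x \<nu>
    show "(curl (\<lambda>_. 0) \<longlongrightarrow> - K x * inner 0 (perp \<nu>)) (at x within \<Omega>)"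
      using div0(2) by (simp add: tendsto_eventually)
  qed (use m0 in auto)
  then show "smooth_solution \<Omega> \<mu> \<beta> \<gamma> K \<rho>0 \<rho> u"
    by (rule smooth_solution_cong[OF op, rotated]) (use triv in \<open>simp add: trivial_solution_def m_def\<close>)
qed

section \<open>Classification of the solutions\<close>

text \<open>By the momentum equation the head \<open>|u|\<^sup>2 / 2 + \<gamma> / (\<gamma> - 1) \<rho>\<^bsup>\<gamma> - 1\<^esup>\<close> is constant, and by the
  continuity equation the density, hence the speed, is constant along stream lines.\<close>

lemma bernoulli:
  assumes dom: "connected_smooth_domain k \<Omega>" and \<gamma>: "\<gamma> > 1"
    and U: "open U" "closure \<Omega> \<subseteq> U" "smooth_open U \<rho>" "smooth_open U u"
    and sol: "smooth_solution \<Omega> \<mu> \<beta> \<gamma> K \<rho>0 \<rho> u" and nv: "nonvacuum \<Omega> \<rho>"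
    and pot: "\<And>x. x \<in> \<Omega> \<Longrightarrow> divg u x = 0 \<and> curl u x = 0"
  shows "\<exists>C2. \<forall>x\<in>closure \<Omega>. \<rho> x powr (\<gamma> - 1) = (\<gamma> - 1) / \<gamma> * (C2 - (norm (u x))\<^sup>2 / 2)"
    and "\<And>x. x \<in> \<Omega> \<Longrightarrow> Re ((cnj (u x))\<^sup>2 * cnj (cnj (pd1 u x))) = 0"
proof -
  have op: "open \<Omega>" and con: "connected \<Omega>" using dom by (auto simp: connected_smooth_domain_def)
  have cl: "\<Omega> \<subseteq> closure \<Omega>" by (rule closure_subset)
  have \<Omega>U: "\<Omega> \<subseteq> U" using cl U(2) by blast
  have \<rho>p: "\<rho> y > 0" if "y \<in> closure \<Omega>" for y using nv that by (simp add: nonvacuum_def)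
  then have \<rho>\<Omega>: "\<rho> y > 0" if "y \<in> \<Omega>" for y using that cl by blast
  then have \<rho>\<Omega>0: "\<rho> y \<ge> 0" if "y \<in> \<Omega>" for y using that less_imp_le by blast
  note s = smooth_open_components[OF U(1,4)]
  have euler: "\<rho> x * (Re (u x) * Re (pd1 u x) + Im (u x) * Im (pd1 u x)) + \<gamma> * \<rho> x powr (\<gamma> - 1) * pd1 \<rho> x = 0"
       "\<rho> x * (Re (u x) * Re (pd2 u x) + Im (u x) * Im (pd2 u x)) + \<gamma> * \<rho> x powr (\<gamma> - 1) * pd2 \<rho> x = 0"
       "pd1 \<rho> x * Re (u x) + pd2 \<rho> x * Im (u x) = 0"
       "Re (pd2 u x) = Im (pd1 u x)" "Im (pd2 u x) = - Re (pd1 u x)" if x: "x \<in> \<Omega>" for x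
  proof -
    note E = potential_flow_equations[OF op U(1) \<Omega>U U(3,4) \<rho>\<Omega>0 \<gamma> pot x]
    have "divg (\<lambda>y. \<rho> y *\<^sub>R u y) x = 0" using sol x by (simp add: smooth_solution_def)
    moreover have "div_tensor (\<lambda>y. \<rho> y *\<^sub>R u y) u x + grad (\<lambda>y. \<rho> y powr \<gamma>) x =
       \<mu> *\<^sub>R laplacian u x + grad (\<lambda>y. (\<mu> + \<rho> y powr \<beta>) * divg u y) x"
      using sol x unfolding smooth_solution_def by blast
    ultimately show "\<rho> x * (Re (u x) * Re (pd1 u x) + Im (u x) * Im (pd1 u x)) + \<gamma> * \<rho> x powr (\<gamma> - 1) * pd1 \<rho> x = 0"
       "\<rho> x * (Re (u x) * Re (pd2 u x) + Im (u x) * Im (pd2 u x)) + \<gamma> * \<rho> x powr (\<gamma> - 1) * pd2 \<rho> x = 0"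
       "pd1 \<rho> x * Re (u x) + pd2 \<rho> x * Im (u x) = 0"
      using E(2) E(3)[of \<mu> \<beta>] by auto
    show "Re (pd2 u x) = Im (pd1 u x)" "Im (pd2 u x) = - Re (pd1 u x)"
      using pot[OF x] divg_curl_eq[OF U(4)] x \<Omega>U by auto
  qed
  show "Re ((cnj (u x))\<^sup>2 * cnj (cnj (pd1 u x))) = 0" if x: "x \<in> \<Omega>" for x
  proof -
    let ?a = "Re (u x)" and ?b = "Im (u x)"
    have "\<rho> x * (?a * (?a * Re (pd1 u x) + ?b * Im (pd1 u x)) + ?b * (?a * Re (pd2 u x) + ?b * Im (pd2 u x)))
      = - (\<gamma> * \<rho> x powr (\<gamma> - 1)) * (pd1 \<rho> x * ?a + pd2 \<rho> x * ?b)"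
      using euler(1,2)[OF x] by algebra
    then have "?a * (?a * Re (pd1 u x) + ?b * Im (pd1 u x)) + ?b * (?a * Re (pd2 u x) + ?b * Im (pd2 u x)) = 0"
      using euler(3)[OF x] \<rho>\<Omega>[OF x] by simp
    then show ?thesis unfolding euler(4,5)[OF x] by (simp add: power2_eq_square algebra_simps)
  qed
  define B where "B y = (1 / 2) * (Re (u y) * Re (u y) + Im (u y) * Im (u y)) + \<gamma> / (\<gamma> - 1) * \<rho> y powr (\<gamma> - 1)" for y
  have "has_partials B 0 0 x" if x: "x \<in> \<Omega>" for x
  proof -
    have xU: "x \<in> U" using x \<Omega>U by blast
    have D: "((\<lambda>t. t powr (\<gamma> - 1)) has_real_derivative (\<gamma> - 1) * \<rho> x powr (\<gamma> - 1 - 1)) (at (\<rho> x) within {0..})"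
      using has_real_derivative_powr[OF \<rho>\<Omega>[OF x]] has_field_derivative_at_within by blast
    note Q = has_partials_chain_nonneg[OF op x \<rho>\<Omega>0 has_partials_smooth_open[OF U(3) xU] D]
    have ha: "has_partials (\<lambda>y. Re (u y)) (Re (pd1 u x)) (Re (pd2 u x)) x"
      "has_partials (\<lambda>y. Im (u y)) (Im (pd1 u x)) (Im (pd2 u x)) x"
      using has_partials_bounded_linear[OF bounded_linear_Re has_partials_smooth_open[OF U(4) xU]]
       has_partials_bounded_linear[OF bounded_linear_Im has_partials_smooth_open[OF U(4) xU]] by auto
    note hB = has_partials_add[OF has_partials_bounded_linear[OF bounded_linear_mult_right
        has_partials_add[OF has_partials_mult[OF ha(1) ha(1)] has_partials_mult[OF ha(2) ha(2)]], of "1 / 2"]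
        has_partials_bounded_linear[OF bounded_linear_mult_right Q, of "\<gamma> / (\<gamma> - 1)"]]
    have pw: "\<rho> x powr (\<gamma> - 1) = \<rho> x * \<rho> x powr (\<gamma> - 1 - 1)"
      using \<rho>\<Omega>[OF x] powr_mult_base[of "\<rho> x" "\<gamma> - 1 - 1"] by simp
    have "Re (u x) * Re (pd1 u x) + Im (u x) * Im (pd1 u x) + \<gamma> * \<rho> x powr (\<gamma> - 1 - 1) * pd1 \<rho> x = 0"
      "Re (u x) * Re (pd2 u x) + Im (u x) * Im (pd2 u x) + \<gamma> * \<rho> x powr (\<gamma> - 1 - 1) * pd2 \<rho> x = 0"
    proof -
      have "\<rho> x * (Re (u x) * Re (pd1 u x) + Im (u x) * Im (pd1 u x) + \<gamma> * \<rho> x powr (\<gamma> - 1 - 1) * pd1 \<rho> x) = 0"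
       "\<rho> x * (Re (u x) * Re (pd2 u x) + Im (u x) * Im (pd2 u x) + \<gamma> * \<rho> x powr (\<gamma> - 1 - 1) * pd2 \<rho> x) = 0"
        using euler(1,2)[OF x] unfolding pw by (simp_all add: algebra_simps)
      then show "Re (u x) * Re (pd1 u x) + Im (u x) * Im (pd1 u x) + \<gamma> * \<rho> x powr (\<gamma> - 1 - 1) * pd1 \<rho> x = 0"
       "Re (u x) * Re (pd2 u x) + Im (u x) * Im (pd2 u x) + \<gamma> * \<rho> x powr (\<gamma> - 1 - 1) * pd2 \<rho> x = 0"
        using \<rho>\<Omega>[OF x] by simp_all
    qed
    note e = this
    have cancel: "\<gamma> / (\<gamma> - 1) * ((\<gamma> - 1) * \<rho> x powr (\<gamma> - 1 - 1) * w) = \<gamma> * \<rho> x powr (\<gamma> - 1 - 1) * w" for w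
      using \<gamma> by simp
    have z: "1 / 2 * (Re (pd1 u x) * Re (u x) + Re (u x) * Re (pd1 u x) + (Im (pd1 u x) * Im (u x) + Im (u x) * Im (pd1 u x)))
        + \<gamma> / (\<gamma> - 1) * ((\<gamma> - 1) * \<rho> x powr (\<gamma> - 1 - 1) * pd1 \<rho> x) = 0"
      "1 / 2 * (Re (pd2 u x) * Re (u x) + Re (u x) * Re (pd2 u x) + (Im (pd2 u x) * Im (u x) + Im (u x) * Im (pd2 u x)))
        + \<gamma> / (\<gamma> - 1) * ((\<gamma> - 1) * \<rho> x powr (\<gamma> - 1 - 1) * pd2 \<rho> x) = 0"
      unfolding cancel using e by (simp_all add: algebra_simps)
    show ?thesis
      using hB unfolding B_def[abs_def] z .
  qed
  from has_partials_zero_constant[OF op con this]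
  obtain C2 where C2: "\<And>x. x \<in> \<Omega> \<Longrightarrow> B x = C2" by blast
  have "continuous_on (closure \<Omega>) B"
  proof -
    have c: "continuous_on (closure \<Omega>) (\<lambda>y. Re (u y))" "continuous_on (closure \<Omega>) (\<lambda>y. Im (u y))" "continuous_on (closure \<Omega>) \<rho>"
      using continuous_on_subset[OF smooth_open_continuous[OF s(1)] U(2)]
        continuous_on_subset[OF smooth_open_continuous[OF s(2)] U(2)]
        continuous_on_subset[OF smooth_open_continuous[OF U(3)] U(2)] by auto
    then have "continuous_on (closure \<Omega>) (\<lambda>y. \<rho> y powr (\<gamma> - 1))"
      using \<rho>p by (intro continuous_on_powr continuous_on_const) force+
    then show ?thesis unfolding B_def
      by (intro continuous_on_add continuous_on_mult continuous_on_const c)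
  qed
  then have Bc: "B x = C2" if "x \<in> closure \<Omega>" for x
    by (rule continuous_constant_on_closure[OF _ C2 that])
  have "\<rho> x powr (\<gamma> - 1) = (\<gamma> - 1) / \<gamma> * (C2 - (norm (u x))\<^sup>2 / 2)" if "x \<in> closure \<Omega>" for x
  proof -
    have "(norm (u x))\<^sup>2 = Re (u x) * Re (u x) + Im (u x) * Im (u x)"
      unfolding cmod_power2 by (simp add: power2_eq_square)
    then have "\<gamma> / (\<gamma> - 1) * \<rho> x powr (\<gamma> - 1) = C2 - (norm (u x))\<^sup>2 / 2"
      using Bc[OF that] by (simp add: B_def)
    then show ?thesis using \<gamma> by (simp add: field_simps)
  qed
  then show "\<exists>C2. \<forall>x\<in>closure \<Omega>. \<rho> x powr (\<gamma> - 1) = (\<gamma> - 1) / \<gamma> * (C2 - (norm (u x))\<^sup>2 / 2)" by blast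
qed

text \<open>The identity \<open>Re (f\<^sup>2 cnj f') = 0\<close> for \<open>f = u\<^sub>1 - \<i> u\<^sub>2\<close> expresses that the speed is constant
  along stream lines; it forces \<open>1 / f\<close> to be affine, and the boundary then decides.\<close>

theorem moving_solution_rotation:
  assumes dom: "connected_smooth_domain k \<Omega>" and k: "k \<ge> 2" and \<gamma>: "\<gamma> > 1"
    and U: "open U" "closure \<Omega> \<subseteq> U" "smooth_open U \<rho>" "smooth_open U u"
    and sol: "smooth_solution \<Omega> \<mu> \<beta> \<gamma> K \<rho>0 \<rho> u" and nv: "nonvacuum \<Omega> \<rho>"
    and pot: "\<And>x. x \<in> \<Omega> \<Longrightarrow> divg u x = 0 \<and> curl u x = 0"
    and mov: "z1 \<in> \<Omega>" "u z1 \<noteq> 0"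
  shows "\<exists>C1 z0. bounded_by_concentric_circles z0 \<Omega> \<and>
     (\<forall>z\<in>closure \<Omega>. z \<noteq> z0 \<and> cnj (u z) = \<i> * of_real C1 / (z - z0)) \<and>
     (\<exists>r>0. sphere z0 r \<subseteq> frontier \<Omega>)"
proof -
  have op: "open \<Omega>" and con: "connected \<Omega>" using dom by (auto simp: connected_smooth_domain_def)
  have \<Omega>U: "\<Omega> \<subseteq> U" using closure_subset U(2) by blast
  have "((\<lambda>z. cnj (u z)) has_field_derivative cnj (pd1 u z)) (at z)" if "z \<in> \<Omega>" for z
    using potential_flow_holomorphic[OF U(4)] \<Omega>U pot that by blast
  from reciprocal_affine[OF op con this bernoulli(2)[OF dom \<gamma> U sol nv pot] mov(1)] mov(2)
  obtain c :: real and d where cd: "\<And>z. z \<in> \<Omega> \<Longrightarrow> cnj (u z) * (\<i> * of_real c * z + d) = 1"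
    unfolding complex_cnj_zero_iff by blast
  have "continuous_on (closure \<Omega>) (\<lambda>z. cnj (u z) * (\<i> * of_real c * z + d))"
    using continuous_on_subset[OF smooth_open_continuous[OF U(4)] U(2)] by (intro continuous_intros)
  then have "cnj (u z) * (\<i> * of_real c * z + d) = 1" if "z \<in> closure \<Omega>" for z
    by (rule continuous_constant_on_closure[OF _ cd that])
  then show ?thesis
  proof (rule rotation_boundary[OF dom k])
    show "inner (u x) \<nu> = 0" if "x \<in> frontier \<Omega>" "outer_unit_normal \<Omega> x \<nu>" for x \<nu>
      using sol that unfolding smooth_solution_def by blast
  qed
qed

text \<open>The radii attained in the domain form an interval that omits \<open>r\<close> and comes close to \<open>R > r\<close>.\<close>

lemma concentric_closure_away_from_centre:
  assumes dom: "connected_smooth_domain k \<Omega>" and circ: "0 < r" "r < R" "frontier \<Omega> = sphere 0 r \<union> sphere 0 R"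
    and z: "z \<in> closure \<Omega>"
  shows "norm z \<ge> r"
proof -
  have op: "open \<Omega>" and con: "connected \<Omega>" using dom by (auto simp: connected_smooth_domain_def)
  have no: "norm y \<noteq> r" if "y \<in> \<Omega>" for y
  proof -
    have "y \<notin> frontier \<Omega>" using that op by (simp add: frontier_def interior_open)
    then show ?thesis unfolding circ(3) by simp
  qed
  have "complex_of_real R \<in> frontier \<Omega>" unfolding circ(3) using circ(1,2) by simp
  then have "complex_of_real R \<in> closure \<Omega>" by (simp add: frontier_def)
  then obtain y where y: "y \<in> \<Omega>" "dist y (of_real R) < R - r"
    using circ(2) unfolding closure_approachable by (meson diff_gt_0_iff_gt)
  have "norm y > r"
    using y(2) norm_triangle_ineq2[of "of_real R" "of_real R - y"] circ by (simp add: dist_norm norm_minus_commute)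
  have conn: "connected (norm ` \<Omega>)" using con by (intro connected_continuous_image continuous_intros)
  have "norm w \<ge> r" if w: "w \<in> \<Omega>" for w
  proof (rule ccontr)
    assume "\<not> norm w \<ge> r"
    then have "r \<in> norm ` \<Omega>"
      using connectedD_interval[OF conn, of "norm w" "norm y" r] w y(1) \<open>norm y > r\<close> by auto
    then show False using no by auto
  qed
  then have "closure \<Omega> \<subseteq> {w. r \<le> norm w}"
    by (intro closure_minimal) (auto intro!: closed_Collect_le continuous_intros)
  then show ?thesis using z by auto
qed

text \<open>On boundary curves contained in two circles around the origin the distance to the origin is
  constant, so normals are radial and the rotation is tangent to the boundary.\<close>

lemma rotation_tangent_to_circles:
  assumes circ: "frontier \<Omega> = sphere 0 r \<union> sphere 0 R" and \<nu>: "outer_unit_normal \<Omega> x \<nu>"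
  shows "inner (\<i> * x) \<nu> = 0"
proof -
  obtain p s where p: "smooth_loop p" "path_image p \<subseteq> frontier \<Omega>" "p s = x" "inner \<nu> (vector_derivative p (at s)) = 0"
    using \<nu> unfolding outer_unit_normal_def by blast
  let ?v = "vector_derivative p (at s)"
  have "(\<lambda>t. norm (p t)) ` UNIV \<subseteq> {r, R}"
    using p(2) circ smooth_loop_range[OF p(1)] by force
  then have "finite ((\<lambda>t. norm (p t)) ` UNIV)" using finite_subset by blast
  moreover have "continuous_on UNIV (\<lambda>t. norm (p t))"
    by (intro continuous_intros smooth_loop_continuous p)
  ultimately have "(\<lambda>t. norm (p t)) constant_on UNIV"
    using continuous_finite_range_constant connected_UNIV by blast
  then obtain a where a: "\<And>t. norm (p t) = a" by (auto simp: constant_on_def)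
  have "(p has_derivative (\<lambda>h. h *\<^sub>R ?v)) (at s)"
    using smooth_loop_has_vector_derivative[OF p(1)] by (simp add: has_vector_derivative_def)
  from has_derivative_inner[OF this this]
  have "((\<lambda>t. inner (p t) (p t)) has_derivative (\<lambda>h. inner (p s) (h *\<^sub>R ?v) + inner (h *\<^sub>R ?v) (p s))) (at s)" .
  moreover have "(\<lambda>t. inner (p t) (p t)) = (\<lambda>t. a\<^sup>2)" by (simp add: dot_square_norm a)
  ultimately have "((\<lambda>t. a\<^sup>2) has_derivative (\<lambda>h. inner (p s) (h *\<^sub>R ?v) + inner (h *\<^sub>R ?v) (p s))) (at s)" by simp
  then have "(\<lambda>h. inner (p s) (h *\<^sub>R ?v) + inner (h *\<^sub>R ?v) (p s)) = (\<lambda>h. 0)"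
    by (rule has_derivative_unique) simp
  from fun_cong[OF this, of 1] have "inner x ?v = 0" using p(3) by (simp add: inner_commute)
  then have "Im (cnj x * \<nu>) = 0"
    using cross_zero_if_orthogonal[of x ?v \<nu>] p(1,4) by (simp add: inner_commute smooth_loop_def)
  then show ?thesis by (simp add: inner_complex_def algebra_simps)
qed

lemma has_partials_field_derivative:
  assumes "(f has_field_derivative D) (at z)"
  shows "has_partials f D (\<i> * D) z"
proof -
  have "(*) D = (\<lambda>h. Re h *\<^sub>R D + Im h *\<^sub>R (\<i> * D))"
    by (auto simp: fun_eq_iff complex_eq_iff algebra_simps)
  then show ?thesis using assms by (simp add: has_partials_def has_field_derivative_def)
qed

text \<open>A rotation is a potential flow, so the viscous terms vanish, and the pressure balances the
  centripetal acceleration \<open>C1\<^sup>2 / |z|\<^sup>3\<close>.\<close>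

lemma rotation_is_solution:
  assumes dom: "connected_smooth_domain k \<Omega>" and \<gamma>: "\<gamma> > 1"
    and circ: "bounded_by_concentric_circles 0 \<Omega>" and K0: "\<And>x. x \<in> frontier \<Omega> \<Longrightarrow> K x = 0"
    and nv: "nonvacuum \<Omega> \<rho>" and mass: "(LINT x:\<Omega>|lebesgue. \<rho> x) = (LINT x:\<Omega>|lebesgue. \<rho>0 x)"
    and form: "\<And>z. z \<in> closure \<Omega> \<Longrightarrow> \<rho> z powr (\<gamma> - 1) = (\<gamma> - 1) / \<gamma> * (C2 - C1\<^sup>2 / (2 * (norm z)\<^sup>2))
        \<and> of_real (Re (u z)) - \<i> * of_real (Im (u z)) = \<i> * of_real C1 / z"
  shows "smooth_solution \<Omega> \<mu> \<beta> \<gamma> K \<rho>0 \<rho> u"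
proof -
  have op: "open \<Omega>" using dom by (auto simp: connected_smooth_domain_def)
  have cl: "\<Omega> \<subseteq> closure \<Omega>" by (rule closure_subset)
  obtain r R where rR: "0 < r" "r < R" "frontier \<Omega> = sphere 0 r \<union> sphere 0 R"
    using circ by (auto simp: bounded_by_concentric_circles_def)
  have nz: "z \<noteq> 0" if "z \<in> closure \<Omega>" for z
    using concentric_closure_away_from_centre[OF dom rR that] rR(1) by auto
  define N where "N z = Re z * Re z + Im z * Im z" for z
  have N: "N z = (norm z)\<^sup>2" for z unfolding N_def cmod_power2 by (simp add: power2_eq_square)
  define I where "I z = N z powr (-1)" for z
  have I: "I z = 1 / (norm z)\<^sup>2" if "z \<noteq> 0" for z using that by (simp add: I_def N powr_minus divide_inverse)
  define H where "H z = (\<gamma> - 1) / \<gamma> * (C2 + (- C1\<^sup>2 / 2) * I z)" for z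
  have H: "H z = (\<gamma> - 1) / \<gamma> * (C2 - C1\<^sup>2 / (2 * (norm z)\<^sup>2))" if "z \<noteq> 0" for z
    using I[OF that] by (simp add: H_def)
  define u' where "u' z = (C1 * I z) *\<^sub>R (- \<i> * z)" for z
  define \<rho>' where "\<rho>' z = H z powr (1 / (\<gamma> - 1))" for z
  have Ncont: "smooth_open S N" if "open S" for S
    unfolding N_def using that smooth_open_components[OF that smooth_open_ident[OF that]]
    by (intro smooth_open_add smooth_open_mult)
  have sI: "smooth_open S I" if "open S" "0 \<notin> S" for S
  proof -
    have "N z > 0" if "z \<in> S" for z using that \<open>0 \<notin> S\<close> by (auto simp: N)
    then show ?thesis unfolding I_def[abs_def] using Ncont[OF that(1)] that(1) by (intro smooth_open_powr) auto
  qed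
  have sH: "smooth_open S H" if "open S" "0 \<notin> S" for S
    unfolding H_def using that sI[OF that] by (intro smooth_open_mult smooth_open_add smooth_open_const)
  define U where "U = - {0} \<inter> H -` {0<..}"
  have o0: "open (- {0::complex})" by (simp add: open_Compl)
  have "continuous_on (- {0}) H" using smooth_open_continuous[OF sH[OF o0]] by simp
  then have "open U" unfolding U_def by (intro continuous_open_preimage[OF _ o0]) auto
  have "0 \<notin> U" by (simp add: U_def)
  have \<rho>p: "\<rho> z > 0" if "z \<in> closure \<Omega>" for z using nv that by (simp add: nonvacuum_def)
  have clU: "closure \<Omega> \<subseteq> U"
  proof
    fix z assume z: "z \<in> closure \<Omega>"
    then have "H z = \<rho> z powr (\<gamma> - 1)" using form[OF z] H[OF nz[OF z]] by simp
    then show "z \<in> U" using nz[OF z] \<rho>p[OF z] by (simp add: U_def)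
  qed
  then have \<Omega>U: "\<Omega> \<subseteq> U" using cl by blast
  have s\<rho>: "smooth_open U \<rho>'"
    unfolding \<rho>'_def[abs_def] using sH[OF \<open>open U\<close> \<open>0 \<notin> U\<close>] \<open>open U\<close> by (intro smooth_open_powr) (auto simp: U_def)
  have su: "smooth_open U u'"
    unfolding u'_def[abs_def]
    using sI[OF \<open>open U\<close> \<open>0 \<notin> U\<close>] \<open>open U\<close>
      smooth_open_bounded_linear[OF bounded_linear_mult_right[of "- \<i>"] \<open>open U\<close> smooth_open_ident[OF \<open>open U\<close>]]
    by (intro smooth_open_scaleR smooth_open_mult smooth_open_const)
  have cnju: "cnj (u' z) = \<i> * of_real C1 / z" if "z \<noteq> 0" for z
  proof -
    have "cnj (u' z) = of_real C1 * \<i> * (cnj z / of_real ((norm z)\<^sup>2))"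
      by (simp add: u'_def I[OF that] scaleR_conv_of_real)
    also have "cnj z / of_real ((norm z)\<^sup>2) = 1 / z"
      using complex_div_cnj[of 1 z] by simp
    finally show ?thesis by simp
  qed
  have eq: "\<rho>' x = \<rho> x \<and> u' x = u x" if x: "x \<in> closure \<Omega>" for x
  proof
    have "H x = \<rho> x powr (\<gamma> - 1)" using form[OF x] H[OF nz[OF x]] by simp
    then show "\<rho>' x = \<rho> x" using \<rho>p[OF x] \<gamma> by (simp add: \<rho>'_def powr_powr)
    have "cnj (u x) = of_real (Re (u x)) - \<i> * of_real (Im (u x))" by (simp add: complex_eq_iff)
    then have "cnj (u x) = cnj (u' x)" using form[OF x] cnju[OF nz[OF x]] by simp
    then show "u' x = u x" by simp
  qed
  have hpu: "has_partials u' (cnj (- \<i> * of_real C1 / z\<^sup>2)) (cnj (\<i> * (- \<i> * of_real C1 / z\<^sup>2))) z" if z: "z \<noteq> 0" for z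
  proof -
    have "((\<lambda>z. \<i> * of_real C1 / z) has_field_derivative (- \<i> * of_real C1 / z\<^sup>2)) (at z)"
      using z by (auto intro!: derivative_eq_intros simp: power2_eq_square)
    note D = has_partials_bounded_linear[OF bounded_linear_cnj has_partials_field_derivative[OF this]]
    show ?thesis
    proof (rule has_partials_cong_open[OF o0 _ _ D])
      fix y :: complex assume "y \<in> - {0}"
      then have "cnj (u' y) = \<i> * of_real C1 / y" by (intro cnju) simp
      from arg_cong[OF this, of cnj] show "cnj (\<i> * of_real C1 / y) = u' y" by simp
    qed (use z in simp)
  qed
  have pot: "divg u' y = 0 \<and> curl u' y = 0" if "y \<in> \<Omega>" for y
  proof -
    have y: "y \<noteq> 0" "y \<in> U" using that \<Omega>U \<open>0 \<notin> U\<close> by auto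
    have "Re (cnj D) + Im (cnj (\<i> * D)) = 0 \<and> Re (cnj (\<i> * D)) - Im (cnj D) = 0" for D
      by simp
    then show ?thesis
      unfolding divg_curl_eq[OF su y(2)] has_partials_pd[OF hpu[OF y(1)]] .
  qed
  have \<rho>'p: "\<rho>' y > 0" if "y \<in> U" for y using that by (simp add: U_def \<rho>'_def)
  have dyn: "pd1 \<rho>' x * Re (u' x) + pd2 \<rho>' x * Im (u' x) = 0"
     "\<rho>' x * (Re (u' x) * Re (pd1 u' x) + Im (u' x) * Im (pd1 u' x)) + \<gamma> * \<rho>' x powr (\<gamma> - 1) * pd1 \<rho>' x = 0"
     "\<rho>' x * (Re (u' x) * Re (pd2 u' x) + Im (u' x) * Im (pd2 u' x)) + \<gamma> * \<rho>' x powr (\<gamma> - 1) * pd2 \<rho>' x = 0"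
    if x: "x \<in> \<Omega>" for x
  proof -
    have xU: "x \<in> U" and x0: "x \<noteq> 0" using x \<Omega>U \<open>0 \<notin> U\<close> by auto
    define a b where "a = Re x" and "b = Im x"
    \<comment> \<open>With \<open>n = 1 / |x|\<^sup>2\<close> all derivatives at \<open>x\<close> become polynomials in \<open>a\<close>, \<open>b\<close> and \<open>n\<close>.\<close>
    define n where "n = I x"
    have n: "n * (a * a + b * b) = 1" using I[OF x0] x0 N[of x] by (simp add: n_def N_def a_def b_def)
    have hN: "has_partials N (1 * a + a * 1 + (0 * b + b * 0)) (0 * a + a * 0 + (1 * b + b * 1)) x"
    proof -
      have "has_partials (\<lambda>z::complex. z) 1 \<i> x"
        using has_partials_field_derivative[OF DERIV_ident] by simp
      note id = has_partials_bounded_linear[OF bounded_linear_Re this] has_partials_bounded_linear[OF bounded_linear_Im this]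
      show ?thesis unfolding N_def[abs_def]
        using has_partials_add[OF has_partials_mult[OF id(1) id(1)] has_partials_mult[OF id(2) id(2)]]
        by (simp add: a_def b_def)
    qed
    have hI: "has_partials I (- (n * n) * (2 * a)) (- (n * n) * (2 * b)) x"
    proof -
      have "N x > 0" using x0 by (simp add: N)
      then have "((\<lambda>t. t powr (-1)) has_real_derivative (-1) * N x powr (-1 - 1)) (at (N x) within {0..})"
        using has_real_derivative_powr has_field_derivative_at_within by blast
      from has_partials_chain_nonneg[OF open_UNIV UNIV_I _ hN this]
      have "has_partials I ((-1) * N x powr (-1 - 1) * (2 * a)) ((-1) * N x powr (-1 - 1) * (2 * b)) x"
        by (simp add: I_def[abs_def] N)
      moreover have "N x powr (-1 - 1) = n * n"
        unfolding n_def I_def powr_add[symmetric] by simp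
      ultimately show ?thesis by simp
    qed
    define \<kappa> where "\<kappa> = (\<gamma> - 1) / \<gamma> * C1\<^sup>2 * (n * n)"
    have hH: "has_partials H (\<kappa> * a) (\<kappa> * b) x"
    proof -
      note h = has_partials_bounded_linear[OF bounded_linear_mult_right
          has_partials_add[OF has_partials_const has_partials_bounded_linear[OF bounded_linear_mult_right hI, of "- C1\<^sup>2 / 2"], of C2],
          of "(\<gamma> - 1) / \<gamma>"]
      show ?thesis using h unfolding H_def[abs_def] \<kappa>_def by (simp add: algebra_simps)
    qed
    define e where "e = 1 / (\<gamma> - 1)"
    define q where "q = e * H x powr (e - 1)"
    have Hx: "H x > 0" using xU by (simp add: U_def)
    have h\<rho>: "has_partials \<rho>' (q * (\<kappa> * a)) (q * (\<kappa> * b)) x"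
    proof -
      have "((\<lambda>t. t powr e) has_real_derivative q) (at (H x) within {0..})"
        unfolding q_def using Hx has_real_derivative_powr has_field_derivative_at_within by blast
      then show ?thesis unfolding \<rho>'_def[abs_def] e_def[symmetric]
        by (intro has_partials_chain_nonneg[OF \<open>open U\<close> xU _ hH]) (auto simp: U_def)
    qed
    have ux: "Re (u' x) = C1 * n * b" "Im (u' x) = - (C1 * n * a)"
      by (simp_all add: u'_def n_def a_def b_def)
    have inv: "1 / x\<^sup>2 = of_real (n * n) * (cnj x)\<^sup>2"
    proof -
      have "1 / x = of_real n * cnj x" using complex_div_cnj[of 1 x] I[OF x0] by (simp add: n_def)
      then show ?thesis by (metis power_one_over power_mult_distrib power2_eq_square of_real_mult power_divide power_one)
    qed
    have D: "- \<i> * of_real C1 / x\<^sup>2 = - \<i> * of_real (C1 * (n * n)) * (cnj x)\<^sup>2"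
    proof -
      have "- \<i> * of_real C1 / x\<^sup>2 = - \<i> * of_real C1 * (1 / x\<^sup>2)" by simp
      then show ?thesis unfolding inv by simp
    qed
    have px: "pd1 u' x = cnj (- \<i> * of_real (C1 * (n * n)) * (cnj x)\<^sup>2)"
      "pd2 u' x = cnj (\<i> * (- \<i> * of_real (C1 * (n * n)) * (cnj x)\<^sup>2))"
      using has_partials_pd[OF hpu[OF x0]] unfolding D by auto
    have sq: "(cnj x)\<^sup>2 = Complex (a * a - b * b) (- 2 * a * b)"
      by (simp add: complex_eq_iff a_def b_def power2_eq_square)
    have pxc: "Re (pd1 u' x) = - (C1 * (n * n)) * (2 * a * b)" "Im (pd1 u' x) = C1 * (n * n) * (a * a - b * b)"
      "Re (pd2 u' x) = C1 * (n * n) * (a * a - b * b)" "Im (pd2 u' x) = C1 * (n * n) * (2 * a * b)"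
      unfolding px sq by simp_all
    have pow: "\<rho>' x powr (\<gamma> - 1) * q * (\<gamma> - 1) = \<rho>' x"
    proof -
      have "\<rho>' x powr (\<gamma> - 1) = H x" using Hx \<gamma> by (simp add: \<rho>'_def powr_powr)
      moreover have "H x * H x powr (e - 1) = H x powr e" using Hx powr_mult_base[of "H x" "e - 1"] by simp
      ultimately show ?thesis using \<gamma> by (simp add: q_def e_def \<rho>'_def)
    qed
    then have main: "\<gamma> * \<rho>' x powr (\<gamma> - 1) * (q * \<kappa>) = \<rho>' x * (C1\<^sup>2 * (n * n))"
    proof -
      have "\<gamma> * \<rho>' x powr (\<gamma> - 1) * (q * \<kappa>) = (\<rho>' x powr (\<gamma> - 1) * q * (\<gamma> - 1)) * (C1\<^sup>2 * (n * n))"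
        using \<gamma> by (simp add: \<kappa>_def)
      then show ?thesis using pow by simp
    qed
    note p\<rho> = has_partials_pd[OF h\<rho>]
    show "pd1 \<rho>' x * Re (u' x) + pd2 \<rho>' x * Im (u' x) = 0"
      unfolding p\<rho> ux by (simp add: algebra_simps)
    have "Re (u' x) * Re (pd1 u' x) + Im (u' x) * Im (pd1 u' x) = - (C1\<^sup>2 * (n * n)) * a"
      "Re (u' x) * Re (pd2 u' x) + Im (u' x) * Im (pd2 u' x) = - (C1\<^sup>2 * (n * n)) * b"
      unfolding ux pxc using n by algebra+
    note conv = this
    have g: "\<gamma> * \<rho>' x powr (\<gamma> - 1) * (q * (\<kappa> * w)) = \<rho>' x * (C1\<^sup>2 * (n * n)) * w" for w
      using main by (simp add: mult.assoc[symmetric])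
    show "\<rho>' x * (Re (u' x) * Re (pd1 u' x) + Im (u' x) * Im (pd1 u' x)) + \<gamma> * \<rho>' x powr (\<gamma> - 1) * pd1 \<rho>' x = 0"
      "\<rho>' x * (Re (u' x) * Re (pd2 u' x) + Im (u' x) * Im (pd2 u' x)) + \<gamma> * \<rho>' x powr (\<gamma> - 1) * pd2 \<rho>' x = 0"
      unfolding conv p\<rho> g by simp_all
  qed
  have \<rho>'0: "\<rho>' y \<ge> 0" if "y \<in> \<Omega>" for y using \<rho>'p[of y] that \<Omega>U by (auto intro: less_imp_le)
  have "smooth_solution \<Omega> \<mu> \<beta> \<gamma> K \<rho>0 \<rho>' u'"
    unfolding smooth_solution_def
  proof (intro conjI ballI allI impI)
    show "smooth_set (closure \<Omega>) \<rho>'" "smooth_set (closure \<Omega>) u'"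
      unfolding smooth_set_def using \<open>open U\<close> clU s\<rho> su by blast+
    show "\<rho>' x \<ge> 0" if "x \<in> closure \<Omega>" for x using \<rho>'p clU that by (auto intro: less_imp_le)
    have "(LINT x:\<Omega>|lebesgue. \<rho>' x) = (LINT x:\<Omega>|lebesgue. \<rho> x)"
      using eq cl op by (intro set_lebesgue_integral_cong) auto
    then show "(LINT x:\<Omega>|lebesgue. \<rho>' x) = (LINT x:\<Omega>|lebesgue. \<rho>0 x)" using mass by simp
    fix x assume x: "x \<in> \<Omega>"
    note E = potential_flow_equations[OF op \<open>open U\<close> \<Omega>U s\<rho> su \<rho>'0 \<gamma> pot x]
    show d0: "divg (\<lambda>y. \<rho>' y *\<^sub>R u' y) x = 0" using E(2) dyn(1)[OF x] by simp
    show "(\<lambda>y. (\<mu> + \<rho>' y powr \<beta>) * divg u' y) differentiable at x" using E(1) by blast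
    show "div_tensor (\<lambda>y. \<rho>' y *\<^sub>R u' y) u' x + grad (\<lambda>y. \<rho>' y powr \<gamma>) x =
         \<mu> *\<^sub>R laplacian u' x + grad (\<lambda>y. (\<mu> + \<rho>' y powr \<beta>) * divg u' y) x"
      using E(3)[of \<mu> \<beta>] d0 dyn(2,3)[OF x] by blast
  next
    fix x \<nu> assume x: "x \<in> frontier \<Omega>" and \<nu>: "outer_unit_normal \<Omega> x \<nu>"
    have "u' x = (- (C1 * I x)) *\<^sub>R (\<i> * x)" by (simp add: u'_def)
    then show "inner (u' x) \<nu> = 0" using rotation_tangent_to_circles[OF rR(3) \<nu>] by simp
    have "\<forall>\<^sub>F y in at x within \<Omega>. curl u' y = 0"
      using pot by (auto simp: eventually_at_filter intro!: always_eventually)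
    then show "(curl u' \<longlongrightarrow> - K x * inner (u' x) (perp \<nu>)) (at x within \<Omega>)"
      using K0[OF x] by (simp add: tendsto_eventually)
  qed
  from smooth_solution_cong[OF op eq this] show ?thesis .
qed

text \<open>Near a boundary point where \<open>K\<close> does not vanish the two boundary conditions leave no velocity, and
  an arc without velocity stops the whole flow.\<close>

lemma friction_stops_flow:
  assumes dom: "connected_smooth_domain k \<Omega>"
    and K: "smooth_set (frontier \<Omega>) K" and x0: "x0 \<in> frontier \<Omega>" "K x0 \<noteq> 0"
    and U: "open U" "closure \<Omega> \<subseteq> U" "smooth_open U u"
    and sol: "smooth_solution \<Omega> \<mu> \<beta> \<gamma> K \<rho>0 \<rho> u"
    and pot: "\<And>x. x \<in> \<Omega> \<Longrightarrow> divg u x = 0 \<and> curl u x = 0"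
    and x: "x \<in> \<Omega>"
  shows "u x = 0"
proof -
  have op: "open \<Omega>" using dom by (auto simp: connected_smooth_domain_def)
  obtain U' g where g: "open U'" "frontier \<Omega> \<subseteq> U'" "smooth_open U' g" "\<forall>x\<in>frontier \<Omega>. g x = K x"
    using K unfolding smooth_set_def by blast
  have "isCont g x0"
    using smooth_open_continuous[OF g(3)] g(1,2) x0(1) continuous_on_eq_continuous_at by blast
  moreover have "g x0 \<noteq> 0" using g(4) x0 by simp
  ultimately obtain e where e: "e > 0" "\<And>y. dist x0 y < e \<Longrightarrow> g y \<noteq> 0"
    using continuous_at_avoid[of x0 g 0] by blast
  have van: "u y = 0" if y: "y \<in> frontier \<Omega>" "y \<in> ball x0 e" for y
  proof -
    obtain \<nu> where \<nu>: "outer_unit_normal \<Omega> y \<nu>" by (rule outer_unit_normal_exists[OF dom y(1)])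
    have bc: "inner (u y) \<nu> = 0" "(curl u \<longlongrightarrow> - K y * inner (u y) (perp \<nu>)) (at y within \<Omega>)"
      using sol y(1) \<nu> unfolding smooth_solution_def by blast+
    have ycl: "y \<in> closure \<Omega>" "y \<notin> \<Omega>" using y(1) op by (auto simp: frontier_def interior_open)
    have "\<forall>\<^sub>F z in at y within \<Omega>. curl u z = 0"
      using pot by (auto simp: eventually_at_filter intro!: always_eventually)
    then have "(curl u \<longlongrightarrow> 0) (at y within \<Omega>)" by (rule tendsto_eventually)
    moreover have "at y within \<Omega> \<noteq> bot"
      using ycl by (simp add: trivial_limit_within islimpt_in_closure)
    ultimately have "- K y * inner (u y) (perp \<nu>) = 0"
      using bc(2) tendsto_unique by blast
    moreover have "K y \<noteq> 0" using e(2)[of y] g(4) y by auto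
    ultimately have p: "inner (u y) (perp \<nu>) = 0" by simp
    have n: "Re \<nu> * Re \<nu> + Im \<nu> * Im \<nu> = 1"
      using \<nu> cmod_power2[of \<nu>] by (simp add: outer_unit_normal_def power2_eq_square)
    have "Re (u y) * Re \<nu> + Im (u y) * Im \<nu> = 0" "Re (u y) * Im \<nu> - Im (u y) * Re \<nu> = 0"
      using bc(1) p by (simp_all add: inner_complex_def perp_def)
    then have "Re (u y) = 0" "Im (u y) = 0" using n by algebra+
    then show ?thesis by (simp add: complex_eq_iff)
  qed
  show ?thesis
    by (rule potential_flow_zero_on_arc[OF dom U pot x0(1) e(1) van x])
qed

theorem theorem1p1:
  fixes k :: nat and \<Omega> :: "complex set" and \<mu> \<beta> \<gamma> :: real and K \<rho>0 :: "complex \<Rightarrow> real"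
  assumes k: "k \<ge> 2"
    and dom: "connected_smooth_domain k \<Omega>"
    and params: "\<mu> > 0" "\<beta> > 0" "\<gamma> > 1"
    and K: "smooth_set (frontier \<Omega>) K" "\<forall>x\<in>frontier \<Omega>. K x \<ge> 0"
    and \<rho>0: "\<forall>x\<in>\<Omega>. \<rho>0 x \<ge> 0" "set_integrable lebesgue \<Omega> \<rho>0" "(LINT x:\<Omega>|lebesgue. \<rho>0 x) > 0"
  shows "((\<exists>x\<in>frontier \<Omega>. K x \<noteq> 0) \<longrightarrow>
      (\<forall>\<rho> u. smooth_solution \<Omega> \<mu> \<beta> \<gamma> K \<rho>0 \<rho> u \<longleftrightarrow> trivial_solution \<Omega> \<rho>0 \<rho> u))
    \<and> ((\<forall>x\<in>frontier \<Omega>. K x = 0) \<and> k = 2 \<and> bounded_by_concentric_circles 0 \<Omega> \<longrightarrow>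
      (\<forall>\<rho> u. smooth_solution \<Omega> \<mu> \<beta> \<gamma> K \<rho>0 \<rho> u \<and> nonvacuum \<Omega> \<rho> \<longleftrightarrow>
         nonvacuum \<Omega> \<rho> \<and> (LINT x:\<Omega>|lebesgue. \<rho> x) = (LINT x:\<Omega>|lebesgue. \<rho>0 x) \<and>
         (\<exists>C1 C2 :: real. \<forall>z\<in>closure \<Omega>.
            \<rho> z powr (\<gamma> - 1) = (\<gamma> - 1) / \<gamma> * (C2 - C1\<^sup>2 / (2 * (norm z)\<^sup>2)) \<and>
            of_real (Re (u z)) - \<i> * of_real (Im (u z)) = \<i> * of_real C1 / z)))
    \<and> ((\<forall>x\<in>frontier \<Omega>. K x = 0) \<and> \<not> (\<exists>c. bounded_by_concentric_circles c \<Omega>) \<longrightarrow>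
      (\<forall>\<rho> u. smooth_solution \<Omega> \<mu> \<beta> \<gamma> K \<rho>0 \<rho> u \<and> nonvacuum \<Omega> \<rho> \<longleftrightarrow> trivial_solution \<Omega> \<rho>0 \<rho> u))"
proof -
  have op: "open \<Omega>" using dom by (simp add: connected_smooth_domain_def)
  have K0: "K x \<ge> 0" if "x \<in> frontier \<Omega>" for x using K(2) that by blast
  have triv: "smooth_solution \<Omega> \<mu> \<beta> \<gamma> K \<rho>0 \<rho> u" "nonvacuum \<Omega> \<rho>" if "trivial_solution \<Omega> \<rho>0 \<rho> u" for \<rho> u
    using trivial_solution_smooth_solution[OF dom params(3) \<rho>0(3) that] by blast+
  \<comment> \<open>Everything that is said about a solution concerns its values on the closure, so it may be
    replaced by a smooth extension, to which the energy identity applies.\<close>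
  have ext: "\<exists>U \<rho>' u'. open U \<and> closure \<Omega> \<subseteq> U \<and> smooth_open U \<rho>' \<and> smooth_open U u' \<and>
      (\<forall>x\<in>closure \<Omega>. \<rho>' x = \<rho> x \<and> u' x = u x) \<and> smooth_solution \<Omega> \<mu> \<beta> \<gamma> K \<rho>0 \<rho>' u' \<and>
      (\<forall>x\<in>\<Omega>. divg u' x = 0 \<and> curl u' x = 0)"
    if sol: "smooth_solution \<Omega> \<mu> \<beta> \<gamma> K \<rho>0 \<rho> u" for \<rho> u
  proof -
    from smooth_solution_extension[OF op sol] obtain U \<rho>' u' where
      E: "open U" "closure \<Omega> \<subseteq> U" "smooth_open U \<rho>'" "smooth_open U u'"
      "\<forall>x\<in>closure \<Omega>. \<rho>' x = \<rho> x \<and> u' x = u x" "smooth_solution \<Omega> \<mu> \<beta> \<gamma> K \<rho>0 \<rho>' u'" by blast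
    then show ?thesis
      using solution_potential[OF dom params K0 E(1-4,6)] by (intro exI[of _ U] exI[of _ \<rho>'] exI[of _ u']) simp
  qed
  have triv_cong: "trivial_solution \<Omega> \<rho>0 \<rho> u"
    if "trivial_solution \<Omega> \<rho>0 \<rho>' u'" "\<forall>x\<in>closure \<Omega>. \<rho>' x = \<rho> x \<and> u' x = u x" for \<rho> \<rho>' u u'
    using that by (auto simp: trivial_solution_def)
  have nv_cong: "nonvacuum \<Omega> \<rho>'"
    if "nonvacuum \<Omega> \<rho>" "\<forall>x\<in>closure \<Omega>. \<rho>' x = \<rho> x \<and> u' x = (u x :: complex)" for \<rho> \<rho>' u u'
    using that by (auto simp: nonvacuum_def)
  have a: "trivial_solution \<Omega> \<rho>0 \<rho> u"
    if sol: "smooth_solution \<Omega> \<mu> \<beta> \<gamma> K \<rho>0 \<rho> u" and x0: "x0 \<in> frontier \<Omega>" "K x0 \<noteq> 0" for \<rho> u x0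
  proof -
    from ext[OF sol] obtain U \<rho>' u' where E: "open U" "closure \<Omega> \<subseteq> U" "smooth_open U \<rho>'" "smooth_open U u'"
      "\<forall>x\<in>closure \<Omega>. \<rho>' x = \<rho> x \<and> u' x = u x" "smooth_solution \<Omega> \<mu> \<beta> \<gamma> K \<rho>0 \<rho>' u'"
      "\<forall>x\<in>\<Omega>. divg u' x = 0 \<and> curl u' x = 0" by blast
    have "u' x = 0" if "x \<in> \<Omega>" for x
      using friction_stops_flow[OF dom K(1) x0 E(1,2,4,6) bspec[OF E(7)] that] .
    then show ?thesis
      using triv_cong[OF solution_at_rest_trivial[OF dom params(3) E(1-4,6)] E(5)] by blast
  qed
  have c: "trivial_solution \<Omega> \<rho>0 \<rho> u \<or> (\<exists>C1 z0. bounded_by_concentric_circles z0 \<Omega> \<and>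
     (\<forall>z\<in>closure \<Omega>. z \<noteq> z0 \<and> cnj (u z) = \<i> * of_real C1 / (z - z0)) \<and>
     (\<exists>r>0. sphere z0 r \<subseteq> frontier \<Omega>))"
    and bern: "\<exists>C2. \<forall>x\<in>closure \<Omega>. \<rho> x powr (\<gamma> - 1) = (\<gamma> - 1) / \<gamma> * (C2 - (norm (u x))\<^sup>2 / 2)"
    if sol: "smooth_solution \<Omega> \<mu> \<beta> \<gamma> K \<rho>0 \<rho> u" and nv: "nonvacuum \<Omega> \<rho>" for \<rho> u
  proof -
    from ext[OF sol] obtain U \<rho>' u' where E: "open U" "closure \<Omega> \<subseteq> U" "smooth_open U \<rho>'" "smooth_open U u'"
      "\<forall>x\<in>closure \<Omega>. \<rho>' x = \<rho> x \<and> u' x = u x" "smooth_solution \<Omega> \<mu> \<beta> \<gamma> K \<rho>0 \<rho>' u'"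
      "\<forall>x\<in>\<Omega>. divg u' x = 0 \<and> curl u' x = 0" by blast
    note nv' = nv_cong[OF nv E(5)]
    show "\<exists>C2. \<forall>x\<in>closure \<Omega>. \<rho> x powr (\<gamma> - 1) = (\<gamma> - 1) / \<gamma> * (C2 - (norm (u x))\<^sup>2 / 2)"
      using bernoulli(1)[OF dom params(3) E(1-4,6) nv' bspec[OF E(7)]] E(5) by simp
    show "trivial_solution \<Omega> \<rho>0 \<rho> u \<or> (\<exists>C1 z0. bounded_by_concentric_circles z0 \<Omega> \<and>
     (\<forall>z\<in>closure \<Omega>. z \<noteq> z0 \<and> cnj (u z) = \<i> * of_real C1 / (z - z0)) \<and>
     (\<exists>r>0. sphere z0 r \<subseteq> frontier \<Omega>))"
    proof (cases "\<forall>x\<in>\<Omega>. u' x = 0")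
      case True
      then show ?thesis
        using triv_cong[OF solution_at_rest_trivial[OF dom params(3) E(1-4,6)] E(5)] by blast
    next
      case False
      then obtain z1 where z1: "z1 \<in> \<Omega>" "u' z1 \<noteq> 0" by blast
      show ?thesis
        using moving_solution_rotation[OF dom k params(3) E(1-4,6) nv' bspec[OF E(7)] z1] E(5) by simp
    qed
  qed
  have cnj_eq: "cnj w = of_real (Re w) - \<i> * of_real (Im w)" for w by (simp add: complex_eq_iff)
  have b: "\<exists>C1 C2 :: real. \<forall>z\<in>closure \<Omega>.
            \<rho> z powr (\<gamma> - 1) = (\<gamma> - 1) / \<gamma> * (C2 - C1\<^sup>2 / (2 * (norm z)\<^sup>2)) \<and>
            of_real (Re (u z)) - \<i> * of_real (Im (u z)) = \<i> * of_real C1 / z"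
    if sol: "smooth_solution \<Omega> \<mu> \<beta> \<gamma> K \<rho>0 \<rho> u" and nv: "nonvacuum \<Omega> \<rho>"
      and circ: "bounded_by_concentric_circles 0 \<Omega>" for \<rho> u
  proof -
    obtain C2 where C2: "\<And>x. x \<in> closure \<Omega> \<Longrightarrow> \<rho> x powr (\<gamma> - 1) = (\<gamma> - 1) / \<gamma> * (C2 - (norm (u x))\<^sup>2 / 2)"
      using bern[OF sol nv] by blast
    have "\<exists>C1. \<forall>z\<in>closure \<Omega>. cnj (u z) = \<i> * of_real C1 / z"
    proof (cases "trivial_solution \<Omega> \<rho>0 \<rho> u")
      case True
      then show ?thesis by (intro exI[of _ 0]) (simp add: trivial_solution_def)
    next
      case False
      with c[OF sol nv] obtain C1 z0 r where
        *: "\<forall>z\<in>closure \<Omega>. z \<noteq> z0 \<and> cnj (u z) = \<i> * of_real C1 / (z - z0)"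
        "r > 0" "sphere z0 r \<subseteq> frontier \<Omega>" by blast
      have "z0 = 0" by (rule concentric_centre_unique[OF *(3,2) circ])
      then show ?thesis using *(1) by auto
    qed
    then obtain C1 where C1: "\<And>z. z \<in> closure \<Omega> \<Longrightarrow> cnj (u z) = \<i> * of_real C1 / z" by blast
    have n: "(norm (u z))\<^sup>2 / 2 = C1\<^sup>2 / (2 * (norm z)\<^sup>2)" if "z \<in> closure \<Omega>" for z
    proof -
      have "norm (u z) = \<bar>C1\<bar> / norm z"
        using arg_cong[OF C1[OF that], of norm] by (simp add: norm_divide norm_mult)
      then show ?thesis by (simp add: power_divide)
    qed
    show ?thesis
      using C2 n C1 unfolding cnj_eq by (intro exI[of _ C1] exI[of _ C2]) simp
  qed
  show ?thesis
  proof (intro conjI impI allI)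
    fix \<rho> u
    show "smooth_solution \<Omega> \<mu> \<beta> \<gamma> K \<rho>0 \<rho> u \<longleftrightarrow> trivial_solution \<Omega> \<rho>0 \<rho> u"
      if "\<exists>x\<in>frontier \<Omega>. K x \<noteq> 0"
      using that a triv(1) by blast
    show "smooth_solution \<Omega> \<mu> \<beta> \<gamma> K \<rho>0 \<rho> u \<and> nonvacuum \<Omega> \<rho> \<longleftrightarrow>
         nonvacuum \<Omega> \<rho> \<and> (LINT x:\<Omega>|lebesgue. \<rho> x) = (LINT x:\<Omega>|lebesgue. \<rho>0 x) \<and>
         (\<exists>C1 C2 :: real. \<forall>z\<in>closure \<Omega>.
            \<rho> z powr (\<gamma> - 1) = (\<gamma> - 1) / \<gamma> * (C2 - C1\<^sup>2 / (2 * (norm z)\<^sup>2)) \<and>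
            of_real (Re (u z)) - \<i> * of_real (Im (u z)) = \<i> * of_real C1 / z)"
      if h: "(\<forall>x\<in>frontier \<Omega>. K x = 0) \<and> k = 2 \<and> bounded_by_concentric_circles 0 \<Omega>"
    proof
      assume s: "smooth_solution \<Omega> \<mu> \<beta> \<gamma> K \<rho>0 \<rho> u \<and> nonvacuum \<Omega> \<rho>"
      then have "(LINT x:\<Omega>|lebesgue. \<rho> x) = (LINT x:\<Omega>|lebesgue. \<rho>0 x)" by (simp add: smooth_solution_def)
      then show "nonvacuum \<Omega> \<rho> \<and> (LINT x:\<Omega>|lebesgue. \<rho> x) = (LINT x:\<Omega>|lebesgue. \<rho>0 x) \<and>
         (\<exists>C1 C2 :: real. \<forall>z\<in>closure \<Omega>.
            \<rho> z powr (\<gamma> - 1) = (\<gamma> - 1) / \<gamma> * (C2 - C1\<^sup>2 / (2 * (norm z)\<^sup>2)) \<and>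
            of_real (Re (u z)) - \<i> * of_real (Im (u z)) = \<i> * of_real C1 / z)"
        using b s h by blast
    next
      assume s: "nonvacuum \<Omega> \<rho> \<and> (LINT x:\<Omega>|lebesgue. \<rho> x) = (LINT x:\<Omega>|lebesgue. \<rho>0 x) \<and>
         (\<exists>C1 C2 :: real. \<forall>z\<in>closure \<Omega>.
            \<rho> z powr (\<gamma> - 1) = (\<gamma> - 1) / \<gamma> * (C2 - C1\<^sup>2 / (2 * (norm z)\<^sup>2)) \<and>
            of_real (Re (u z)) - \<i> * of_real (Im (u z)) = \<i> * of_real C1 / z)"
      then obtain C1 C2 :: real where C: "\<forall>z\<in>closure \<Omega>.
            \<rho> z powr (\<gamma> - 1) = (\<gamma> - 1) / \<gamma> * (C2 - C1\<^sup>2 / (2 * (norm z)\<^sup>2)) \<and>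
            of_real (Re (u z)) - \<i> * of_real (Im (u z)) = \<i> * of_real C1 / z" by blast
      have Kz: "K x = 0" if "x \<in> frontier \<Omega>" for x using h that by blast
      have "smooth_solution \<Omega> \<mu> \<beta> \<gamma> K \<rho>0 \<rho> u"
        by (rule rotation_is_solution[where ?C1.0 = C1 and ?C2.0 = C2,
              OF dom params(3) conjunct2[OF conjunct2[OF h]] Kz conjunct1[OF s]
              conjunct1[OF conjunct2[OF s]] bspec[OF C]])
      then show "smooth_solution \<Omega> \<mu> \<beta> \<gamma> K \<rho>0 \<rho> u \<and> nonvacuum \<Omega> \<rho>" using s by blast
    qed
    show "smooth_solution \<Omega> \<mu> \<beta> \<gamma> K \<rho>0 \<rho> u \<and> nonvacuum \<Omega> \<rho> \<longleftrightarrow> trivial_solution \<Omega> \<rho>0 \<rho> u"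
      if "(\<forall>x\<in>frontier \<Omega>. K x = 0) \<and> \<not> (\<exists>c. bounded_by_concentric_circles c \<Omega>)"
      using that c triv by blast
  qed
qed

end
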